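(* For every real $\alpha$ with $0<\alpha<2$ there exist $\varepsilon=\varepsilon(\alpha)>0$, depending only on $\alpha$, and a constant $C>0$ (depending at most on $\alpha$; in particular independent of $p$, $k$, $\mathcal{P}$, $\mathcal{L}$) such that the following holds. Let $p$ be a prime, $k\ge 1$ an integer, $R_k=\mathbb{Z}/p^k\mathbb{Z}$, let $\mathcal{P}$ be a set of points of $R_k^2$ and $\mathcal{L}$ a set of lines in $R_k^2$ such that every two distinct lines of $\mathcal{L}$ are either $1$-separated in direction or $1$-separated in distance. Suppose $|\mathcal{P}|,|\mathcal{L}|\le N=p^{\alpha}$. Then $$|\mathcal{I}(\mathcal{P},\mathcal{L})|\le C\,N^{\frac32-\varepsilon}.$$
   Context: $p$ is a prime and $R_k=\mathbb{Z}/p^k\mathbb{Z}$. For $0\le j\le k$, $\pi_j:R_k^2\to R_j^2$ is reduction mod $p^j$. Distance: for $x,y\in R_k^2$, $\|x-y\|=p^{-j}$ where $j\in\{0,\dots,k\}$ is the largest such that $p^j$ divides both coordinates of $x-y$ (so $\|0\|=p^{-k}$). Lines and directions: let $R_k^{2,\times}$ be the set of elements of $R_k^2$ with at least one invertible coordinate. A direction is a class in $\mathbb{P}R_k^1=R_k^{2,\times}/R_k^{\times}$. A line in $R_k^2$ with direction $b$ is a set $\{a+tb:t\in R_k\}$ with $a\in R_k^2$, $b\in R_k^{2,\times}$ (only such nondegenerate lines are considered). $\pi_j$ maps lines to lines. Angle: for directions $b,b'$, $\angle(b,b')\le p^{-j}$ if there are representatives $rb$, $r'b'$ ($r,r'$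 units) with $p^j\mid rb-r'b'$; $\angle(b,b')=p^{-j}$ if $\angle(b,b')\le p^{-j}$ and either $j=k$ or $\angle(b,b')\not\le p^{-(j+1)}$. The angle $\angle(l,l')$ of two lines is the angle of their directions. Separation: two lines $l,l'$ are $1$-separated in direction if $\angle(l,l')\ge 1$, i.e. $\angle(l,l')=1$. Two disjoint lines $l,l'$ with $\angle(l,l')=p^{-r}$ ($1\le r\le k$) are at distance $p^{-j}$, $j<r$, if the distance between the parallel lines $\pi_r(l)$ and $\pi_r(l')$ in $R_r^2$ (the minimum of $\|x-y\|$ over $x\in\pi_r(l)$, $y\in\pi_r(l')$) is $p^{-j}$. They are $1$-separated in distance if they are disjoint with distance $\ge 1$ (i.e. equal to $1$). Incidences: $\mathcal{I}(\mathcal{P},\mathcal{L})=\{(q,l)\in\mathcal{P}\times\mathcal{L}:q\in l\}$. *)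

theory Defs
  imports Complex_Main "HOL-Number_Theory.Residues"
begin

text \<open>
  The ring \<open>R\<^sub>k = \<int>/p\<^sup>k\<int>\<close> is the library ring of residues with carrier \<open>{0..p^k - 1}\<close>.  For
  \<open>k = 0\<close> the library's \<open>\<one>\<close> would be \<open>1\<close> rather than \<open>0\<close>; the ring structure is only ever used
  for \<open>k \<ge> 1\<close>.
\<close>

definition Rk :: "nat \<Rightarrow> nat \<Rightarrow> int ring" where
  "Rk p k = residue_ring (int p ^ k)"

definition plane :: "nat \<Rightarrow> nat \<Rightarrow> (int \<times> int) set" where
  "plane p k = carrier (Rk p k) \<times> carrier (Rk p k)"

definition padd :: "nat \<Rightarrow> nat \<Rightarrow> int \<times> int \<Rightarrow> int \<times> int \<Rightarrow> int \<times> int" where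
  "padd p k x y = (fst x \<oplus>\<^bsub>Rk p k\<^esub> fst y, snd x \<oplus>\<^bsub>Rk p k\<^esub> snd y)"

definition pscale :: "nat \<Rightarrow> nat \<Rightarrow> int \<Rightarrow> int \<times> int \<Rightarrow> int \<times> int" where
  "pscale p k t x = (t \<otimes>\<^bsub>Rk p k\<^esub> fst x, t \<otimes>\<^bsub>Rk p k\<^esub> snd x)"

text \<open>Reduction mod \<open>p\<^sup>j\<close>, for \<open>j \<le> k\<close>.\<close>

definition reduction :: "nat \<Rightarrow> nat \<Rightarrow> int \<times> int \<Rightarrow> int \<times> int" where
  "reduction p j x = (fst x mod int p ^ j, snd x mod int p ^ j)"

text \<open>
  For \<open>j \<le> k\<close>, divisibility of a residue class mod \<open>p\<^sup>k\<close> by \<open>p\<^sup>j\<close> can be tested on any integer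
  representative, so \<open>x - y\<close> is computed in the integers.
\<close>

definition pow_dvd_diff :: "nat \<Rightarrow> nat \<Rightarrow> int \<times> int \<Rightarrow> int \<times> int \<Rightarrow> bool" where
  "pow_dvd_diff p j x y \<longleftrightarrow> int p ^ j dvd fst x - fst y \<and> int p ^ j dvd snd x - snd y"

definition pdist :: "nat \<Rightarrow> nat \<Rightarrow> int \<times> int \<Rightarrow> int \<times> int \<Rightarrow> real" where
  "pdist p k x y = 1 / real p ^ Max {j. j \<le> k \<and> pow_dvd_diff p j x y}"

definition unimodular :: "nat \<Rightarrow> nat \<Rightarrow> (int \<times> int) set" where
  "unimodular p k = {b \<in> plane p k. fst b \<in> Units (Rk p k) \<or> snd b \<in> Units (Rk p k)}"

definition direction_class :: "nat \<Rightarrow> nat \<Rightarrow> int \<times> int \<Rightarrow> (int \<times> int) set" where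
  "direction_class p k b = (\<lambda>r. pscale p k r b) ` Units (Rk p k)"

definition line :: "nat \<Rightarrow> nat \<Rightarrow> int \<times> int \<Rightarrow> int \<times> int \<Rightarrow> (int \<times> int) set" where
  "line p k a b = (\<lambda>t. padd p k a (pscale p k t b)) ` carrier (Rk p k)"

definition lines :: "nat \<Rightarrow> nat \<Rightarrow> (int \<times> int) set set" where
  "lines p k = {line p k a b |a b. a \<in> plane p k \<and> b \<in> unimodular p k}"

text \<open>Well defined by lemma \<open>line_direction_line\<close> below.\<close>

definition line_direction :: "nat \<Rightarrow> nat \<Rightarrow> (int \<times> int) set \<Rightarrow> (int \<times> int) set" where
  "line_direction p k l = (THE D. \<exists>a\<in>plane p k. \<exists>b\<in>unimodular p k.
     l = line p k a b \<and> D = direction_class p k b)"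

definition angle_le :: "nat \<Rightarrow> nat \<Rightarrow> (int \<times> int) set \<Rightarrow> (int \<times> int) set \<Rightarrow> bool" where
  "angle_le p j D D' \<longleftrightarrow> (\<exists>u\<in>D. \<exists>u'\<in>D'. pow_dvd_diff p j u u')"

definition has_angle_exponent ::
    "nat \<Rightarrow> nat \<Rightarrow> nat \<Rightarrow> (int \<times> int) set \<Rightarrow> (int \<times> int) set \<Rightarrow> bool" where
  "has_angle_exponent p k j D D' \<longleftrightarrow>
     j \<le> k \<and> angle_le p j D D' \<and> (j = k \<or> \<not> angle_le p (Suc j) D D')"

text \<open>The exponent exists and is unique by lemma \<open>ex1_angle_exponent\<close> below.\<close>

definition angle :: "nat \<Rightarrow> nat \<Rightarrow> (int \<times> int) set \<Rightarrow> (int \<times> int) set \<Rightarrow> real" where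
  "angle p k D D' = 1 / real p ^ (THE j. has_angle_exponent p k j D D')"

definition line_angle :: "nat \<Rightarrow> nat \<Rightarrow> (int \<times> int) set \<Rightarrow> (int \<times> int) set \<Rightarrow> real" where
  "line_angle p k l l' = angle p k (line_direction p k l) (line_direction p k l')"

definition set_dist :: "nat \<Rightarrow> nat \<Rightarrow> (int \<times> int) set \<Rightarrow> (int \<times> int) set \<Rightarrow> real" where
  "set_dist p r A B = Min {pdist p r x y |x y. x \<in> A \<and> y \<in> B}"

definition lines_at_distance ::
    "nat \<Rightarrow> nat \<Rightarrow> nat \<Rightarrow> (int \<times> int) set \<Rightarrow> (int \<times> int) set \<Rightarrow> bool" where
  "lines_at_distance p k j l l' \<longleftrightarrow> l \<inter> l' = {} \<and>
     (\<exists>r. 1 \<le> r \<and> r \<le> k \<and> j < r \<and> line_angle p k l l' = 1 / real p ^ r \<and>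
          set_dist p r (reduction p r ` l) (reduction p r ` l') = 1 / real p ^ j)"

definition separated_in_direction ::
    "nat \<Rightarrow> nat \<Rightarrow> (int \<times> int) set \<Rightarrow> (int \<times> int) set \<Rightarrow> bool" where
  "separated_in_direction p k l l' \<longleftrightarrow> line_angle p k l l' \<ge> 1"

definition separated_in_distance ::
    "nat \<Rightarrow> nat \<Rightarrow> (int \<times> int) set \<Rightarrow> (int \<times> int) set \<Rightarrow> bool" where
  "separated_in_distance p k l l' \<longleftrightarrow> (\<exists>j. lines_at_distance p k j l l' \<and> 1 / real p ^ j \<ge> 1)"

definition incidences :: "(int \<times> int) set \<Rightarrow> (int \<times> int) set set \<Rightarrow>
    ((int \<times> int) \<times> (int \<times> int) set) set" where
  "incidences P L = {(q, l). q \<in> P \<and> l \<in> L \<and> q \<in> l}"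

lemma cring_Rk:
  assumes "prime p" "1 \<le> k"
  shows "cring (Rk p k)"
proof -
  have "1 < p ^ k"
    using assms prime_gt_1_nat[of p] by (intro one_less_power) auto
  then have "1 < int p ^ k"
    by (metis of_nat_1 of_nat_less_iff of_nat_power)
  then interpret residues "int p ^ k" "Rk p k"
    by unfold_locales (simp_all add: Rk_def)
  show ?thesis by (rule cring)
qed

lemma line_eq_imp_direction_subset:
  assumes "prime p" "1 \<le> k"
    and a: "a \<in> plane p k" and b: "b \<in> unimodular p k"
    and a': "a' \<in> plane p k" and b': "b' \<in> unimodular p k"
    and eq: "line p k a b = line p k a' b'"
  shows "direction_class p k b' \<subseteq> direction_class p k b"
proof -
  interpret cring "Rk p k" by (rule cring_Rk[OF assms(1,2)])
  let ?R = "Rk p k"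
  obtain a1 a2 b1 b2 c1 c2 d1 d2
    where ab: "a = (a1, a2)" "b = (b1, b2)" "a' = (c1, c2)" "b' = (d1, d2)"
    by (cases a, cases b, cases a', cases b')
  have car[simp]: "a1 \<in> carrier ?R" "a2 \<in> carrier ?R" "b1 \<in> carrier ?R" "b2 \<in> carrier ?R"
    "c1 \<in> carrier ?R" "c2 \<in> carrier ?R" "d1 \<in> carrier ?R" "d2 \<in> carrier ?R"
    using a b a' b' by (auto simp: ab plane_def unimodular_def)
  have "padd p k a' (pscale p k \<zero>\<^bsub>?R\<^esub> b') \<in> line p k a b"
    unfolding eq by (auto simp: line_def)
  then obtain s where s[simp]: "s \<in> carrier ?R"
    and s12: "c1 = a1 \<oplus>\<^bsub>?R\<^esub> s \<otimes>\<^bsub>?R\<^esub> b1" "c2 = a2 \<oplus>\<^bsub>?R\<^esub> s \<otimes>\<^bsub>?R\<^esub> b2"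
    by (auto simp: line_def padd_def pscale_def ab)
  have "padd p k a' (pscale p k \<one>\<^bsub>?R\<^esub> b') \<in> line p k a b"
    unfolding eq by (auto simp: line_def)
  then obtain t where t[simp]: "t \<in> carrier ?R"
    and t12: "c1 \<oplus>\<^bsub>?R\<^esub> d1 = a1 \<oplus>\<^bsub>?R\<^esub> t \<otimes>\<^bsub>?R\<^esub> b1" "c2 \<oplus>\<^bsub>?R\<^esub> d2 = a2 \<oplus>\<^bsub>?R\<^esub> t \<otimes>\<^bsub>?R\<^esub> b2"
    by (auto simp: line_def padd_def pscale_def ab)
  define u where "u = t \<ominus>\<^bsub>?R\<^esub> s"
  have u[simp]: "u \<in> carrier ?R" by (simp add: u_def)
  have key: "d = u \<otimes>\<^bsub>?R\<^esub> b"
    if "a \<in> carrier ?R" "b \<in> carrier ?R" "c \<in> carrier ?R" "d \<in> carrier ?R"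
      "c = a \<oplus>\<^bsub>?R\<^esub> s \<otimes>\<^bsub>?R\<^esub> b" "c \<oplus>\<^bsub>?R\<^esub> d = a \<oplus>\<^bsub>?R\<^esub> t \<otimes>\<^bsub>?R\<^esub> b" for a b c d
  proof -
    have "d = (c \<oplus>\<^bsub>?R\<^esub> d) \<ominus>\<^bsub>?R\<^esub> c"
      using that(3,4) by (metis a_comm add.inv_closed minus_eq r_neg1 a_assoc r_neg r_zero add.m_closed)
    also have "\<dots> = (a \<oplus>\<^bsub>?R\<^esub> t \<otimes>\<^bsub>?R\<^esub> b) \<ominus>\<^bsub>?R\<^esub> (a \<oplus>\<^bsub>?R\<^esub> s \<otimes>\<^bsub>?R\<^esub> b)"
      using that(5,6) by metis
    also have "\<dots> = u \<otimes>\<^bsub>?R\<^esub> b"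
      unfolding u_def using that(1,2) s t by algebra
    finally show ?thesis .
  qed
  have d: "d1 = u \<otimes>\<^bsub>?R\<^esub> b1" "d2 = u \<otimes>\<^bsub>?R\<^esub> b2"
    using key[OF _ _ _ _ s12(1) t12(1)] key[OF _ _ _ _ s12(2) t12(2)] by simp_all
  have unit: "u \<in> Units ?R"
  proof -
    have "u \<otimes>\<^bsub>?R\<^esub> b1 \<in> Units ?R \<or> u \<otimes>\<^bsub>?R\<^esub> b2 \<in> Units ?R"
      using b' d by (auto simp: unimodular_def ab)
    then obtain c where c: "c \<in> carrier ?R" and cu: "u \<otimes>\<^bsub>?R\<^esub> c \<in> Units ?R"
      using car by blast
    let ?v = "c \<otimes>\<^bsub>?R\<^esub> inv\<^bsub>?R\<^esub> (u \<otimes>\<^bsub>?R\<^esub> c)"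
    have v: "?v \<in> carrier ?R" using c cu by simp
    have "u \<otimes>\<^bsub>?R\<^esub> ?v = \<one>\<^bsub>?R\<^esub>"
      using Units_r_inv[OF cu] c Units_inv_closed[OF cu] by (simp add: m_assoc)
    then show ?thesis
      using v u m_comm[OF u v] unfolding Units_def by auto
  qed
  have "pscale p k r b' = pscale p k (r \<otimes>\<^bsub>?R\<^esub> u) b" if "r \<in> Units ?R" for r
    using Units_closed[OF that] by (simp add: pscale_def ab d m_assoc)
  then show ?thesis
    using unit by (auto simp: direction_class_def intro!: image_eqI[OF _ Units_m_closed])
qed

lemma line_direction_line:
  assumes "prime p" "1 \<le> k" "a \<in> plane p k" "b \<in> unimodular p k"
  shows "line_direction p k (line p k a b) = direction_class p k b"
  unfolding line_direction_def
proof (rule the_equality)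
  show "\<exists>a'\<in>plane p k. \<exists>b'\<in>unimodular p k.
      line p k a b = line p k a' b' \<and> direction_class p k b = direction_class p k b'"
    using assms by blast
next
  fix D
  assume "\<exists>a'\<in>plane p k. \<exists>b'\<in>unimodular p k. line p k a b = line p k a' b' \<and> D = direction_class p k b'"
  then show "D = direction_class p k b"
    using assms line_eq_imp_direction_subset[of p k] by (metis subset_antisym)
qed

lemma angle_le_mono:
  assumes "angle_le p j D D'" "i \<le> j"
  shows "angle_le p i D D'"
  using assms unfolding angle_le_def pow_dvd_diff_def by (meson dvd_trans le_imp_power_dvd)

lemma ex1_angle_exponent:
  assumes "D \<noteq> {}" "D' \<noteq> {}"
  shows "\<exists>!j. has_angle_exponent p k j D D'"
proof (rule ex_ex1I)
  have 0: "angle_le p 0 D D'"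
    using assms by (auto simp: angle_le_def pow_dvd_diff_def)
  let ?S = "{j. j \<le> k \<and> angle_le p j D D'}"
  have S: "finite ?S" "?S \<noteq> {}" using 0 by auto
  have "Max ?S \<in> ?S" using Max_in[OF S] .
  moreover have "\<not> angle_le p (Suc (Max ?S)) D D'" if "Max ?S \<noteq> k"
  proof
    assume "angle_le p (Suc (Max ?S)) D D'"
    then have "Suc (Max ?S) \<in> ?S" using that \<open>Max ?S \<in> ?S\<close> by simp
    from Max_ge[OF S(1) this] show False by simp
  qed
  ultimately show "\<exists>j. has_angle_exponent p k j D D'"
    unfolding has_angle_exponent_def by blast
next
  fix i j
  assume "has_angle_exponent p k i D D'" "has_angle_exponent p k j D D'"
  then show "i = j"
    unfolding has_angle_exponent_def
    by (metis angle_le_mono le_antisym not_less_eq_eq)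
qed

end

theory Submission
  imports Defs "HOL-Library.Set_Algebras"
begin

text \<open>
  Write \<open>N = p\<^sup>\<alpha>\<close>, \<open>n = \<surd>N\<close> and \<open>K = N\<^sup>\<epsilon>\<close>.  The separation hypothesis says exactly that the normal
  forms \<open>a x + b y + c = 0\<close> of distinct lines are not proportional mod \<open>p\<close>.  Hence distinct lines that
  share a point cross transversally mod \<open>p\<close> and share only this point, and Cauchy-Schwarz bounds the
  incidences by a multiple of \<open>n\<^sup>3\<close>.  To save a factor \<open>K\<close>, suppose that there are at least \<open>n\<^sup>3/K\<close> of
  them; the conclusion will be that \<open>n \<le> K\<^sup>c\<close> or \<open>p \<le> K\<^sup>c n\<close> for an absolute constant \<open>c\<close>, which is
  impossible for small \<open>\<epsilon>\<close>, because \<open>n = p\<^sup>\<alpha>\<^sup>/\<^sup>2\<close> with \<open>\<alpha> < 2\<close>.  Below, words such as almost,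
  large, few and small allow for bounded powers of \<open>K\<close>.

  Reduction to the field with \<open>p\<close> elements.  Different points may agree mod \<open>p\<close>, so reducing mod \<open>p\<close>
  straight away loses too much.  But counting produces two points \<open>q\<^sub>1, q\<^sub>2\<close> and almost \<open>N\<close> points that
  are intersections of a line through \<open>q\<^sub>1\<close> with another line through \<open>q\<^sub>2\<close> (\<open>two_pencils\<close>).  If
  \<open>p\<^sup>j\<close> is the exact power of \<open>p\<close> dividing \<open>q\<^sub>2 - q\<^sub>1\<close>, then transversality forces all these points to
  be congruent to \<open>q\<^sub>1\<close> mod \<open>p\<^sup>j\<close>.  Dividing by \<open>p\<^sup>j\<close> and then reducing mod \<open>p\<close>, the two points become
  distinct; the pencils of lines through them stay injective, since lines through one point are
  pairwise transverse mod \<open>p\<close>.  The projective map that sends both points to infinity turns the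
  pencils into the columns and rows of a grid \<open>U \<times> V\<close> with \<open>|U|, |V| \<le> 2n\<close>, the chosen points
  into distinct grid points, and the lines into distinct lines (\<open>grid_coordinates\<close>).

  From the grid to sums of dilates.  For a popular pair \<open>u\<^sub>0, u\<^sub>1\<close> of columns, a line is determined by
  its heights \<open>v\<^sub>0, v\<^sub>1\<close> there and has height \<open>(1 - b) v\<^sub>0 + b v\<^sub>1\<close> in a third column.  So there are
  almost \<open>n\<close> values of \<open>b\<close> for which \<open>(1 - b) v + b w \<in> V\<close> holds for almost \<open>n\<^sup>2\<close> pairs
  (\<open>grid_incidence_bound\<close>).  The Balog-Szemeredi-Gowers theorem gives large \<open>X\<^sub>b, Y\<^sub>b \<subseteq> V\<close> with a small
  set \<open>(1 - b) X\<^sub>b + b Y\<^sub>b\<close>; many of these pairs overlap heavily with one of them, and Ruzsa covering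
  then yields one set \<open>D\<close> of small doubling and a set \<open>S\<close> of almost \<open>n\<close> multipliers \<open>s\<close> such that
  few translates of \<open>4D - 4D\<close> cover \<open>s D\<close> (\<open>structured_family_bound\<close>).

  The contradiction (\<open>covered_dilates_small\<close>).  Such multipliers are stable under ring operations,
  at the price of a power of \<open>K\<close>, and by Pluennecke-Ruzsa they all make \<open>D + q D\<close> small.
  On the other hand, following
  Glibichuk and Konyagin, the set of ratios \<open>(a - b)/(c - d)\<close> from \<open>S\<close> is either the whole field or
  not stable under adding \<open>1\<close>; in both cases a set \<open>(c - d) S + (a - b + c - d) S\<close> with
  \<open>a, b, c, d \<in> S\<close> has at least \<open>min(|S|\<^sup>2, p)/2\<close> elements.  That is more than \<open>D\<close> can tolerate: among
  so many multipliers \<open>q\<close>, one has \<open>|D + q D|\<close> large (\<open>exists_large_dilate_sum\<close>).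
\<close>

section \<open>Sumset inequalities\<close>

text \<open>
  Fix a representation \<open>d = b - c\<close> of each difference.  The pair \<open>(a + b, a + c)\<close> determines first
  \<open>d\<close>, then its representation, then \<open>a\<close>.
\<close>

lemma ruzsa_triangle:
  fixes A B C :: "'a::ab_group_add set"
  assumes fin: "finite A" "finite B" "finite C"
  shows "card A * card (B + uminus ` C) \<le> card (A + B) * card (A + C)"
proof -
  define f where "f d = (SOME bc. fst bc \<in> B \<and> snd bc \<in> C \<and> d = fst bc - snd bc)" for d
  have f: "fst (f d) \<in> B" "snd (f d) \<in> C" "fst (f d) - snd (f d) = d"
    if "d \<in> B + uminus ` C" for d
  proof -
    from that obtain b c where "b \<in> B" "c \<in> C" "d = b - c"
      by (auto simp: set_plus_def)
    then have "\<exists>bc. fst bc \<in> B \<and> snd bc \<in> C \<and> d = fst bc - snd bc"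
      by (intro exI[of _ "(b, c)"]) simp
    from someI_ex[OF this] show "fst (f d) \<in> B" "snd (f d) \<in> C" "fst (f d) - snd (f d) = d"
      unfolding f_def[symmetric] by auto
  qed
  let ?g = "\<lambda>(a, d). (a + fst (f d), a + snd (f d))"
  have "inj_on ?g (A \<times> (B + uminus ` C))"
  proof (rule inj_onI, clarify)
    fix a d a' d'
    assume d: "d \<in> B + uminus ` C" "d' \<in> B + uminus ` C"
      and eq: "a + fst (f d) = a' + fst (f d')" "a + snd (f d) = a' + snd (f d')"
    have "d = d'"
      using f(3)[OF d(1)] f(3)[OF d(2)] eq by (metis add_diff_cancel_left)
    then show "a = a' \<and> d = d'" using eq by simp
  qed
  moreover have "?g ` (A \<times> (B + uminus ` C)) \<subseteq> (A + B) \<times> (A + C)"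
    using f by auto
  ultimately have "card (A \<times> (B + uminus ` C)) \<le> card ((A + B) \<times> (A + C))"
    using fin by (intro card_inj_on_le) (auto intro: finite_set_plus)
  then show ?thesis by (simp add: card_cartesian_product)
qed

text \<open>
  Take \<open>F \<subseteq> B\<close> maximal such that the translates \<open>f + A\<close> are disjoint.  They fit into \<open>A + B\<close>, and by
  maximality each \<open>b + A\<close> meets one of them.
\<close>

lemma ruzsa_covering:
  fixes A B :: "'a::ab_group_add set"
  assumes fin: "finite A" "finite B" and "A \<noteq> {}"
  shows "\<exists>F\<subseteq>B. card F * card A \<le> card (A + B) \<and> B \<subseteq> F + (A + uminus ` A)"
proof -
  let ?fam = "{F. F \<subseteq> B \<and> inj_on (\<lambda>(x, a). x + a) (F \<times> A)}"
  have "finite ?fam" using fin by auto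
  moreover have "?fam \<noteq> {}" by (auto intro: exI[of _ "{}"])
  ultimately have "\<exists>F\<in>?fam. \<forall>G\<in>?fam. F \<le> G \<longrightarrow> F = G"
    by (rule finite_has_maximal)
  then obtain F where F: "F \<subseteq> B" "inj_on (\<lambda>(x, a). x + a) (F \<times> A)"
    and max: "\<And>G. G \<subseteq> B \<Longrightarrow> inj_on (\<lambda>(x, a). x + a) (G \<times> A) \<Longrightarrow> F \<subseteq> G \<Longrightarrow> F = G"
    by auto
  have "card (F \<times> A) \<le> card (A + B)"
  proof (rule card_inj_on_le)
    show "inj_on (\<lambda>(x, a). x + a) (F \<times> A)" using F by simp
    show "(\<lambda>(x, a). x + a) ` (F \<times> A) \<subseteq> A + B"
      using F by (auto simp: add.commute[of A] intro!: set_plus_intro)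
    show "finite (A + B)" using fin by (rule finite_set_plus)
  qed
  moreover have "b \<in> F + (A + uminus ` A)" if b: "b \<in> B" for b
  proof (cases "b \<in> F")
    case True
    obtain a where "a \<in> A" using \<open>A \<noteq> {}\<close> by auto
    then have "b + (a + - a) \<in> F + (A + uminus ` A)" using True by blast
    then show ?thesis by simp
  next
    case False
    then have "\<not> inj_on (\<lambda>(x, a). x + a) (insert b F \<times> A)"
      using max[of "insert b F"] F b by auto
    then obtain x y a a' where xy: "x \<in> insert b F" "y \<in> insert b F" "a \<in> A" "a' \<in> A"
      "x + a = y + a'" "(x, a) \<noteq> (y, a')"
      unfolding inj_on_def by auto
    have "\<exists>f\<in>F. \<exists>a\<in>A. \<exists>a'\<in>A. b = f + (a + - a')"
    proof -
      consider "x = b" "y = b" | "x = b" "y \<in> F" | "x \<in> F" "y = b" | "x \<in> F" "y \<in> F"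
        using xy by auto
      then show ?thesis
      proof cases
        case 1 then show ?thesis using xy by simp
      next
        case 2
        then have "b = y + (a' + - a)" using xy(5) by (simp add: algebra_simps)
        then show ?thesis using 2 xy by blast
      next
        case 3
        then have "b = x + (a + - a')" using xy(5) by (simp add: algebra_simps)
        then show ?thesis using 3 xy by blast
      next
        case 4
        then show ?thesis using F xy unfolding inj_on_def by auto
      qed
    qed
    then show ?thesis by blast
  qed
  ultimately show ?thesis using F by (auto simp: card_cartesian_product)
qed

lemma card_translate_le:
  fixes A B :: "'a::ab_group_add set"
  shows "card ((\<lambda>x. x + c) ` A) = card A"
  by (intro card_image) (auto simp: inj_on_def)

text \<open>
  Petridis' lemma.  The set \<open>X\<close> minimises the growth ratio \<open>|X + B|/|X|\<close> among nonempty subsets of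
  \<open>A\<close>.  Adding a point \<open>c\<close> to \<open>C\<close> enlarges \<open>X + B + C\<close> by at most \<open>|X + B| - |Z + B|\<close>, where \<open>Z\<close>
  collects the \<open>x\<close> with \<open>x + B + c\<close> already covered; minimality bounds \<open>|Z + B|\<close> from below, and the
  part of \<open>X + c\<close> that is already covered comes from points of \<open>Z\<close>.
\<close>

lemma petridis:
  fixes A B :: "'a::ab_group_add set" and \<kappa> :: real
  assumes fin: "finite A" "finite B" and ne: "A \<noteq> {}"
    and le: "card (A + B) \<le> \<kappa> * card A"
  obtains X where "X \<subseteq> A" "X \<noteq> {}"
    "\<And>C. finite C \<Longrightarrow> card (X + B + C) \<le> \<kappa> * card (X + C)"
proof -
  let ?r = "\<lambda>X. real (card (X + B)) / real (card X)"
  let ?S = "{X. X \<subseteq> A \<and> X \<noteq> {}}"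
  have "finite ?S" "A \<in> ?S" using fin ne by auto
  then obtain X where X: "is_arg_min ?r (\<lambda>X. X \<in> ?S) X"
    using ex_is_arg_min_if_finite[of ?S ?r] by blast
  then have XA: "X \<subseteq> A" "X \<noteq> {}" and min: "\<And>Y. Y \<subseteq> A \<Longrightarrow> Y \<noteq> {} \<Longrightarrow> ?r X \<le> ?r Y"
    by (auto simp: is_arg_min_linorder)
  define \<rho> where "\<rho> = ?r X"
  have finX: "finite X" using XA fin finite_subset by auto
  have cX: "card X > 0" using XA finX by (simp add: card_gt_0_iff)
  have cA: "card A > 0" using fin ne by (simp add: card_gt_0_iff)
  have "\<rho> \<le> ?r A" unfolding \<rho>_def using min ne by simp
  also have "\<dots> \<le> \<kappa>" using le cA by (simp add: divide_simps)
  finally have rk: "\<rho> \<le> \<kappa>" .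
  have sub: "\<rho> * card Z \<le> card (Z + B)" if "Z \<subseteq> X" for Z
  proof (cases "Z = {}")
    case False
    then have "card Z > 0" using that finX finite_subset by (metis card_gt_0_iff)
    moreover have "\<rho> \<le> ?r Z" using min[of Z] that XA False by (auto simp: \<rho>_def)
    ultimately show ?thesis by (simp add: divide_simps)
  qed simp
  have XB: "card (X + B) = \<rho> * card X" using cX by (simp add: \<rho>_def)
  have "card (X + B + C) \<le> \<rho> * card (X + C)" if "finite C" for C
    using that
  proof (induction C)
    case empty then show ?case by simp
  next
    case (insert c C)
    let ?t = "\<lambda>S. (\<lambda>x. x + c) ` S"
    define Z where "Z = {x \<in> X. \<forall>b\<in>B. x + b + c \<in> X + B + C}"
    define W where "W = {x \<in> X. x + c \<in> X + C}"
    have finC: "finite C" by fact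
    have fin': "finite (X + B + C)" "finite (X + B)" "finite (Z + B)" "finite (X + C)" "finite Z"
      "finite W"
      using finX fin insert.hyps by (auto simp: Z_def W_def intro!: finite_set_plus)
    have WZ: "W \<subseteq> Z"
    proof
      fix x assume "x \<in> W"
      then obtain x' c' where *: "x \<in> X" "x' \<in> X" "c' \<in> C" "x + c = x' + c'"
        by (auto simp: W_def elim: set_plus_elim)
      have "x + b + c \<in> X + B + C" if "b \<in> B" for b
      proof -
        have "x + b + c = x' + b + c'" using *(4) by (metis add.commute add.left_commute)
        then show ?thesis using * that by (metis set_plus_intro)
      qed
      then show "x \<in> Z" using * by (auto simp: Z_def)
    qed
    have ZX: "Z \<subseteq> X" by (auto simp: Z_def)
    have "X + B + insert c C \<subseteq> (X + B + C) \<union> ?t (X + B - (Z + B))"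
    proof
      fix y assume "y \<in> X + B + insert c C"
      then obtain x b d where y: "y = x + b + d" "x \<in> X" "b \<in> B" "d \<in> insert c C"
        by (auto elim!: set_plus_elim)
      show "y \<in> (X + B + C) \<union> ?t (X + B - (Z + B))"
      proof (cases "y \<in> X + B + C")
        case False
        then have "d = c" using y by auto
        have "x + b \<notin> Z + B"
        proof
          assume "x + b \<in> Z + B"
          then obtain z b' where "z \<in> Z" "b' \<in> B" "x + b = z + b'" by (auto elim: set_plus_elim)
          then have "x + b + c \<in> X + B + C" by (auto simp: Z_def)
          then show False using False y \<open>d = c\<close> by simp
        qed
        then show ?thesis using y \<open>d = c\<close> by auto
      qed simp
    qed
    then have "card (X + B + insert c C) \<le> card ((X + B + C) \<union> ?t (X + B - (Z + B)))"
      using fin' by (intro card_mono) auto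
    also have "\<dots> \<le> card (X + B + C) + card (?t (X + B - (Z + B)))"
      by (rule card_Un_le)
    also have "card (?t (X + B - (Z + B))) = card (X + B - (Z + B))"
      by (rule card_translate_le)
    also have "\<dots> = card (X + B) - card (Z + B)"
      using ZX fin' by (intro card_Diff_subset) (auto simp: set_plus_def)
    finally have "card (X + B + insert c C) \<le> card (X + B + C) + (card (X + B) - card (Z + B))" .
    moreover have "card (Z + B) \<le> card (X + B)"
      using ZX fin' by (intro card_mono) (auto simp: set_plus_def)
    ultimately have "real (card (X + B + insert c C))
        \<le> card (X + B + C) + (card (X + B) - real (card (Z + B)))" by linarith
    also have "\<dots> \<le> \<rho> * card (X + C) + (\<rho> * card X - \<rho> * card Z)"
      using insert.IH XB sub[OF ZX] by linarith
    also have "\<dots> \<le> \<rho> * card (X + C) + (\<rho> * card X - \<rho> * card W)"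
    proof -
      have "card W \<le> card Z" using WZ fin' by (intro card_mono) auto
      then have "\<rho> * card W \<le> \<rho> * card Z" by (intro mult_left_mono) (auto simp: \<rho>_def)
      then show ?thesis by simp
    qed
    also have "\<dots> = \<rho> * (card (X + C) + (card X - real (card W)))" by (simp add: algebra_simps)
    also have "card (X + C) + (card X - real (card W)) = card (X + insert c C)"
    proof -
      have "X + insert c C = (X + C) \<union> ?t (X - W)"
      proof
        show "X + insert c C \<subseteq> (X + C) \<union> ?t (X - W)"
        proof
          fix y assume "y \<in> X + insert c C"
          then obtain x d where y: "y = x + d" "x \<in> X" "d \<in> insert c C"
            by (auto elim!: set_plus_elim)
          then show "y \<in> (X + C) \<union> ?t (X - W)" by (auto simp: W_def)
        qed
        show "(X + C) \<union> ?t (X - W) \<subseteq> X + insert c C" by (auto simp: set_plus_def)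
      qed
      moreover have "(X + C) \<inter> ?t (X - W) = {}" by (auto simp: W_def)
      ultimately have "card (X + insert c C) = card (X + C) + card (?t (X - W))"
        using fin' finX by (simp add: card_Un_disjoint)
      also have "card (?t (X - W)) = card (X - W)" by (rule card_translate_le)
      also have "\<dots> = card X - card W" using fin' by (intro card_Diff_subset) (auto simp: W_def)
      finally show ?thesis
        using card_mono[OF finX, of W] by (simp add: W_def)
    qed
    finally show ?case .
  qed
  then have "card (X + B + C) \<le> \<kappa> * card (X + C)" if "finite C" for C
    using that rk by (meson mult_right_mono of_nat_0_le_iff order_trans)
  then show ?thesis using that XA by blast
qed

primrec multisum :: "nat \<Rightarrow> 'a::comm_monoid_add set \<Rightarrow> 'a set" where
  "multisum 0 B = {0}"
| "multisum (Suc m) B = B + multisum m B"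

lemma finite_multisum: "finite B \<Longrightarrow> finite (multisum m B)"
  by (induction m) (auto intro: finite_set_plus)

lemma multisum_add: "multisum (m + l) B = multisum m B + multisum l B"
  by (induction m) (auto simp: add.assoc)

lemma multisum_mono: "B \<subseteq> C \<Longrightarrow> multisum m B \<subseteq> multisum m C"
  by (induction m) (simp_all add: set_plus_mono2)

lemma multisum_plus: "multisum m (B + C) = multisum m B + multisum m C"
  by (induction m) (auto simp: add_ac)

lemma multisum_mult: "multisum m (multisum l B) = multisum (m * l) B"
  by (induction m) (auto simp: multisum_add)

lemma card_set_plus_le:
  fixes A B :: "'a::plus set"
  assumes "finite A" "finite B"
  shows "card (A + B) \<le> card A * card B"
proof -
  have "A + B = (\<lambda>(a, b). a + b) ` (A \<times> B)" by (auto simp: set_plus_def)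
  then show ?thesis
    using assms by (metis card_cartesian_product card_image_le finite_cartesian_product)
qed

lemma card_multisum_le: "finite B \<Longrightarrow> card (multisum m B) \<le> card B ^ m"
proof (induction m)
  case (Suc m)
  then have "card (B + multisum m B) \<le> card B * card (multisum m B)"
    by (intro card_set_plus_le finite_multisum)
  with Suc show ?case by (auto intro: order_trans mult_left_mono)
qed simp

text \<open>
  Iterating Petridis' lemma with \<open>C = B, B + B, \<dots>\<close> bounds \<open>|X + m B|\<close>; the triangle inequality
  through \<open>X\<close> passes from two such sums to a difference.
\<close>

lemma pluennecke_ruzsa:
  fixes A B :: "'a::ab_group_add set" and \<kappa> :: real
  assumes fin: "finite A" "finite B" and ne: "A \<noteq> {}" and \<kappa>: "\<kappa> \<ge> 0"
    and le: "card (A + B) \<le> \<kappa> * card A"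
  shows "card (multisum m B + uminus ` multisum l B) \<le> \<kappa> ^ (m + l) * card A"
proof -
  obtain X where X: "X \<subseteq> A" "X \<noteq> {}"
    and step: "\<And>C. finite C \<Longrightarrow> card (X + B + C) \<le> \<kappa> * card (X + C)"
    using petridis[OF fin ne le] by blast
  have finX: "finite X" using X fin finite_subset by auto
  then have cX: "card X > 0" using X by (simp add: card_gt_0_iff)
  have it: "card (X + multisum m B) \<le> \<kappa> ^ m * card X" for m
  proof (induction m)
    case (Suc m)
    have "real (card (X + multisum (Suc m) B)) = card (X + B + multisum m B)"
      by (simp add: add.assoc)
    also have "\<dots> \<le> \<kappa> * card (X + multisum m B)"
      by (intro step finite_multisum fin)
    also have "\<dots> \<le> \<kappa> * (\<kappa> ^ m * card X)"
      using Suc \<kappa> by (intro mult_left_mono) auto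
    finally show ?case by simp
  qed simp
  have "real (card X * card (multisum m B + uminus ` multisum l B))
      \<le> real (card (X + multisum m B) * card (X + multisum l B))"
    using ruzsa_triangle[of X "multisum m B" "multisum l B"] finX fin finite_multisum
    by (metis of_nat_le_iff)
  also have "\<dots> \<le> (\<kappa> ^ m * card X) * (\<kappa> ^ l * card X)"
    unfolding of_nat_mult using it \<kappa> by (intro mult_mono) auto
  also have "\<dots> = real (card X) * (\<kappa> ^ (m + l) * card X)" by (simp add: power_add algebra_simps)
  finally have "card (multisum m B + uminus ` multisum l B) \<le> \<kappa> ^ (m + l) * card X"
    using cX by (simp add: mult_le_cancel_left_pos)
  also have "\<dots> \<le> \<kappa> ^ (m + l) * card A"
    using card_mono[OF fin(1) X(1)] \<kappa> by (intro mult_left_mono) auto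
  finally show ?thesis .
qed

section \<open>The Balog-Szemeredi-Gowers theorem\<close>

lemma double_counting:
  assumes "finite A" "finite B"
  shows "(\<Sum>x\<in>A. real (card {y \<in> B. R x y})) = (\<Sum>y\<in>B. real (card {x \<in> A. R x y}))"
proof -
  have 1: "real (card {y \<in> B. R x y}) = (\<Sum>y\<in>B. if R x y then 1 else 0)" for x
    using assms by (simp add: sum.If_cases Int_def conj_commute)
  have 2: "real (card {x \<in> A. R x y}) = (\<Sum>x\<in>A. if R x y then 1 else 0)" for y
    using assms by (simp add: sum.If_cases Int_def conj_commute)
  show ?thesis unfolding 1 2 by (rule sum.swap)
qed

lemma card_filter_pairs:
  assumes "finite A" "finite B"
  shows "real (card {(x, y). x \<in> A \<and> y \<in> B \<and> R x y}) = (\<Sum>x\<in>A. real (card {y \<in> B. R x y}))"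
proof -
  have "{(x, y). x \<in> A \<and> y \<in> B \<and> R x y} = (SIGMA x:A. {y \<in> B. R x y})" by auto
  then show ?thesis using assms by simp
qed

text \<open>
  Pigeonhole, with an upper bound \<open>c\<close> in place of the exact number of terms.
\<close>

lemma exists_ge_average:
  fixes f :: "'a \<Rightarrow> real" and c d :: real
  assumes "finite Y" "card Y \<le> c" "c > 0" "d > 0" "c * d \<le> sum f Y"
  shows "\<exists>y\<in>Y. d \<le> f y"
proof (rule ccontr)
  assume *: "\<not> ?thesis"
  have "Y \<noteq> {}" using assms(5) mult_pos_pos[OF assms(3,4)] by force
  then have "sum f Y < (\<Sum>y\<in>Y. d)" using * assms by (intro sum_strict_mono) auto
  also have "\<dots> = card Y * d" by simp
  also have "\<dots> \<le> c * d" using assms by (intro mult_right_mono) auto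
  finally show False using assms by simp
qed

text \<open>
  Gowers' graph argument.  Averaging over the neighbourhoods \<open>N y\<close> of vertices \<open>y\<close>, one of them, \<open>A\<close>,
  is large and has few bad pairs, that is, pairs with few common neighbours.  Let \<open>X'\<close> be the vertices
  of \<open>A\<close> that lie in few bad pairs, and \<open>Y'\<close> the vertices with many neighbours in \<open>A\<close>.  A vertex
  \<open>y \<in> Y'\<close> then has many neighbours \<open>x1 \<in> A\<close> that are not bad with respect to a given \<open>x \<in> X'\<close>, and
  every common neighbour \<open>y1\<close> of \<open>x\<close> and \<open>x1\<close> completes a path \<open>x, y1, x1, y\<close>.
\<close>

lemma many_paths_of_length_three:
  fixes G :: "('a \<times> 'b) set" and n \<delta> :: real
  assumes fin: "finite X" "finite Y" and G: "G \<subseteq> X \<times> Y"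
    and X: "card X \<le> n" and Y: "card Y \<le> n" and n: "n > 0" and \<delta>: "0 < \<delta>"
    and dense: "\<delta> * n\<^sup>2 \<le> card G"
  obtains X' Y' where "X' \<subseteq> X" "Y' \<subseteq> Y" "\<delta> * n / 6 \<le> card X'" "\<delta> * n / 4 \<le> card Y'"
    "\<And>x y. x \<in> X' \<Longrightarrow> y \<in> Y' \<Longrightarrow>
      \<delta> ^ 5 * n\<^sup>2 / 3072 \<le> card {(x1, y1). (x, y1) \<in> G \<and> (x1, y1) \<in> G \<and> (x1, y) \<in> G}"
proof -
  define deg where "deg x = real (card {y \<in> Y. (x, y) \<in> G})" for x
  define X0 where "X0 = {x \<in> X. \<delta> * n / 2 \<le> deg x}"
  define N where "N y = {x \<in> X0. (x, y) \<in> G}" for y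
  define cod where "cod x x' = real (card {y \<in> Y. (x, y) \<in> G \<and> (x', y) \<in> G})" for x x'
  \<comment> \<open>With fewer than \<open>\<theta> n\<close> common neighbours a pair is bad.  The value of \<open>\<theta>\<close> makes the weight \<open>16/\<delta>\<close>
    of the bad pairs below affordable: it costs half of the main term.\<close>
  define \<theta> where "\<theta> = \<delta> ^ 3 / 128"
  define bad where "bad y = real (card {(x, x'). x \<in> N y \<and> x' \<in> N y \<and> cod x x' < \<theta> * n})" for y
  have X0: "X0 \<subseteq> X" "finite X0" using fin by (auto simp: X0_def)
  have finN: "finite (N y)" for y using X0 by (auto simp: N_def)
  have cardX0: "card X0 \<le> n" using card_mono[OF fin(1) X0(1)] X by linarith

  have "{(x, y). x \<in> X \<and> y \<in> Y \<and> (x, y) \<in> G} = G" using G by auto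
  then have "card G = (\<Sum>x\<in>X. deg x)"
    using card_filter_pairs[OF fin, of "\<lambda>x y. (x, y) \<in> G"] by (simp add: deg_def)
  also have "\<dots> = (\<Sum>x\<in>X0. deg x) + (\<Sum>x\<in>X - X0. deg x)"
    using X0 fin by (subst sum.subset_diff[of X0 X]) auto
  also have "(\<Sum>x\<in>X - X0. deg x) \<le> (\<Sum>x\<in>X - X0. \<delta> * n / 2)"
    by (intro sum_mono) (auto simp: X0_def)
  also have "\<dots> \<le> (\<Sum>x\<in>X. \<delta> * n / 2)"
    using fin \<delta> n by (intro sum_mono2) auto
  also have "\<dots> \<le> n * (\<delta> * n / 2)"
    using mult_right_mono[OF X, of "\<delta> * n / 2"] \<delta> n by simp
  finally have edges0: "\<delta> * n\<^sup>2 / 2 \<le> (\<Sum>x\<in>X0. deg x)"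
    using dense by (simp add: power2_eq_square algebra_simps)
  have "(\<Sum>x\<in>X0. deg x) = (\<Sum>y\<in>Y. real (card (N y)))"
    unfolding deg_def N_def by (rule double_counting) (use X0 fin in auto)
  with edges0 have sumN: "\<delta> * n\<^sup>2 / 2 \<le> (\<Sum>y\<in>Y. real (card (N y)))" by simp

  \<comment> \<open>\<open>(t - c)\<^sup>2 \<ge> 0\<close> at the expected mean \<open>c\<close>\<close>
  define c where "c = \<delta> * n / 2"
  have c: "c > 0" using \<delta> n by (simp add: c_def)
  have "(\<Sum>y\<in>Y. 2 * c * card (N y) - c\<^sup>2) \<le> (\<Sum>y\<in>Y. (real (card (N y)))\<^sup>2)"
  proof (intro sum_mono)
    fix y
    show "2 * c * card (N y) - c\<^sup>2 \<le> (real (card (N y)))\<^sup>2"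
      using zero_le_power2[of "real (card (N y)) - c"] by (simp add: power2_diff mult_ac)
  qed
  moreover have "(\<Sum>y\<in>Y. 2 * c * card (N y) - c\<^sup>2) = 2 * c * (\<Sum>y\<in>Y. real (card (N y))) - card Y * c\<^sup>2"
    by (simp add: sum_subtractf sum_distrib_left)
  moreover have "2 * c * (c * n) \<le> 2 * c * (\<Sum>y\<in>Y. real (card (N y)))"
    using sumN c by (intro mult_left_mono) (auto simp: c_def power2_eq_square)
  moreover have "card Y * c\<^sup>2 \<le> n * c\<^sup>2" using Y by (intro mult_right_mono) auto
  ultimately have sumN2: "c\<^sup>2 * n \<le> (\<Sum>y\<in>Y. (real (card (N y)))\<^sup>2)"
    by (simp add: power2_eq_square algebra_simps)

  have "(\<Sum>y\<in>Y. bad y) =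
      (\<Sum>y\<in>Y. real (card {q \<in> {q \<in> X0 \<times> X0. cod (fst q) (snd q) < \<theta> * n}.
          (fst q, y) \<in> G \<and> (snd q, y) \<in> G}))"
    unfolding bad_def N_def
    by (intro sum.cong refl arg_cong[where f = card] arg_cong[where f = real]) auto
  also have "\<dots> = (\<Sum>q\<in>{q \<in> X0 \<times> X0. cod (fst q) (snd q) < \<theta> * n}. cod (fst q) (snd q))"
    unfolding cod_def using fin X0 by (subst double_counting[symmetric]) auto
  also have "\<dots> \<le> (\<Sum>q\<in>{q \<in> X0 \<times> X0. cod (fst q) (snd q) < \<theta> * n}. \<theta> * n)"
    by (intro sum_mono) auto
  also have "\<dots> \<le> (\<Sum>q\<in>X0 \<times> X0. \<theta> * n)"
    using X0 \<delta> n by (intro sum_mono2) (auto simp: \<theta>_def)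
  also have "\<dots> = (real (card X0) * real (card X0)) * (\<theta> * n)" by (simp add: card_cartesian_product)
  also have "\<dots> \<le> (n * n) * (\<theta> * n)"
    using cardX0 n \<delta> by (intro mult_right_mono mult_mono) (auto simp: \<theta>_def)
  finally have sumbad: "(\<Sum>y\<in>Y. bad y) \<le> \<theta> * n ^ 3" by (simp add: power3_eq_cube algebra_simps)

  have "n * (\<delta>\<^sup>2 * n\<^sup>2 / 8) = c\<^sup>2 * n - (16 / \<delta>) * (\<theta> * n ^ 3)"
    using \<delta> by (simp add: c_def \<theta>_def power2_eq_square power3_eq_cube field_simps)
  also have "\<dots> \<le> (\<Sum>y\<in>Y. (real (card (N y)))\<^sup>2) - (16 / \<delta>) * (\<Sum>y\<in>Y. bad y)"
    using sumN2 sumbad \<delta> by (intro diff_mono mult_left_mono) auto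
  also have "\<dots> = (\<Sum>y\<in>Y. (real (card (N y)))\<^sup>2 - (16 / \<delta>) * bad y)"
    by (simp add: sum_subtractf sum_distrib_left)
  finally have sum_diff: "n * (\<delta>\<^sup>2 * n\<^sup>2 / 8)
      \<le> (\<Sum>y\<in>Y. (real (card (N y)))\<^sup>2 - (16 / \<delta>) * bad y)" .
  have "0 < \<delta>\<^sup>2 * n\<^sup>2 / 8" using \<delta> n by simp
  from exists_ge_average[OF fin(2) Y n this sum_diff]
  obtain y0 where y0: "y0 \<in> Y"
    "\<delta>\<^sup>2 * n\<^sup>2 / 8 \<le> (real (card (N y0)))\<^sup>2 - (16 / \<delta>) * bad y0"
    by blast

  define A where "A = N y0"
  have A: "A \<subseteq> X0" "finite A" using finN by (auto simp: A_def N_def)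
  have bad0: "0 \<le> bad y0" by (simp add: bad_def)
  have "(\<delta> * n / 3)\<^sup>2 \<le> \<delta>\<^sup>2 * n\<^sup>2 / 8" by (simp add: power_mult_distrib power_divide)
  also have "\<dots> \<le> (real (card A))\<^sup>2"
    using y0 bad0 \<delta> by (auto simp: A_def intro: order_trans)
  finally have cA: "\<delta> * n / 3 \<le> card A" by (rule power2_le_imp_le) simp
  then have cA0: "0 < real (card A)" using \<delta> n by (smt (verit) divide_pos_pos mult_pos_pos)
  have "(16 / \<delta>) * bad y0 \<le> (real (card A))\<^sup>2"
  proof -
    have "0 \<le> \<delta>\<^sup>2 * n\<^sup>2 / 8" by simp
    then show ?thesis using y0(2) unfolding A_def by linarith
  qed
  then have badA: "bad y0 \<le> \<delta> / 16 * (real (card A))\<^sup>2" using \<delta> by (simp add: field_simps)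

  \<comment> \<open>At most half of the vertices of \<open>A\<close> form a bad pair with more than \<open>\<delta> |A|/8\<close> others,
    whereas a vertex of \<open>Y'\<close> has at least \<open>\<delta> |A|/4\<close> neighbours in \<open>A\<close>.\<close>
  define nb where "nb x = real (card {x1 \<in> A. cod x x1 < \<theta> * n})" for x
  define X' where "X' = {x \<in> A. nb x \<le> \<delta> / 8 * card A}"
  define Y' where "Y' = {y \<in> Y. \<delta> / 4 * card A \<le> card {x \<in> A. (x, y) \<in> G}}"
  have X'A: "X' \<subseteq> A" by (auto simp: X'_def)
  have finX': "finite X'" using X'A A finite_subset by auto
  have "(real (card A) - real (card X')) * (\<delta> / 8 * card A) = (\<Sum>x\<in>A - X'. \<delta> / 8 * card A)"
    using X'A A finX' by (simp add: card_Diff_subset card_mono of_nat_diff)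
  also have "\<dots> \<le> (\<Sum>x\<in>A - X'. nb x)" by (intro sum_mono) (auto simp: X'_def)
  also have "\<dots> \<le> (\<Sum>x\<in>A. nb x)"
    using A by (intro sum_mono2) (auto simp: nb_def)
  also have "\<dots> = bad y0"
    unfolding bad_def nb_def A_def[symmetric] using A
    by (subst card_filter_pairs[symmetric]) auto
  finally have "(real (card A) - real (card X')) * (\<delta> / 8 * card A)
      \<le> (real (card A) / 2) * (\<delta> / 8 * card A)"
    using badA by (simp add: power2_eq_square algebra_simps)
  moreover have "0 < \<delta> / 8 * card A" using \<delta> cA0 by simp
  ultimately have "real (card A) - real (card X') \<le> real (card A) / 2"
    by (meson mult_le_cancel_right_pos)
  then have cX': "\<delta> * n / 6 \<le> card X'" using cA by linarith

  have finY': "finite Y'" "Y' \<subseteq> Y" using fin by (auto simp: Y'_def)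
  have "real (card A) * (\<delta> * n / 2) = (\<Sum>x\<in>A. \<delta> * n / 2)" by simp
  also have "\<dots> \<le> (\<Sum>x\<in>A. deg x)" using A by (intro sum_mono) (auto simp: X0_def)
  also have "\<dots> = (\<Sum>y\<in>Y. real (card {x \<in> A. (x, y) \<in> G}))"
    unfolding deg_def using A fin by (intro double_counting) auto
  also have "\<dots> = (\<Sum>y\<in>Y'. real (card {x \<in> A. (x, y) \<in> G})) + (\<Sum>y\<in>Y - Y'. real (card {x \<in> A. (x, y) \<in> G}))"
    using finY' fin by (subst sum.subset_diff[of Y' Y]) auto
  also have "\<dots> \<le> (\<Sum>y\<in>Y'. real (card A)) + (\<Sum>y\<in>Y - Y'. \<delta> / 4 * card A)"
    using A by (intro add_mono sum_mono) (auto simp: Y'_def intro!: card_mono)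
  also have "\<dots> \<le> (\<Sum>y\<in>Y'. real (card A)) + (\<Sum>y\<in>Y. \<delta> / 4 * card A)"
    using fin \<delta> by (intro add_left_mono sum_mono2) auto
  also have "\<dots> \<le> card Y' * real (card A) + n * (\<delta> / 4 * card A)"
    using Y \<delta> by (simp, intro mult_right_mono) auto
  finally have "real (card A) * (\<delta> * n / 4) \<le> real (card A) * card Y'"
    by (simp add: algebra_simps)
  then have cY': "\<delta> * n / 4 \<le> card Y'" using cA0 by (simp add: mult_le_cancel_left_pos)

  have paths: "\<delta> ^ 5 * n\<^sup>2 / 3072 \<le> card {(x1, y1). (x, y1) \<in> G \<and> (x1, y1) \<in> G \<and> (x1, y) \<in> G}"
    if x: "x \<in> X'" and y: "y \<in> Y'" for x y
  proof -
    define Z where "Z = {x1 \<in> A. (x1, y) \<in> G \<and> \<theta> * n \<le> cod x x1}"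
    have finZ: "finite Z" using A by (auto simp: Z_def)
    have "{x1 \<in> A. (x1, y) \<in> G} \<subseteq> Z \<union> {x1 \<in> A. cod x x1 < \<theta> * n}" by (auto simp: Z_def)
    then have "card {x1 \<in> A. (x1, y) \<in> G} \<le> card (Z \<union> {x1 \<in> A. cod x x1 < \<theta> * n})"
      using finZ A by (intro card_mono) auto
    also have "\<dots> \<le> card Z + card {x1 \<in> A. cod x x1 < \<theta> * n}" by (rule card_Un_le)
    finally have "real (card {x1 \<in> A. (x1, y) \<in> G}) \<le> card Z + nb x" by (simp add: nb_def)
    then have "\<delta> / 8 * card A \<le> card Z" using x y by (simp add: X'_def Y'_def)
    moreover have "\<delta> / 8 * (\<delta> * n / 3) \<le> \<delta> / 8 * card A"
      using cA \<delta> by (intro mult_left_mono) auto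
    ultimately have cZ: "\<delta>\<^sup>2 * n / 24 \<le> card Z" by (simp add: power2_eq_square)
    have "\<delta> ^ 5 * n\<^sup>2 / 3072 = (\<delta>\<^sup>2 * n / 24) * (\<theta> * n)"
      by (simp add: \<theta>_def power2_eq_square power3_eq_cube numeral_eq_Suc)
    also have "\<dots> \<le> card Z * (\<theta> * n)" using cZ \<delta> n by (intro mult_right_mono) (auto simp: \<theta>_def)
    also have "\<dots> = (\<Sum>x1\<in>Z. \<theta> * n)" by simp
    also have "\<dots> \<le> (\<Sum>x1\<in>Z. cod x x1)" by (intro sum_mono) (auto simp: Z_def)
    also have "\<dots> = card {(x1, y1). x1 \<in> Z \<and> y1 \<in> Y \<and> (x, y1) \<in> G \<and> (x1, y1) \<in> G}"
      unfolding cod_def using finZ fin by (subst card_filter_pairs[symmetric]) auto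
    also have "\<dots> \<le> card {(x1, y1). (x, y1) \<in> G \<and> (x1, y1) \<in> G \<and> (x1, y) \<in> G}"
    proof -
      have "finite {(x1, y1). (x, y1) \<in> G \<and> (x1, y1) \<in> G \<and> (x1, y) \<in> G}"
        by (rule finite_subset[of _ "X \<times> Y"]) (use G fin in auto)
      then show ?thesis by (intro of_nat_mono card_mono) (auto simp: Z_def)
    qed
    finally show ?thesis .
  qed
  show ?thesis
    using that[of X' Y', OF _ finY'(2) cX' cY' paths] X'A A X0 by auto
qed

text \<open>
  Along a path \<open>x, y1, x1, y\<close> one has \<open>x + y = (x + y1) - (x1 + y1) + (x1 + y)\<close>.  So every element of
  \<open>X' + Y'\<close> has many representations by triples from \<open>S\<close>, and there are only \<open>n\<^sup>3\<close> triples.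
\<close>

lemma balog_szemeredi_gowers:
  fixes X Y S :: "'a::ab_group_add set" and n \<delta> :: real
  assumes fin: "finite X" "finite Y" "finite S" and G: "G \<subseteq> X \<times> Y"
    and sums: "\<And>x y. (x, y) \<in> G \<Longrightarrow> x + y \<in> S"
    and X: "card X \<le> n" and Y: "card Y \<le> n" and S: "card S \<le> n" and n: "n > 0" and \<delta>: "0 < \<delta>"
    and dense: "\<delta> * n\<^sup>2 \<le> card G"
  obtains X' Y' where "X' \<subseteq> X" "Y' \<subseteq> Y" "\<delta> * n / 6 \<le> card X'" "\<delta> * n / 4 \<le> card Y'"
    "card (X' + Y') \<le> 3072 / \<delta> ^ 5 * n"
proof -
  obtain X' Y' where XY: "X' \<subseteq> X" "Y' \<subseteq> Y" "\<delta> * n / 6 \<le> card X'" "\<delta> * n / 4 \<le> card Y'"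
    and paths: "\<And>x y. x \<in> X' \<Longrightarrow> y \<in> Y' \<Longrightarrow>
      \<delta> ^ 5 * n\<^sup>2 / 3072 \<le> card {(x1, y1). (x, y1) \<in> G \<and> (x1, y1) \<in> G \<and> (x1, y) \<in> G}"
    using many_paths_of_length_three[OF fin(1,2) G X Y n \<delta> dense] by blast
  define T where "T z = {(a, b, c). a \<in> S \<and> b \<in> S \<and> c \<in> S \<and> z = a - b + c}" for z
  have "T z \<subseteq> S \<times> S \<times> S" for z by (auto simp: T_def)
  then have finT: "finite (T z)" for z using fin by (meson finite_SigmaI finite_subset)
  have T: "\<delta> ^ 5 * n\<^sup>2 / 3072 \<le> card (T z)" if zXY: "z \<in> X' + Y'" for z
  proof -
    obtain x y where z: "z = x + y" "x \<in> X'" "y \<in> Y'" using zXY by (rule set_plus_elim)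
    let ?f = "\<lambda>(x1, y1). (x + y1, x1 + y1, x1 + y)"
    have "card {(x1, y1). (x, y1) \<in> G \<and> (x1, y1) \<in> G \<and> (x1, y) \<in> G} \<le> card (T z)"
      using sums by (intro card_inj_on_le[of ?f] finT) (auto simp: inj_on_def T_def z)
    then show ?thesis using paths[OF z(2,3)] by linarith
  qed
  have finXY: "finite (X' + Y')" using XY fin finite_subset by (auto intro!: finite_set_plus)
  have "card (X' + Y') * (\<delta> ^ 5 * n\<^sup>2 / 3072) = (\<Sum>z\<in>X' + Y'. \<delta> ^ 5 * n\<^sup>2 / 3072)" by simp
  also have "\<dots> \<le> (\<Sum>z\<in>X' + Y'. real (card (T z)))" by (intro sum_mono T)
  also have "\<dots> = real (card (\<Union>z\<in>X' + Y'. T z))"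
    using finXY finT by (subst card_UN_disjoint) (auto simp: T_def)
  also have "\<dots> \<le> card (S \<times> S \<times> S)"
    using fin by (intro of_nat_mono card_mono) (auto simp: T_def)
  also have "\<dots> = real (card S) * (real (card S) * real (card S))" by (simp add: card_cartesian_product)
  also have "\<dots> \<le> n * (n * n)" using S n by (intro mult_mono) auto
  finally have "card (X' + Y') \<le> 3072 / \<delta> ^ 5 * n"
    using n \<delta> by (simp add: power2_eq_square field_simps)
  then show ?thesis using that XY by blast
qed

section \<open>Sums of dilates in a prime field\<close>

lemma sum_square_le:
  fixes f :: "'a \<Rightarrow> real"
  assumes "finite A"
  shows "(sum f A)\<^sup>2 \<le> card A * (\<Sum>x\<in>A. (f x)\<^sup>2)"
proof (cases "A = {}")
  case False
  then have c: "real (card A) > 0" using assms by (simp add: card_gt_0_iff)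
  define m where "m = sum f A / card A"
  have m: "sum f A = m * card A" using c by (simp add: m_def)
  have "0 \<le> (\<Sum>x\<in>A. (f x - m)\<^sup>2)" by (intro sum_nonneg) auto
  also have "\<dots> = (\<Sum>x\<in>A. (f x)\<^sup>2) + card A * m\<^sup>2 - 2 * m * sum f A"
    unfolding power2_diff sum.distrib sum_subtractf mult.assoc sum_distrib_right[symmetric]
      sum_distrib_left[symmetric] by simp
  also have "\<dots> = (\<Sum>x\<in>A. (f x)\<^sup>2) - card A * m\<^sup>2"
    by (simp add: m power2_eq_square)
  finally have "card A * (card A * m\<^sup>2) \<le> card A * (\<Sum>x\<in>A. (f x)\<^sup>2)"
    using c by (intro mult_left_mono) auto
  then show ?thesis by (simp add: m power2_eq_square mult_ac)
qed simp

text \<open>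
  Cauchy-Schwarz for the fibre sizes of \<open>f\<close>: few collisions force a large image.
\<close>

lemma card_square_le_collisions:
  assumes "finite A"
  shows "(real (card A))\<^sup>2 \<le> card (f ` A) * real (card {(x, y). x \<in> A \<and> y \<in> A \<and> f x = f y})"
proof -
  let ?r = "\<lambda>z. real (card {x \<in> A. f x = z})"
  have "real (card A) = (\<Sum>x\<in>A. 1)" by simp
  also have "\<dots> = (\<Sum>z\<in>f ` A. ?r z)"
    using assms by (subst sum.image_gen[of A _ f]) auto
  finally have "(real (card A))\<^sup>2 \<le> card (f ` A) * (\<Sum>z\<in>f ` A. (?r z)\<^sup>2)"
    using sum_square_le[of "f ` A" ?r] assms by simp
  also have "(\<Sum>z\<in>f ` A. (?r z)\<^sup>2) = (\<Sum>x\<in>A. real (card {y \<in> A. f x = f y}))"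
  proof -
    have "(\<Sum>x\<in>A. real (card {y \<in> A. f x = f y}))
        = (\<Sum>z\<in>f ` A. \<Sum>x\<in>{x \<in> A. f x = z}. real (card {y \<in> A. f x = f y}))"
      using assms by (rule sum.image_gen)
    also have "\<dots> = (\<Sum>z\<in>f ` A. \<Sum>x\<in>{x \<in> A. f x = z}. ?r z)"
      by (intro sum.cong refl arg_cong[where f = card] arg_cong[where f = real]) auto
    finally show ?thesis by (simp add: power2_eq_square)
  qed
  also have "\<dots> = card {(x, y). x \<in> A \<and> y \<in> A \<and> f x = f y}"
    using assms by (subst card_filter_pairs) auto
  finally show ?thesis .
qed

text \<open>
  A finite prime field with unit \<open>e\<close>, sitting inside a commutative ring whose own unit may differ
  from \<open>e\<close>.  Being a subset of a ring rather than a type, the field may depend on a variable prime.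
  The last assumption says that \<open>e\<close> generates the additive group; it is the only place where
  primality enters, and it fails for larger finite fields, where subfields would be counterexamples
  to growth.
\<close>

locale prime_subfield =
  fixes F :: "'a::comm_ring_1 set" and e :: 'a and rec :: "'a \<Rightarrow> 'a"
  assumes finite_F: "finite F"
    and zero_F: "0 \<in> F" and e_F: "e \<in> F" and e_nonzero: "e \<noteq> 0"
    and add_F: "\<And>x y. x \<in> F \<Longrightarrow> y \<in> F \<Longrightarrow> x + y \<in> F"
    and uminus_F: "\<And>x. x \<in> F \<Longrightarrow> - x \<in> F"
    and mult_F: "\<And>x y. x \<in> F \<Longrightarrow> y \<in> F \<Longrightarrow> x * y \<in> F"
    and e_mult: "\<And>x. x \<in> F \<Longrightarrow> e * x = x"
    and rec_F: "\<And>x. x \<in> F \<Longrightarrow> x \<noteq> 0 \<Longrightarrow> rec x \<in> F"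
    and rec_mult: "\<And>x. x \<in> F \<Longrightarrow> x \<noteq> 0 \<Longrightarrow> rec x * x = e"
    and prime_F: "\<And>R. R \<subseteq> F \<Longrightarrow> 0 \<in> R \<Longrightarrow> (\<And>x. x \<in> R \<Longrightarrow> x + e \<in> R) \<Longrightarrow> R = F"
begin

lemma diff_F: "x \<in> F \<Longrightarrow> y \<in> F \<Longrightarrow> x - y \<in> F"
  using add_F[of x "- y"] uminus_F[of y] by simp

lemma mult_eq_0_F:
  assumes "x \<in> F" "y \<in> F" "x * y = 0"
  shows "x = 0 \<or> y = 0"
proof (rule ccontr)
  assume *: "\<not> ?thesis"
  then have "y = rec x * x * y" using assms rec_mult e_mult by simp
  also have "\<dots> = 0" using assms by (simp add: mult.assoc)
  finally show False using * by simp
qed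

lemma mult_cancel_F:
  assumes "x \<in> F" "y \<in> F" "z \<in> F" "x \<noteq> 0" "x * y = x * z"
  shows "y = z"
proof -
  have "x * (y - z) = 0" using assms by (simp add: right_diff_distrib)
  then have "y - z = 0" using mult_eq_0_F[of x "y - z"] diff_F[of y z] assms by blast
  then show ?thesis by simp
qed

lemma inj_on_mult_F:
  assumes "x \<in> F" "x \<noteq> 0" "A \<subseteq> F"
  shows "inj_on ((*) x) A"
proof (rule inj_onI)
  fix y z assume "y \<in> A" "z \<in> A" "x * y = x * z"
  then show "y = z" using mult_cancel_F[of x y z] assms by blast
qed

text \<open>
  A collision \<open>x + q y = x' + q y'\<close> between distinct pairs determines \<open>q\<close>.  So the average number of
  collisions over \<open>q \<in> Q\<close> is at most \<open>|D|\<^sup>2 + |D|\<^sup>4/|Q|\<close>, and few collisions mean many sums.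
\<close>

lemma exists_large_dilate_sum:
  assumes D: "D \<subseteq> F" and Q: "Q \<subseteq> F" "Q \<noteq> {}"
  obtains q where "q \<in> Q"
    "real (card Q) * (real (card D))\<^sup>2 \<le> card (D + (*) q ` D) * (real (card Q) + (real (card D))\<^sup>2)"
proof (cases "D = {}")
  case True
  then show ?thesis using that Q by auto
next
  case False
  have finD: "finite D" and finQ: "finite Q" using D Q finite_F finite_subset by auto
  let ?d = "real (card D)" and ?q = "real (card Q)"
  have d: "?d > 0" using False finD by (simp add: card_gt_0_iff)
  have q: "?q > 0" using Q finQ by (simp add: card_gt_0_iff)
  let ?DD = "D \<times> D"
  define En where "En q = real (card {(x, y). x \<in> ?DD \<and> y \<in> ?DD \<and>
      fst x + q * snd x = fst y + q * snd y})" for q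
  have CS: "?d ^ 4 \<le> card (D + (*) q ` D) * En q" for q
  proof -
    have "D + (*) q ` D = (\<lambda>x. fst x + q * snd x) ` ?DD"
      by (auto simp: set_plus_def image_def)
    moreover have "(real (card ?DD))\<^sup>2 = ?d ^ 4"
      by (simp add: card_cartesian_product power2_eq_square power4_eq_xxxx)
    ultimately show ?thesis
      using card_square_le_collisions[of ?DD "\<lambda>x. fst x + q * snd x"] finD unfolding En_def by simp
  qed
  \<comment> \<open>Two distinct pairs determine at most one dilation at which they collide.\<close>
  have one: "card {q \<in> Q. fst x + q * snd x = fst y + q * snd y} \<le> (if x = y then card Q else 1)"
    if xy: "x \<in> ?DD" "y \<in> ?DD" for x y
  proof (cases "x = y")
    case False
    let ?T = "{q \<in> Q. fst x + q * snd x = fst y + q * snd y}"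
    have "q1 = q2" if "q1 \<in> ?T" "q2 \<in> ?T" for q1 q2
    proof -
      have eq: "q1 * (snd x - snd y) = fst y - fst x" "q2 * (snd x - snd y) = fst y - fst x"
        using that by (auto simp: algebra_simps)
      have "snd x \<noteq> snd y"
      proof
        assume "snd x = snd y"
        then have "fst x = fst y" using eq by simp
        then show False using False \<open>snd x = snd y\<close> by (simp add: prod_eq_iff)
      qed
      then have "snd x - snd y \<noteq> 0" by simp
      moreover have "snd x - snd y \<in> F" using xy D by (intro diff_F) auto
      moreover have "q1 \<in> F" "q2 \<in> F" using that Q by auto
      moreover have "(snd x - snd y) * q1 = (snd x - snd y) * q2"
        using eq by (simp add: mult.commute)
      ultimately show ?thesis by (intro mult_cancel_F[of "snd x - snd y" q1 q2])
    qed
    then have "card ?T \<le> 1" using finQ by (intro card_le_Suc0_iff_eq[THEN iffD2, folded One_nat_def]) auto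
    then show ?thesis using False by simp
  qed (use finQ in \<open>auto intro: card_mono\<close>)
  have "(\<Sum>q\<in>Q. En q) = (\<Sum>q\<in>Q. real (card {z \<in> ?DD \<times> ?DD.
      fst (fst z) + q * snd (fst z) = fst (snd z) + q * snd (snd z)}))"
    unfolding En_def
    by (intro sum.cong refl arg_cong[where f = card] arg_cong[where f = real]) auto
  also have "\<dots> = (\<Sum>z\<in>?DD \<times> ?DD. real (card {q \<in> Q.
      fst (fst z) + q * snd (fst z) = fst (snd z) + q * snd (snd z)}))"
    using finD finQ by (intro double_counting) auto
  also have "\<dots> \<le> (\<Sum>z\<in>?DD \<times> ?DD. if fst z = snd z then ?q else 1)"
  proof (intro sum_mono)
    fix z assume "z \<in> ?DD \<times> ?DD"
    then show "real (card {q \<in> Q. fst (fst z) + q * snd (fst z) = fst (snd z) + q * snd (snd z)})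
        \<le> (if fst z = snd z then ?q else 1)"
      using one[of "fst z" "snd z"] by (auto split: if_splits)
  qed
  also have "\<dots> = (\<Sum>x\<in>?DD. \<Sum>y\<in>?DD. if x = y then ?q else 1)"
    by (subst sum.cartesian_product) (auto intro: sum.cong)
  also have "\<dots> \<le> (\<Sum>x\<in>?DD. \<Sum>y\<in>?DD. (if x = y then ?q else 0) + 1)"
    by (intro sum_mono) auto
  also have "\<dots> = ?d\<^sup>2 * ?q + ?d ^ 4"
    using finD by (simp add: sum.distrib card_cartesian_product power2_eq_square power4_eq_xxxx
        distrib_left mult.assoc)
  finally have total: "(\<Sum>q\<in>Q. En q) \<le> ?d\<^sup>2 * (?q + ?d\<^sup>2)"
    by (simp add: algebra_simps power2_eq_square power4_eq_xxxx)
  have "\<exists>q\<in>Q. En q \<le> ?d\<^sup>2 * (?q + ?d\<^sup>2) / ?q"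
  proof (rule ccontr)
    assume "\<not> ?thesis"
    then have "(\<Sum>q\<in>Q. ?d\<^sup>2 * (?q + ?d\<^sup>2) / ?q) < (\<Sum>q\<in>Q. En q)"
      using Q finQ by (intro sum_strict_mono) auto
    then show False using total q by simp
  qed
  then obtain q0 where q0: "q0 \<in> Q" "En q0 \<le> ?d\<^sup>2 * (?q + ?d\<^sup>2) / ?q" by blast
  have "?d ^ 4 \<le> card (D + (*) q0 ` D) * (?d\<^sup>2 * (?q + ?d\<^sup>2) / ?q)"
    using CS[of q0] q0(2) by (meson mult_left_mono of_nat_0_le_iff order_trans)
  then have "?d\<^sup>2 * (?q * ?d\<^sup>2) \<le> ?d\<^sup>2 * (card (D + (*) q0 ` D) * (?q + ?d\<^sup>2))"
    using q by (simp add: field_simps power2_eq_square power4_eq_xxxx)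
  then show ?thesis using that[OF q0(1)] d by (simp add: mult_le_cancel_left_pos)
qed

end

text \<open>
  The multipliers \<open>q\<close> for which at most \<open>M\<close> translates of \<open>m (D - D)\<close> cover \<open>q D\<close>.  Unlike smallness of
  \<open>D + q D\<close>, this property is inherited by sums and products of multipliers without further hypotheses.
\<close>

definition covered :: "'a::comm_ring_1 set \<Rightarrow> real \<Rightarrow> nat \<Rightarrow> 'a \<Rightarrow> bool" where
  "covered D M m q \<longleftrightarrow>
     (\<exists>T. finite T \<and> real (card T) \<le> M \<and> (*) q ` D \<subseteq> T + multisum m (D + uminus ` D))"

lemma image_set_plus:
  assumes "\<And>x y. h (x + y) = h x + h y"
  shows "h ` (A + B) = h ` A + h ` B"
proof (intro subset_antisym subsetI)
  fix z assume "z \<in> h ` (A + B)"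
  then obtain a b where "a \<in> A" "b \<in> B" "z = h a + h b" by (auto simp: set_plus_def assms)
  then show "z \<in> h ` A + h ` B" by auto
next
  fix z assume "z \<in> h ` A + h ` B"
  then obtain a b where "a \<in> A" "b \<in> B" "z = h (a + b)" by (auto simp: set_plus_def assms)
  then show "z \<in> h ` (A + B)" by auto
qed

lemma image_multisum:
  assumes "\<And>x y. h (x + y) = h x + h y" "h 0 = 0"
  shows "h ` multisum m B = multisum m (h ` B)"
  by (induction m) (auto simp: assms image_set_plus[of h])

lemma uminus_set_plus: "uminus ` (A + B) = uminus ` A + uminus ` (B :: 'a::ab_group_add set)"
  by (rule image_set_plus) simp

lemma uminus_difference_set:
  fixes D :: "'a::ab_group_add set"
  shows "uminus ` (D + uminus ` D) = D + uminus ` D"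
  by (simp add: uminus_set_plus image_image add.commute)

lemma uminus_multisum_difference_set:
  fixes D :: "'a::ab_group_add set"
  shows "uminus ` multisum m (D + uminus ` D) = multisum m (D + uminus ` D)"
  by (simp add: image_multisum[of uminus] uminus_difference_set)

lemma card_set_plus_le_real:
  fixes M M' :: real
  assumes "finite A" "finite B" "card A \<le> M" "card B \<le> M'"
  shows "card (A + B) \<le> M * M'"
proof -
  have "real (card (A + B)) \<le> real (card A) * real (card B)"
    using card_set_plus_le[OF assms(1,2)] by (metis of_nat_le_iff of_nat_mult)
  also have "\<dots> \<le> M * M'" using assms by (intro mult_mono) auto
  finally show ?thesis .
qed

lemma covered_add:
  assumes "covered D M m q" "covered D M' m' q'"
  shows "covered D (M * M') (m + m') (q + q')"
proof -
  let ?E = "D + uminus ` D"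
  obtain T T' where T: "finite T" "card T \<le> M" "(*) q ` D \<subseteq> T + multisum m ?E"
    and T': "finite T'" "card T' \<le> M'" "(*) q' ` D \<subseteq> T' + multisum m' ?E"
    using assms unfolding covered_def by blast
  have "(*) (q + q') ` D \<subseteq> (*) q ` D + (*) q' ` D"
    by (auto simp: distrib_right)
  also have "\<dots> \<subseteq> (T + multisum m ?E) + (T' + multisum m' ?E)"
    using T T' by (intro set_plus_mono2)
  also have "\<dots> = (T + T') + multisum (m + m') ?E" by (simp add: multisum_add add_ac)
  finally show ?thesis
    using card_set_plus_le_real[OF T(1) T'(1) T(2) T'(2)] finite_set_plus[OF T(1) T'(1)]
    unfolding covered_def by (intro exI[of _ "T + T'"]) auto
qed

lemma covered_uminus:
  assumes "covered D M m q"
  shows "covered D M m (- q)"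
proof -
  let ?E = "D + uminus ` D"
  obtain T where T: "finite T" "card T \<le> M" "(*) q ` D \<subseteq> T + multisum m ?E"
    using assms unfolding covered_def by blast
  have "(*) (- q) ` D = uminus ` (*) q ` D" by (simp add: image_image)
  also have "\<dots> \<subseteq> uminus ` (T + multisum m ?E)" using T by (intro image_mono)
  also have "\<dots> = uminus ` T + multisum m ?E"
    by (simp add: uminus_set_plus uminus_multisum_difference_set)
  finally show ?thesis
    using T card_image[of uminus T] unfolding covered_def
    by (intro exI[of _ "uminus ` T"]) (auto simp: inj_on_def)
qed

lemma covered_diff:
  assumes "covered D M m q" "covered D M' m' q'"
  shows "covered D (M * M') (m + m') (q - q')"
  using covered_add[OF assms(1) covered_uminus[OF assms(2)]] by simp

text \<open>
  Multiply a covering of \<open>q' D\<close> by \<open>q\<close> and cover each of the \<open>m'\<close> copies of \<open>q (D - D)\<close> by the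
  difference of two copies of the covering of \<open>q D\<close>.
\<close>

lemma covered_mult:
  assumes "covered D M m q" "covered D M' m' q'"
  shows "covered D (M' * M ^ (2 * m')) (2 * m * m') (q * q')"
proof -
  let ?E = "D + uminus ` D"
  obtain T T' where T: "finite T" "card T \<le> M" "(*) q ` D \<subseteq> T + multisum m ?E"
    and T': "finite T'" "card T' \<le> M'" "(*) q' ` D \<subseteq> T' + multisum m' ?E"
    using assms unfolding covered_def by blast
  let ?TT = "T + uminus ` T"
  have qadd: "q * (x + y) = q * x + q * y" for x y by (rule distrib_left)
  have "(*) q ` ?E = (*) q ` D + uminus ` (*) q ` D"
    by (simp add: image_set_plus[of "(*) q", OF qadd] image_image)
  also have "\<dots> \<subseteq> (T + multisum m ?E) + uminus ` (T + multisum m ?E)"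
    using T by (intro set_plus_mono2 image_mono)
  also have "\<dots> = ?TT + multisum (2 * m) ?E"
    by (simp add: uminus_set_plus uminus_multisum_difference_set mult_2 multisum_add add_ac)
  finally have qE: "(*) q ` ?E \<subseteq> ?TT + multisum (2 * m) ?E" .
  have "(*) (q * q') ` D = (*) q ` (*) q' ` D" by (simp add: image_image mult.assoc)
  also have "\<dots> \<subseteq> (*) q ` (T' + multisum m' ?E)" using T' by (intro image_mono)
  also have "\<dots> = (*) q ` T' + multisum m' ((*) q ` ?E)"
    by (simp add: image_set_plus[of "(*) q", OF qadd] image_multisum[of "(*) q", OF qadd])
  also have "\<dots> \<subseteq> (*) q ` T' + multisum m' (?TT + multisum (2 * m) ?E)"
    using qE by (intro set_plus_mono2 multisum_mono) auto
  also have "\<dots> = ((*) q ` T' + multisum m' ?TT) + multisum (2 * m * m') ?E"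
    by (simp add: multisum_plus multisum_mult add_ac mult_ac)
  finally have sub: "(*) (q * q') ` D \<subseteq> ((*) q ` T' + multisum m' ?TT) + multisum (2 * m * m') ?E" .
  have finTT: "finite ?TT" using T by (intro finite_set_plus) auto
  have "real (card ?TT) \<le> M * M"
    using T by (intro card_set_plus_le_real) (auto simp: card_image inj_on_def)
  then have "real (card ?TT) ^ m' \<le> (M * M) ^ m'" by (intro power_mono) auto
  also have "(M * M) ^ m' = M ^ (2 * m')" by (simp add: power_mult power2_eq_square)
  finally have "real (card ?TT) ^ m' \<le> M ^ (2 * m')" .
  moreover have "real (card (multisum m' ?TT)) \<le> real (card ?TT) ^ m'"
    using card_multisum_le[OF finTT, of m'] by (simp flip: of_nat_power)
  moreover have "card ((*) q ` T') \<le> M'"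
    using card_image_le[OF T'(1), of "(*) q"] T'(2) by linarith
  ultimately have "card ((*) q ` T' + multisum m' ?TT) \<le> M' * M ^ (2 * m')"
    by (intro card_set_plus_le_real finite_multisum finite_imageI T'(1) finTT) (assumption | linarith)+
  moreover have "finite ((*) q ` T' + multisum m' ?TT)"
    using T(1) T'(1) by (intro finite_set_plus finite_multisum) auto
  ultimately show ?thesis
    using sub unfolding covered_def by (intro exI[of _ "(*) q ` T' + multisum m' ?TT"]) auto
qed

text \<open>
  A covered multiplier gives a small sum of dilates, because \<open>D + m (D - D)\<close> is small by
  Pluennecke-Ruzsa.  The set \<open>V\<close> only witnesses that \<open>D\<close> grows slowly.
\<close>

lemma card_dilate_sum_le:
  fixes D V :: "'a::comm_ring_1 set" and \<kappa> M :: real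
  assumes "finite D" "finite V" "V \<noteq> {}" "\<kappa> \<ge> 0" "card (V + D) \<le> \<kappa> * card V"
    and "covered D M m q"
  shows "card (D + (*) q ` D) \<le> M * (\<kappa> ^ (2 * m + 1) * card V)"
proof -
  let ?E = "D + uminus ` D"
  obtain T where T: "finite T" "card T \<le> M" "(*) q ` D \<subseteq> T + multisum m ?E"
    using assms unfolding covered_def by blast
  have D1: "D + multisum m ?E = multisum (m + 1) D + uminus ` multisum m D"
    by (simp add: multisum_plus image_multisum[of uminus] add_ac)
  have fin: "finite (D + multisum m ?E)"
    using assms by (intro finite_set_plus finite_multisum) auto
  have "D + (*) q ` D \<subseteq> D + (T + multisum m ?E)" using T by (intro set_plus_mono2) auto
  also have "\<dots> = T + (D + multisum m ?E)" by (simp add: add_ac)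
  finally have "card (D + (*) q ` D) \<le> card (T + (D + multisum m ?E))"
    using T fin by (intro card_mono finite_set_plus[OF T(1) fin])
  also have "real \<dots> \<le> M * (\<kappa> ^ (2 * m + 1) * card V)"
  proof (rule card_set_plus_le_real[OF T(1) fin T(2)])
    have "card (multisum (m + 1) D + uminus ` multisum m D) \<le> \<kappa> ^ (m + 1 + m) * card V"
      using assms by (intro pluennecke_ruzsa)
    then show "card (D + multisum m ?E) \<le> \<kappa> ^ (2 * m + 1) * card V"
      unfolding D1 by (simp add: mult_2 add_ac)
  qed
  finally show ?thesis by simp
qed

context prime_subfield
begin

text \<open>
  The Glibichuk-Konyagin dichotomy for the set \<open>R\<close> of ratios \<open>(a - b)/(c - d)\<close>.  If \<open>R\<close> is the whole
  field, choose \<open>\<rho>\<close> with few collisions \<open>s + \<rho> t = s' + \<rho> t'\<close>; then \<open>\<rho> - 1\<close> is a ratio.  Otherwise some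
  \<open>x \<in> R\<close> has \<open>x + 1 \<notin> R\<close>, and for \<open>\<rho> = x + 1\<close> there are no collisions at all, because a collision
  would express \<open>\<rho>\<close> as a ratio.  In both cases \<open>\<rho> (c - d)\<close> is a short expression in elements of \<open>S\<close>.
\<close>

lemma exists_growing_ratio:
  assumes S: "S \<subseteq> F" and card_S: "card S \<ge> 2"
  obtains \<rho> a b c d where "\<rho> \<in> F" "a \<in> S" "b \<in> S" "c \<in> S" "d \<in> S" "c \<noteq> d"
    "(a - b) + (c - d) = \<rho> * (c - d)"
    "(real (card S))\<^sup>2 \<le> 2 * card (S + (*) \<rho> ` S) \<or> card F \<le> 2 * card (S + (*) \<rho> ` S)"
proof -
  have finS: "finite S" using S finite_F finite_subset by auto
  define R where "R = {r \<in> F. \<exists>a\<in>S. \<exists>b\<in>S. \<exists>c\<in>S. \<exists>d\<in>S. c \<noteq> d \<and> r * (c - d) = a - b}"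
  obtain c0 d0 where cd0: "c0 \<in> S" "d0 \<in> S" "c0 \<noteq> d0"
    using card_S by (metis card_le_Suc0_iff_eq finS not_less_eq_eq numeral_2_eq_2)
  have "0 \<in> R" using cd0 zero_F by (auto simp: R_def)
  show ?thesis
  proof (cases "R = F")
    case True
    obtain \<rho> where \<rho>: "\<rho> \<in> F"
      and big: "real (card F) * (real (card S))\<^sup>2
        \<le> card (S + (*) \<rho> ` S) * (real (card F) + (real (card S))\<^sup>2)"
      using exists_large_dilate_sum[OF S subset_refl] zero_F by blast
    have "\<rho> - e \<in> R" using True \<rho> diff_F e_F by blast
    then obtain a b c d where abcd: "a \<in> S" "b \<in> S" "c \<in> S" "d \<in> S" "c \<noteq> d" "(\<rho> - e) * (c - d) = a - b"
      by (auto simp: R_def)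
    have e: "e * (c - d) = c - d" using abcd S diff_F e_mult by blast
    have "(a - b) + (c - d) = (\<rho> - e) * (c - d) + e * (c - d)" using abcd(6) e by simp
    also have "\<dots> = \<rho> * (c - d)" by (simp only: left_diff_distrib diff_add_cancel)
    finally have "(a - b) + (c - d) = \<rho> * (c - d)" .
    moreover have "(real (card S))\<^sup>2 \<le> 2 * card (S + (*) \<rho> ` S) \<or> card F \<le> 2 * card (S + (*) \<rho> ` S)"
    proof (rule ccontr)
      let ?x = "real (card (S + (*) \<rho> ` S))"
      assume "\<not> ?thesis"
      then have *: "2 * ?x < (real (card S))\<^sup>2" "2 * ?x < real (card F)" by auto
      have "real (card F) > 0" using *(2) by linarith
      have "2 * ?x * card F < (real (card S))\<^sup>2 * card F"
        using *(1) \<open>real (card F) > 0\<close> by (rule mult_strict_right_mono)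
      moreover have "2 * ?x * (real (card S))\<^sup>2 \<le> real (card F) * (real (card S))\<^sup>2"
        using *(2) by (intro mult_right_mono) auto
      ultimately show False using big by (simp add: algebra_simps)
    qed
    ultimately show ?thesis using that \<rho> abcd by blast
  next
    case False
    have "R \<subseteq> F" by (auto simp: R_def)
    then obtain x where x: "x \<in> R" "x + e \<notin> R"
      using prime_F[of R] \<open>0 \<in> R\<close> False by blast
    then have xF: "x \<in> F" "x + e \<in> F" using e_F add_F by (auto simp: R_def)
    obtain a b c d where abcd: "a \<in> S" "b \<in> S" "c \<in> S" "d \<in> S" "c \<noteq> d" "x * (c - d) = a - b"
      using x by (auto simp: R_def)
    have "e * (c - d) = c - d" using abcd S diff_F e_mult by blast
    then have eq: "(a - b) + (c - d) = (x + e) * (c - d)"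
      using abcd(6) by (simp only: distrib_right)
    have "inj_on (\<lambda>(s, t). s + (x + e) * t) (S \<times> S)"
    proof (rule inj_onI, clarify)
      fix s t s' t' assume st: "s \<in> S" "t \<in> S" "s' \<in> S" "t' \<in> S"
        and "s + (x + e) * t = s' + (x + e) * t'"
      then have *: "(x + e) * (t - t') = s' - s" by (simp add: algebra_simps)
      have "t = t'"
      proof (rule ccontr)
        assume "t \<noteq> t'"
        then have "x + e \<in> R" using xF st * by (auto simp: R_def)
        then show False using x(2) by simp
      qed
      then show "s = s' \<and> t = t'" using * by simp
    qed
    moreover have "(\<lambda>(s, t). s + (x + e) * t) ` (S \<times> S) = S + (*) (x + e) ` S"
      by (auto simp: set_plus_def image_iff)
    ultimately have "card (S + (*) (x + e) ` S) = card (S \<times> S)" by (metis card_image)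
    then have "(real (card S))\<^sup>2 \<le> 2 * card (S + (*) (x + e) ` S)"
      by (simp add: card_cartesian_product power2_eq_square)
    then show ?thesis using that[OF xF(2) abcd(1-5) eq] by blast
  qed
qed

text \<open>
  Clearing the denominator \<open>\<xi> = c - d\<close> in \<open>S + \<rho> S\<close> gives a large set \<open>Q\<close> of multipliers \<open>s \<xi> + t \<eta>\<close>
  that are polynomial expressions in \<open>S\<close>, hence covered.  So \<open>D + q D\<close> is small for every \<open>q \<in> Q\<close>,
  whereas some \<open>q \<in> Q\<close> makes it large.  The exponents \<open>54\<close> and \<open>385 = 2 \<sqdot> 192 + 1\<close> are those of
  \<open>s \<xi> + t \<eta>\<close> under the rules for sums and products of covered multipliers.
\<close>

lemma covered_dilates_small:
  fixes \<kappa> M :: real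
  assumes D: "D \<subseteq> F" and V: "V \<subseteq> F" "V \<noteq> {}" and \<kappa>: "\<kappa> \<ge> 0" "card (V + D) \<le> \<kappa> * card V"
    and S: "S \<subseteq> F" "card S \<ge> 2" and cov: "\<And>s. s \<in> S \<Longrightarrow> covered D M 4 s"
  defines "B \<equiv> M ^ 54 * (\<kappa> ^ 385 * card V)"
  shows "(real (card D))\<^sup>2 \<le> 2 * B \<or> (real (card S))\<^sup>2 \<le> 4 * B \<or> real (card F) \<le> 4 * B"
proof -
  have finD: "finite D" and finV: "finite V" and finS: "finite S"
    using finite_subset[OF _ finite_F] D V S by blast+
  obtain \<rho> a b c d where \<rho>: "\<rho> \<in> F" and abcd: "a \<in> S" "b \<in> S" "c \<in> S" "d \<in> S" "c \<noteq> d"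
    and eq: "(a - b) + (c - d) = \<rho> * (c - d)"
    and large: "(real (card S))\<^sup>2 \<le> 2 * card (S + (*) \<rho> ` S) \<or> card F \<le> 2 * card (S + (*) \<rho> ` S)"
    using exists_growing_ratio[OF S] by blast
  define \<xi> \<eta> where "\<xi> = c - d" and "\<eta> = (a - b) + (c - d)"
  define Q where "Q = (*) \<xi> ` (S + (*) \<rho> ` S)"
  have \<xi>: "\<xi> \<in> F" "\<xi> \<noteq> 0" using abcd S diff_F by (auto simp: \<xi>_def)
  have SS: "S + (*) \<rho> ` S \<subseteq> F"
    using S \<rho> by (auto simp: set_plus_def intro!: add_F mult_F)
  then have QF: "Q \<subseteq> F" using \<xi> by (auto simp: Q_def intro!: mult_F)
  have "S \<noteq> {}" using abcd by auto
  then have Qne: "Q \<noteq> {}" by (auto simp: Q_def set_plus_def)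
  have cQ: "card Q = card (S + (*) \<rho> ` S)"
    unfolding Q_def by (intro card_image inj_on_mult_F \<xi> SS)
  have covQ: "covered D (M ^ 54) 192 q" if "q \<in> Q" for q
  proof -
    from that obtain s t where st: "s \<in> S" "t \<in> S" "q = \<xi> * (s + \<rho> * t)"
      by (auto simp: Q_def set_plus_def)
    have "q = s * \<xi> + t * (\<rho> * \<xi>)" using st by (simp add: algebra_simps)
    then have q: "q = s * \<xi> + t * \<eta>" using eq by (simp add: \<xi>_def \<eta>_def)
    have c\<xi>: "covered D (M * M) (4 + 4) \<xi>" unfolding \<xi>_def by (intro covered_diff cov abcd)
    have c\<eta>: "covered D ((M * M) * (M * M)) ((4 + 4) + (4 + 4)) \<eta>"
      unfolding \<eta>_def by (intro covered_add covered_diff cov abcd)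
    have "covered D ((M * M) * M ^ (2 * (4 + 4))) (2 * 4 * (4 + 4)) (s * \<xi>)"
      by (rule covered_mult[OF cov[OF st(1)] c\<xi>])
    moreover have "covered D ((M * M) * (M * M) * M ^ (2 * ((4 + 4) + (4 + 4)))) (2 * 4 * ((4 + 4) + (4 + 4))) (t * \<eta>)"
      by (rule covered_mult[OF cov[OF st(2)] c\<eta>])
    ultimately have "covered D ((M * M) * M ^ (2 * (4 + 4)) * ((M * M) * (M * M) * M ^ (2 * ((4 + 4) + (4 + 4)))))
        (2 * 4 * (4 + 4) + 2 * 4 * ((4 + 4) + (4 + 4))) (s * \<xi> + t * \<eta>)"
      by (rule covered_add)
    moreover have "(M * M) * M ^ (2 * (4 + 4)) * ((M * M) * (M * M) * M ^ (2 * ((4 + 4) + (4 + 4)))) = M ^ 54"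
    proof -
      have "M * M = M ^ 2" by (simp add: power2_eq_square)
      then show ?thesis by (simp only: power_add[symmetric]) simp
    qed
    ultimately show ?thesis by (simp add: q)
  qed
  obtain q where q: "q \<in> Q"
    and big: "real (card Q) * (real (card D))\<^sup>2 \<le> card (D + (*) q ` D) * (real (card Q) + (real (card D))\<^sup>2)"
    using exists_large_dilate_sum[OF D QF Qne] by blast
  have "card (D + (*) q ` D) \<le> M ^ 54 * (\<kappa> ^ (2 * 192 + 1) * card V)"
    by (rule card_dilate_sum_le[OF finD finV V(2) \<kappa> covQ[OF q]])
  then have "card (D + (*) q ` D) \<le> B" by (simp add: B_def)
  then have "real (card Q) * (real (card D))\<^sup>2 \<le> B * (real (card Q) + (real (card D))\<^sup>2)"
    using big by (meson add_nonneg_nonneg mult_right_mono of_nat_0_le_iff order_trans zero_le_power2)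
  moreover have "B \<ge> 0" using \<open>card (D + (*) q ` D) \<le> B\<close> by (meson of_nat_0_le_iff order_trans)
  ultimately have "(real (card D))\<^sup>2 \<le> 2 * B \<or> card Q \<le> 2 * B"
  proof -
    let ?x = "real (card Q)" and ?y = "(real (card D))\<^sup>2"
    assume h: "?x * ?y \<le> B * (?x + ?y)" and B: "B \<ge> 0"
    show ?thesis
    proof (rule ccontr)
      assume "\<not> ?thesis"
      then have *: "2 * B < ?y" "2 * B < ?x" by auto
      have "2 * B * ?x < ?y * ?x" using * B by (intro mult_strict_right_mono) auto
      moreover have "2 * B * ?y \<le> ?x * ?y" using * by (intro mult_right_mono) auto
      ultimately show False using h by (simp add: algebra_simps)
    qed
  qed
  then show ?thesis using large cQ by auto
qed

end

section \<open>Many dilates with structured sums\<close>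

text \<open>
  By Cauchy-Schwarz, the average of \<open>|Z b \<inter> Z b0|\<close> over pairs \<open>(b, b0)\<close> is at least \<open>\<delta>\<^sup>2 w\<close>.
\<close>

lemma popular_intersection:
  fixes \<delta> w :: real
  assumes fin: "finite B" "finite W" and B: "B \<noteq> {}" and Z: "\<And>b. b \<in> B \<Longrightarrow> Z b \<subseteq> W"
    and W: "card W \<le> w" and w: "w > 0" and \<delta>: "\<delta> > 0"
    and large: "\<And>b. b \<in> B \<Longrightarrow> \<delta> * w \<le> card (Z b)"
  obtains b0 where "b0 \<in> B"
    "\<delta>\<^sup>2 / 2 * card B \<le> card {b \<in> B. \<delta>\<^sup>2 / 2 * w \<le> card (Z b \<inter> Z b0)}"
proof -
  let ?B = "real (card B)"
  have cB: "?B > 0" using B fin by (simp add: card_gt_0_iff)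
  define r where "r z = real (card {b \<in> B. z \<in> Z b})" for z
  have "?B * (\<delta> * w) \<le> (\<Sum>b\<in>B. real (card (Z b)))"
    using sum_mono[of B "\<lambda>_. \<delta> * w" "\<lambda>b. real (card (Z b))"] large by simp
  also have "\<dots> = (\<Sum>b\<in>B. real (card {z \<in> W. z \<in> Z b}))"
    using Z by (intro sum.cong refl arg_cong[where f = card] arg_cong[where f = real]) auto
  also have "\<dots> = (\<Sum>z\<in>W. r z)" unfolding r_def using fin by (intro double_counting)
  finally have "(?B * (\<delta> * w))\<^sup>2 \<le> (\<Sum>z\<in>W. r z)\<^sup>2"
    using cB \<delta> w by (intro power_mono) auto
  also have "\<dots> \<le> card W * (\<Sum>z\<in>W. (r z)\<^sup>2)" using fin(2) by (rule sum_square_le)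
  also have "\<dots> \<le> w * (\<Sum>z\<in>W. (r z)\<^sup>2)" using W by (intro mult_right_mono sum_nonneg) auto
  also have "(\<Sum>z\<in>W. (r z)\<^sup>2) = (\<Sum>z\<in>W. real (card {q \<in> B \<times> B. z \<in> Z (fst q) \<and> z \<in> Z (snd q)}))"
  proof (intro sum.cong refl)
    fix z
    have "{q \<in> B \<times> B. z \<in> Z (fst q) \<and> z \<in> Z (snd q)} = {b \<in> B. z \<in> Z b} \<times> {b \<in> B. z \<in> Z b}"
      by auto
    then show "(r z)\<^sup>2 = real (card {q \<in> B \<times> B. z \<in> Z (fst q) \<and> z \<in> Z (snd q)})"
      by (simp add: r_def card_cartesian_product power2_eq_square)
  qed
  also have "\<dots> = (\<Sum>q\<in>B \<times> B. real (card {z \<in> W. z \<in> Z (fst q) \<and> z \<in> Z (snd q)}))"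
    using fin by (intro double_counting) auto
  also have "\<dots> = (\<Sum>q\<in>B \<times> B. real (card (Z (snd q) \<inter> Z (fst q))))"
    by (intro sum.cong refl arg_cong[where f = card] arg_cong[where f = real])
      (auto dest: Z[THEN subsetD])
  also have "\<dots> = (\<Sum>b0\<in>B. \<Sum>b\<in>B. real (card (Z b \<inter> Z b0)))"
    by (simp add: sum.cartesian_product case_prod_unfold)
  finally have "w * (?B * (\<delta>\<^sup>2 * ?B * w)) \<le> w * (\<Sum>b0\<in>B. \<Sum>b\<in>B. real (card (Z b \<inter> Z b0)))"
    by (simp add: power2_eq_square algebra_simps)
  then have "?B * (\<delta>\<^sup>2 * ?B * w) \<le> (\<Sum>b0\<in>B. \<Sum>b\<in>B. real (card (Z b \<inter> Z b0)))"
    using w by (simp add: mult_le_cancel_left_pos)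
  then obtain b0 where b0: "b0 \<in> B" and sum_b0: "\<delta>\<^sup>2 * ?B * w \<le> (\<Sum>b\<in>B. real (card (Z b \<inter> Z b0)))"
    using exists_ge_average[OF fin(1) order_refl cB, of "\<delta>\<^sup>2 * ?B * w"] \<delta> w cB by auto
  define G where "G = {b \<in> B. \<delta>\<^sup>2 / 2 * w \<le> card (Z b \<inter> Z b0)}"
  have G: "G \<subseteq> B" "finite G" using fin by (auto simp: G_def)
  have "(\<Sum>b\<in>B. real (card (Z b \<inter> Z b0))) = (\<Sum>b\<in>G. real (card (Z b \<inter> Z b0))) + (\<Sum>b\<in>B - G. real (card (Z b \<inter> Z b0)))"
    using G fin by (subst sum.subset_diff[of G B]) auto
  also have "\<dots> \<le> (\<Sum>b\<in>G. w) + (\<Sum>b\<in>B - G. \<delta>\<^sup>2 / 2 * w)"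
  proof (intro add_mono sum_mono)
    fix b assume "b \<in> G"
    then have "card (Z b \<inter> Z b0) \<le> card W" using Z G fin by (intro card_mono) auto
    then show "real (card (Z b \<inter> Z b0)) \<le> w" using W by linarith
  qed (auto simp: G_def)
  also have "\<dots> \<le> (\<Sum>b\<in>G. w) + (\<Sum>b\<in>B. \<delta>\<^sup>2 / 2 * w)"
    using fin w by (intro add_left_mono sum_mono2) auto
  finally have "w * (\<delta>\<^sup>2 / 2 * ?B) \<le> w * card G" using sum_b0 by (simp add: algebra_simps)
  then have "\<delta>\<^sup>2 / 2 * ?B \<le> card G" using w by (simp add: mult_le_cancel_left_pos)
  then show ?thesis using that b0 unfolding G_def by blast
qed

text \<open>
  This absorbs numerical constants into powers of \<open>K\<close>.
\<close>

lemma numeral_le_power: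
  fixes K :: real
  assumes "K \<ge> 2" "x \<le> 2 ^ j"
  shows "x \<le> K ^ j"
  using assms power_mono[of 2 K j] by linarith

context prime_subfield
begin

text \<open>
  The hypothesis controls only the part \<open>s Y\<close> of \<open>s D\<close>, and relative to \<open>A\<close> instead of \<open>D\<close>.  Three
  coverings bridge this: \<open>D\<close> is covered by translates of \<open>Y - Y\<close>, then \<open>s Y\<close> by translates of \<open>A - A\<close>,
  and finally \<open>A \<subseteq> V\<close> by translates of \<open>D - D\<close>.
\<close>

lemma covered_of_partial_sums:
  fixes K n :: real
  assumes finD: "finite D" and finV: "finite V" and K: "K \<ge> 1" and n: "n > 0"
    and cV: "card V \<le> n" and D: "n / K \<le> card D" and VD: "card (V + D) \<le> K * n"
    and cVK: "n / K \<le> card V"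
    and A: "A \<subseteq> V" "n / K ^ 5 \<le> card A" and Y: "Y \<subseteq> D" "n / K ^ 5 \<le> card Y"
    and AY: "card (A + (*) s ` Y) \<le> K * n"
  shows "covered D (K ^ 29) 4 s"
proof -
  let ?E = "D + uminus ` D"
  have div: "x \<le> K ^ (i + j)" if "x * c \<le> K ^ i * n" "n / K ^ j \<le> c" "x \<ge> 0" for x c :: real and i j
  proof -
    have "x * (n / K ^ j) \<le> x * c" using that by (intro mult_left_mono) auto
    also have "\<dots> \<le> K ^ i * n" by fact
    finally have "n * x \<le> n * K ^ (i + j)" using K by (simp add: field_simps power_add)
    then show ?thesis using n by (simp add: mult_le_cancel_left_pos)
  qed
  have ne: "Y \<noteq> {}" "A \<noteq> {}" "D \<noteq> {}" "V \<noteq> {}"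
  proof -
    have "n / K ^ 5 > 0" "n / K > 0" using K n by auto
    then show "Y \<noteq> {}" "A \<noteq> {}" "D \<noteq> {}" "V \<noteq> {}" using A Y D cVK by auto
  qed
  have finA: "finite A" and finY: "finite Y" using A Y finD finV finite_subset by auto
  obtain F1 where F1: "F1 \<subseteq> (*) s ` Y" "card F1 * card A \<le> card (A + (*) s ` Y)"
      "(*) s ` Y \<subseteq> F1 + (A + uminus ` A)"
    using ruzsa_covering[OF finA finite_imageI[OF finY] ne(2)] by blast
  obtain F2 where F2: "F2 \<subseteq> D" "card F2 * card Y \<le> card (Y + D)" "D \<subseteq> F2 + (Y + uminus ` Y)"
    using ruzsa_covering[OF finY finD ne(1)] by blast
  obtain F3 where F3: "F3 \<subseteq> V" "card F3 * card D \<le> card (D + V)" "V \<subseteq> F3 + ?E"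
    using ruzsa_covering[OF finD finV ne(3)] by blast
  have finF: "finite F1" "finite F2" "finite F3"
    using F1(1) F2(1) F3(1) finY finD finV finite_subset by (auto intro: finite_subset)
  have F1': "card F1 \<le> K ^ (1 + 5)"
    using F1(2) AY by (intro div[of _ "card A"] A) (auto simp flip: of_nat_mult)
  have F3': "card F3 \<le> K ^ (1 + 1)"
    using F3(2) VD D by (intro div[of _ "card D"]) (auto simp: add.commute simp flip: of_nat_mult)
  have "card (Y + D) \<le> card (multisum 2 D + uminus ` multisum 0 D)"
    using finD Y(1) by (intro card_mono) (simp_all add: numeral_2_eq_2 finite_set_plus set_plus_mono2)
  also have "real (card (multisum 2 D + uminus ` multisum 0 D)) \<le> (K ^ 2) ^ (2 + 0) * card V"
  proof (rule pluennecke_ruzsa[OF finV finD ne(4)])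
    have "K * n \<le> K ^ 2 * card V" using cVK K by (simp add: field_simps power2_eq_square)
    then show "card (V + D) \<le> K ^ 2 * card V" using VD by linarith
  qed (use K in auto)
  also have "\<dots> \<le> (K ^ 2) ^ (2 + 0) * n" using cV K by (intro mult_left_mono) auto
  finally have "card (Y + D) \<le> K ^ 4 * n" by (simp flip: power_mult)
  then have F2': "card F2 \<le> K ^ (4 + 5)"
    using F2(2) Y by (intro div[of _ "card Y"]) (auto simp flip: of_nat_mult)

  have sadd: "s * (x + y) = s * x + s * y" for x y by (rule distrib_left)
  let ?T1 = "F1 + uminus ` F1" and ?T3 = "F3 + uminus ` F3"
  define T where "T = (*) s ` F2 + (?T1 + (?T3 + ?T3))"
  have AA: "A + uminus ` A \<subseteq> ?T3 + multisum 2 ?E"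
  proof -
    have "A \<subseteq> F3 + ?E" using A F3 by blast
    then have "A + uminus ` A \<subseteq> (F3 + ?E) + uminus ` (F3 + ?E)"
      by (intro set_plus_mono2 image_mono)
    also have "uminus ` (F3 + ?E) = uminus ` F3 + ?E"
      by (simp only: uminus_set_plus[of F3 ?E] uminus_difference_set)
    also have "(F3 + ?E) + (uminus ` F3 + ?E) = ?T3 + multisum 2 ?E"
      by (simp add: numeral_2_eq_2 add_ac)
    finally show ?thesis .
  qed
  have "(*) s ` (Y + uminus ` Y) = (*) s ` Y + uminus ` (*) s ` Y"
    by (simp add: image_set_plus[of "(*) s", OF sadd] image_image)
  also have "\<dots> \<subseteq> (F1 + (A + uminus ` A)) + uminus ` (F1 + (A + uminus ` A))"
    using F1(3) by (intro set_plus_mono2 image_mono)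
  also have "uminus ` (F1 + (A + uminus ` A)) = uminus ` F1 + (A + uminus ` A)"
    by (simp only: uminus_set_plus[of F1 "A + uminus ` A"] uminus_difference_set)
  also have "(F1 + (A + uminus ` A)) + (uminus ` F1 + (A + uminus ` A))
      = ?T1 + ((A + uminus ` A) + (A + uminus ` A))" by (simp add: add_ac)
  also have "\<dots> \<subseteq> ?T1 + ((?T3 + multisum 2 ?E) + (?T3 + multisum 2 ?E))"
    by (rule set_plus_mono2[OF subset_refl set_plus_mono2[OF AA AA]])
  finally have sYY: "(*) s ` (Y + uminus ` Y) \<subseteq> ?T1 + ((?T3 + multisum 2 ?E) + (?T3 + multisum 2 ?E))" .
  have "(*) s ` D \<subseteq> (*) s ` (F2 + (Y + uminus ` Y))" using F2(3) by (intro image_mono)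
  also have "\<dots> = (*) s ` F2 + (*) s ` (Y + uminus ` Y)"
    by (rule image_set_plus[of "(*) s", OF sadd])
  also have "\<dots> \<subseteq> (*) s ` F2 + (?T1 + ((?T3 + multisum 2 ?E) + (?T3 + multisum 2 ?E)))"
    by (rule set_plus_mono2[OF subset_refl sYY])
  also have "\<dots> = T + multisum (2 + 2) ?E" by (simp only: T_def multisum_add add_ac)
  finally have "(*) s ` D \<subseteq> T + multisum 4 ?E" by simp
  moreover have finT: "finite T" using finF unfolding T_def by (intro finite_set_plus) auto
  moreover have "card T \<le> K ^ 9 * ((K ^ 6 * K ^ 6) * ((K ^ 2 * K ^ 2) * (K ^ 2 * K ^ 2)))"
  proof -
    have c1: "card F1 \<le> K ^ 6" and c3: "card F3 \<le> K ^ 2"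
      using F1' F3' by (simp_all add: power2_eq_square)
    have c2: "card ((*) s ` F2) \<le> K ^ 9" using F2' card_image_le[OF finF(2), of "(*) s"] by simp
    have n1: "card (uminus ` F1) \<le> K ^ 6" using c1 card_image_le[OF finF(1), of uminus] by linarith
    have n3: "card (uminus ` F3) \<le> K ^ 2" using c3 card_image_le[OF finF(3), of uminus] by linarith
    show ?thesis
      unfolding T_def
      by (rule card_set_plus_le_real finite_set_plus finite_imageI finF c1 c2 c3 n1 n3)+
  qed
  moreover have "K ^ 9 * ((K ^ 6 * K ^ 6) * ((K ^ 2 * K ^ 2) * (K ^ 2 * K ^ 2))) = K ^ 29"
    by (simp only: power_add[symmetric]) simp
  ultimately show ?thesis unfolding covered_def by auto
qed

text \<open>
  By \<open>popular_intersection\<close>, some \<open>(X b0, Y b0)\<close> overlaps heavily with \<open>(X b, Y b)\<close> for the \<open>b\<close> in a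
  large set \<open>G\<close>.  Dividing \<open>(1 - b) X + b Y\<close> by \<open>1 - b\<close> leaves the dilate by \<open>b/(1 - b)\<close>; normalising
  by its value at \<open>b0\<close> gives distinct multipliers \<open>s\<close>, all covered with respect to \<open>D = Y b0\<close>.  The
  exponent \<open>2350\<close> leaves room for \<open>29 \<sqdot> 54 + 2 \<sqdot> 385 = 2336\<close> together with the squared density
  losses \<open>K\<^sup>1\<^sup>2\<close> and a constant.
\<close>

lemma structured_family_bound:
  fixes K n :: real
  assumes K: "K \<ge> 2" and n: "n > 0" and V: "V \<subseteq> F" "card V \<le> n"
    and B: "B \<subseteq> F" "0 \<notin> B" "e \<notin> B" "n / K \<le> card B"
    and X: "\<And>b. b \<in> B \<Longrightarrow> X b \<subseteq> V" "\<And>b. b \<in> B \<Longrightarrow> n / K \<le> card (X b)"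
    and Y: "\<And>b. b \<in> B \<Longrightarrow> Y b \<subseteq> V" "\<And>b. b \<in> B \<Longrightarrow> n / K \<le> card (Y b)"
    and XY: "\<And>b. b \<in> B \<Longrightarrow> card ((*) (e - b) ` X b + (*) b ` Y b) \<le> K * n"
  shows "n \<le> K ^ 2350 \<or> card F \<le> K ^ 2350 * n"
proof (cases "n \<le> K ^ 7")
  case True
  also have "K ^ 7 \<le> K ^ 2350" using K by (intro power_increasing) auto
  finally show ?thesis ..
next
  case nbig: False
  have finV: "finite V" and finB: "finite B" using finite_subset[OF _ finite_F] V B by auto
  have nK: "n / K > 0" using K n by simp
  have Bne: "B \<noteq> {}" using B(4) nK by auto
  define Z where "Z b = X b \<times> Y b" for b
  have VV: "card (V \<times> V) \<le> n\<^sup>2"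
    using V n mult_mono[of "real (card V)" n "real (card V)" n]
    by (simp add: card_cartesian_product power2_eq_square)
  have Z_large: "(1 / K\<^sup>2) * n\<^sup>2 \<le> card (Z b)" if b: "b \<in> B" for b
  proof -
    have "(n / K) * (n / K) \<le> real (card (X b)) * real (card (Y b))"
      using X(2)[OF b] Y(2)[OF b] nK by (intro mult_mono) auto
    then show ?thesis by (simp add: Z_def card_cartesian_product power2_eq_square)
  qed
  have Z_sub: "Z b \<subseteq> V \<times> V" if "b \<in> B" for b using X(1) Y(1) that by (auto simp: Z_def)
  have pos: "n\<^sup>2 > 0" "1 / K\<^sup>2 > 0" using K n by auto
  obtain b0 where b0: "b0 \<in> B"
    and pop: "(1 / K\<^sup>2)\<^sup>2 / 2 * card B \<le> card {b \<in> B. (1 / K\<^sup>2)\<^sup>2 / 2 * n\<^sup>2 \<le> card (Z b \<inter> Z b0)}"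
    by (rule popular_intersection[OF finB finite_cartesian_product[OF finV finV] Bne Z_sub VV pos Z_large])
  define G where "G = {b \<in> B. (1 / K\<^sup>2)\<^sup>2 / 2 * n\<^sup>2 \<le> card (Z b \<inter> Z b0)}"
  have K5: "1 / K ^ 5 \<le> (1 / K\<^sup>2)\<^sup>2 / 2"
  proof -
    have "2 * K ^ 4 \<le> K * K ^ 4" using K by (intro mult_right_mono) auto
    then show ?thesis using K by (simp add: field_simps power2_eq_square numeral_eq_Suc)
  qed
  have "1 / K ^ 5 * (n / K) \<le> (1 / K\<^sup>2)\<^sup>2 / 2 * card B"
    using K5 B(4) nK K by (intro mult_mono) auto
  then have cG: "n / K ^ 6 \<le> card G" using pop unfolding G_def[symmetric] by (simp add: numeral_eq_Suc)
  define D where "D = Y b0"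
  \<comment> \<open>The multiplier \<open>b/(1 - b)\<close>, with \<open>e\<close> as the unit.\<close>
  define ratio where "ratio b = b * rec (e - b)" for b
  have nz: "e - b \<noteq> 0" "b \<noteq> 0" "b \<in> F" "e - b \<in> F" if "b \<in> B" for b
    using B that e_F diff_F by auto
  have ratio: "ratio b \<in> F" "ratio b \<noteq> 0" "(e - b) * ratio b = b" if "b \<in> B" for b
  proof -
    note nz = nz[OF that]
    show "ratio b \<in> F" unfolding ratio_def using nz rec_F mult_F by auto
    have "(e - b) * ratio b = b * (rec (e - b) * (e - b))" by (simp add: ratio_def mult_ac)
    also have "\<dots> = e * b" using nz rec_mult by (simp add: mult.commute)
    also have "\<dots> = b" using nz e_mult by simp
    finally show *: "(e - b) * ratio b = b" .
    show "ratio b \<noteq> 0" using * nz by auto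
  qed
  have sum_le: "card (X b + (*) (ratio b) ` Y b) \<le> K * n" if b: "b \<in> B" for b
  proof -
    have "(*) (e - b) ` (X b + (*) (ratio b) ` Y b) = (*) (e - b) ` X b + (*) (e - b) ` (*) (ratio b) ` Y b"
      by (rule image_set_plus) (rule distrib_left)
    also have "(*) (e - b) ` (*) (ratio b) ` Y b = (*) b ` Y b"
      using ratio(3)[OF b] by (simp add: image_image flip: mult.assoc)
    finally have eq: "(*) (e - b) ` (X b + (*) (ratio b) ` Y b) = (*) (e - b) ` X b + (*) b ` Y b" .
    have "X b + (*) (ratio b) ` Y b \<subseteq> F"
      using X(1)[OF b] Y(1)[OF b] V ratio[OF b] by (auto simp: set_plus_def intro!: add_F mult_F)
    then have "card ((*) (e - b) ` (X b + (*) (ratio b) ` Y b)) = card (X b + (*) (ratio b) ` Y b)"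
      using nz[OF b] by (intro card_image inj_on_mult_F)
    then show ?thesis using XY[OF b] eq by simp
  qed
  define u where "u = rec (ratio b0)"
  have u: "u \<in> F" "u * ratio b0 = e" unfolding u_def using ratio[OF b0] rec_F rec_mult by auto
  have u0: "u \<noteq> 0" using u e_nonzero by auto
  define V0 where "V0 = (*) u ` X b0"
  define S where "S = (\<lambda>b. u * ratio b) ` G"
  have DV: "D \<subseteq> V" "D \<subseteq> F" using Y(1)[OF b0] V by (auto simp: D_def)
  have Xb0: "X b0 \<subseteq> F" using X(1)[OF b0] V by auto
  have V0: "V0 \<subseteq> F" using Xb0 u by (auto simp: V0_def intro: mult_F)
  have cV0: "card V0 = card (X b0)" unfolding V0_def by (intro card_image inj_on_mult_F u u0 Xb0)
  have finX: "finite (X b)" "finite (Y b)" if "b \<in> B" for b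
    by (rule finite_subset[OF X(1)[OF that] finV], rule finite_subset[OF Y(1)[OF that] finV])
  have finV0: "finite V0" "finite D" using finX b0 by (auto simp: V0_def D_def)
  have "X b0 \<noteq> {}" using X(2)[OF b0] nK by auto
  then have V0ne: "V0 \<noteq> {}" by (auto simp: V0_def)
  have cV0n: "card V0 \<le> n" unfolding cV0 using card_mono[OF finV X(1)[OF b0]] V by linarith
  have uadd: "u * (x + y) = u * x + u * y" for x y by (rule distrib_left)
  have scale: "card ((*) u ` A + (*) (u * t) ` C) \<le> card (A + (*) t ` C)"
    if "finite A" "finite C" for A C t
  proof -
    have "(*) u ` A + (*) (u * t) ` C = (*) u ` (A + (*) t ` C)"
      by (simp add: image_set_plus[of "(*) u", OF uadd] image_image mult.assoc)
    then show ?thesis using that by (simp add: card_image_le finite_set_plus)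
  qed
  have "(*) (u * ratio b0) ` D = (\<lambda>d. d) ` D"
    using DV(2) e_mult unfolding u(2) by (intro image_cong refl) auto
  then have V0D: "card (V0 + D) \<le> K * n"
    using scale[OF finX(1)[OF b0] finX(2)[OF b0], of "ratio b0"] sum_le[OF b0]
    unfolding V0_def D_def by simp
  have D_large: "n / K \<le> card D" using Y(2)[OF b0] by (simp add: D_def)
  have V0_large: "n / K \<le> card V0" using X(2)[OF b0] by (simp add: cV0)
  have cov: "covered D (K ^ 29) 4 s" if s: "s \<in> S" for s
  proof -
    from s obtain b where b: "b \<in> G" "s = u * ratio b" by (auto simp: S_def)
    then have bB: "b \<in> B" by (simp add: G_def)
    define A0 Y0 where "A0 = X b \<inter> X b0" and "Y0 = Y b \<inter> D"
    have sub: "A0 \<subseteq> X b0" "A0 \<subseteq> X b" "Y0 \<subseteq> D" "Y0 \<subseteq> Y b" by (auto simp: A0_def Y0_def)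
    have fin0: "finite A0" "finite Y0" using finX[OF bB] by (auto simp: A0_def Y0_def)
    have "Z b \<inter> Z b0 = A0 \<times> Y0" by (auto simp: Z_def A0_def Y0_def D_def)
    then have "(1 / K\<^sup>2)\<^sup>2 / 2 * n\<^sup>2 \<le> real (card A0) * real (card Y0)"
      using b(1) by (simp add: G_def card_cartesian_product)
    moreover have "1 / K ^ 5 * n\<^sup>2 \<le> (1 / K\<^sup>2)\<^sup>2 / 2 * n\<^sup>2" using K5 by (intro mult_right_mono) auto
    ultimately have AY: "n / K ^ 5 * n \<le> real (card A0) * real (card Y0)"
      by (simp add: power2_eq_square)
    have A0n: "card A0 \<le> n" "card Y0 \<le> n"
      using card_mono[OF finV, of A0] card_mono[OF finV, of Y0] X(1)[OF b0] DV sub V(2)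
      by (force)+
    have "real (card A0) * real (card Y0) \<le> real (card A0) * n" using A0n by (intro mult_left_mono) auto
    then have A0: "n / K ^ 5 \<le> card A0" using AY n by (meson mult_le_cancel_right_pos order_trans)
    have "real (card A0) * real (card Y0) \<le> n * real (card Y0)" using A0n by (intro mult_right_mono) auto
    then have "n / K ^ 5 * n \<le> card Y0 * n" using AY by (simp add: mult.commute)
    then have Y0: "n / K ^ 5 \<le> card Y0" using n by (meson mult_le_cancel_right_pos)
    have uA0: "card ((*) u ` A0) = card A0"
      using sub Xb0 by (intro card_image inj_on_mult_F u u0) auto
    have "card ((*) u ` A0 + (*) s ` Y0) \<le> card (A0 + (*) (ratio b) ` Y0)"
      unfolding b(2) by (rule scale[OF fin0])
    also have "\<dots> \<le> card (X b + (*) (ratio b) ` Y b)"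
      using sub finX[OF bB] by (intro card_mono finite_set_plus set_plus_mono2 image_mono) auto
    finally have "card ((*) u ` A0 + (*) s ` Y0) \<le> K * n" using sum_le[OF bB] by linarith
    moreover have "(*) u ` A0 \<subseteq> V0" using sub by (auto simp: V0_def)
    ultimately show ?thesis
      using K n A0 Y0 sub uA0
      by (intro covered_of_partial_sums[OF finV0(2,1) _ n cV0n D_large V0D V0_large,
            of "(*) u ` A0" Y0 s]) auto
  qed
  have "inj_on (\<lambda>b. u * ratio b) G"
  proof (rule inj_onI)
    fix b b' assume bb: "b \<in> G" "b' \<in> G" "u * ratio b = u * ratio b'"
    then have bB: "b \<in> B" "b' \<in> B" by (auto simp: G_def)
    have r: "ratio b = ratio b'" by (rule mult_cancel_F[OF u(1) ratio(1)[OF bB(1)] ratio(1)[OF bB(2)] u0 bb(3)])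
    have "e * ratio b = b + b * ratio b" "e * ratio b = b' + b' * ratio b"
      using ratio(3)[OF bB(1)] ratio(3)[OF bB(2)] r by (simp_all add: algebra_simps)
    then have *: "(b - b') * (e + ratio b) = 0"
      using e_mult[OF nz(3)[OF bB(1)]] e_mult[OF nz(3)[OF bB(2)]] by (simp add: algebra_simps)
    have "e + ratio b \<noteq> 0"
    proof
      assume "e + ratio b = 0"
      then have "ratio b = - e" by (simp add: eq_neg_iff_add_eq_0 add.commute)
      then have "b = - (e * e) + e * b" using ratio(3)[OF bB(1)] by (simp add: algebra_simps)
      then have "e * e = 0" using e_mult[OF nz(3)[OF bB(1)]] by simp
      then show False using e_mult[OF e_F] e_nonzero by simp
    qed
    then show "b = b'"
      using mult_eq_0_F[OF _ _ *] nz(3)[OF bB(1)] nz(3)[OF bB(2)] diff_F add_F[OF e_F ratio(1)[OF bB(1)]]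
      by auto
  qed
  then have cS: "card S = card G" unfolding S_def by (rule card_image)
  have SF: "S \<subseteq> F" using u ratio by (auto simp: S_def G_def intro!: mult_F)
  have "K ^ 7 / K ^ 6 \<le> n / K ^ 6" using nbig K by (intro divide_right_mono) auto
  moreover have "K ^ 7 / K ^ 6 = K" using K by (simp add: numeral_eq_Suc)
  ultimately have "2 \<le> real (card S)" using cG K unfolding cS by linarith
  then have cS2: "card S \<ge> 2" by simp
  have "K * n \<le> K\<^sup>2 * card V0" using V0_large K by (simp add: field_simps power2_eq_square)
  then have \<kappa>: "card (V0 + D) \<le> K\<^sup>2 * card V0" using V0D by linarith
  define M where "M = (K ^ 29) ^ 54 * ((K\<^sup>2) ^ 385 * card V0)"
  have M: "M \<le> K ^ 2336 * n"
  proof -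
    have "(K ^ 29) ^ 54 * (K\<^sup>2) ^ 385 = K ^ 2336" by (simp flip: power_mult power_add)
    then have "M = K ^ 2336 * card V0" by (simp add: M_def flip: mult.assoc)
    then show ?thesis using cV0n K by (simp add: mult_left_mono)
  qed
  have main: "(real (card D))\<^sup>2 \<le> 2 * M \<or> (real (card S))\<^sup>2 \<le> 4 * M \<or> card F \<le> 4 * M"
    unfolding M_def using K by (intro covered_dilates_small DV V0 V0ne SF cS2 \<kappa> cov) auto
  have square: "n \<le> K ^ 2350" if "n / K ^ i \<le> x" "x\<^sup>2 \<le> 4 * M" "i \<le> 6" for x i
  proof -
    have "(n / K ^ i)\<^sup>2 \<le> x\<^sup>2" using that K n by (intro power_mono) auto
    also have "\<dots> \<le> 4 * (K ^ 2336 * n)" using that M by linarith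
    also have "\<dots> \<le> K ^ 2 * (K ^ 2336 * n)"
      using numeral_le_power[OF K, of 4 2] K n by (intro mult_right_mono) auto
    also have "K ^ 2 * (K ^ 2336 * n) = K ^ 2338 * n" by (simp flip: mult.assoc power_add)
    finally have sq: "(n / K ^ i)\<^sup>2 \<le> K ^ 2338 * n" .
    have "n * n = (n / K ^ i)\<^sup>2 * K ^ (2 * i)"
      using K by (simp add: power_divide power2_eq_square mult_2 power_add)
    also have "\<dots> \<le> (K ^ 2338 * n) * K ^ (2 * i)" using sq K by (intro mult_right_mono) auto
    finally have "n * n \<le> n * (K ^ (2 * i) * K ^ 2338)" by (simp add: mult_ac)
    then have "n \<le> K ^ (2 * i + 2338)" using n by (simp add: mult_le_cancel_left_pos power_add)
    also have "\<dots> \<le> K ^ 2350" using K that by (intro power_increasing) auto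
    finally show ?thesis .
  qed
  have M0: "M \<ge> 0" using K by (simp add: M_def)
  show ?thesis
  proof (cases "card F \<le> 4 * M")
    case True
    also have "4 * M \<le> K ^ 2 * (K ^ 2336 * n)"
      using numeral_le_power[OF K, of 4 2] M M0 K by (intro mult_mono) auto
    also have "\<dots> = K ^ 2338 * n" by (simp flip: mult.assoc power_add)
    also have "\<dots> \<le> K ^ 2350 * n" using K n by (intro mult_right_mono power_increasing) auto
    finally show ?thesis ..
  next
    case False
    then have "(real (card D))\<^sup>2 \<le> 4 * M \<or> (real (card S))\<^sup>2 \<le> 4 * M" using main M0 by auto
    then show ?thesis
      using square[of 1 "card D"] square[of 6 "card S"] D_large cG cS by auto
  qed
qed

end

section \<open>Incidences on a grid\<close>

lemma card_distinct_triples: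
  assumes "finite H"
  shows "card {(x, y, z). x \<in> H \<and> y \<in> H \<and> z \<in> H \<and> x \<noteq> y \<and> z \<noteq> x \<and> z \<noteq> y}
    = card H * (card H - 1) * (card H - 2)"
proof -
  have "{(x, y, z). x \<in> H \<and> y \<in> H \<and> z \<in> H \<and> x \<noteq> y \<and> z \<noteq> x \<and> z \<noteq> y}
      = (SIGMA x:H. SIGMA y:H - {x}. H - {x, y})" by auto
  also have "card \<dots> = (\<Sum>x\<in>H. \<Sum>y\<in>H - {x}. card (H - {x, y}))"
    using assms by (subst card_SigmaI) (auto intro!: sum.cong)
  also have "\<dots> = (\<Sum>x\<in>H. \<Sum>y\<in>H - {x}. card H - 2)"
    using assms by (intro sum.cong refl) (subst card_Diff_subset, auto)
  also have "\<dots> = (\<Sum>x\<in>H. (card H - 1) * (card H - 2))"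
    using assms by (intro sum.cong refl) simp
  finally show ?thesis by simp
qed

text \<open>
  The terms below \<open>t\<close> contribute at most \<open>a t\<close>.
\<close>

lemma sum_popular_ge:
  fixes f :: "'a \<Rightarrow> real" and a s t :: real
  assumes "finite A" "card A \<le> a" "t \<ge> 0" "s \<le> sum f A"
  shows "s - a * t \<le> sum f {x \<in> A. t \<le> f x}"
proof -
  let ?G = "{x \<in> A. t \<le> f x}"
  have "sum f A = sum f ?G + sum f (A - ?G)"
    using assms by (subst sum.subset_diff[of ?G A]) auto
  also have "sum f (A - ?G) \<le> (\<Sum>x\<in>A - ?G. t)" by (intro sum_mono) auto
  also have "\<dots> \<le> (\<Sum>x\<in>A. t)" using assms by (intro sum_mono2) auto
  also have "\<dots> \<le> a * t" using assms by (simp add: mult_right_mono)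
  finally show ?thesis using assms by linarith
qed

context prime_subfield
begin

text \<open>
  The Balog-Szemeredi-Gowers theorem, applied to \<open>(1 - b) V\<close> and \<open>b V\<close> with all sums in \<open>V\<close>, turns popularity into
  structure and replaces \<open>K\<close> by \<open>K\<^sup>1\<^sup>7\<close>; note \<open>17 \<sqdot> 2350 = 39950\<close>.
\<close>

lemma popular_dilates_bound:
  fixes K n :: real
  assumes K: "K \<ge> 2" and n: "n > 0" and V: "V \<subseteq> F" "card V \<le> n"
    and B: "B \<subseteq> F" "0 \<notin> B" "e \<notin> B" "n / K \<le> card B"
    and pop: "\<And>b. b \<in> B \<Longrightarrow> n\<^sup>2 / K \<le> card {(v, w). v \<in> V \<and> w \<in> V \<and> (e - b) * v + b * w \<in> V}"
  shows "n \<le> K ^ 39950 \<or> card F \<le> K ^ 39950 * n"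
proof -
  have finV: "finite V" using finite_subset[OF _ finite_F] V by auto
  have K17: "K \<le> K ^ 17" "2 \<le> K ^ 17"
    using K power_increasing[of 1 17 K] by auto
  have "\<exists>X Y. X \<subseteq> V \<and> Y \<subseteq> V \<and> n / K ^ 17 \<le> card X \<and> n / K ^ 17 \<le> card Y \<and>
      card ((*) (e - b) ` X + (*) b ` Y) \<le> K ^ 17 * n" if b: "b \<in> B" for b
  proof -
    let ?P = "{(v, w). v \<in> V \<and> w \<in> V \<and> (e - b) * v + b * w \<in> V}"
    let ?f = "\<lambda>(v, w). ((e - b) * v, b * w)"
    have nz: "e - b \<noteq> 0" "b \<noteq> 0" "b \<in> F" "e - b \<in> F" using B b e_F diff_F by auto
    have "inj_on ?f ?P"
    proof (rule inj_onI, clarify)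
      fix v w v' w' assume *: "v \<in> V" "w \<in> V" "v' \<in> V" "w' \<in> V"
        "(e - b) * v = (e - b) * v'" "b * w = b * w'"
      then show "v = v' \<and> w = w'"
        using mult_cancel_F[of "e - b" v v'] mult_cancel_F[of b w w'] nz V by blast
    qed
    then have dense: "(1 / K) * n\<^sup>2 \<le> card (?f ` ?P)" using pop[OF b] by (simp add: card_image)
    have small: "card ((*) (e - b) ` V) \<le> n" "card ((*) b ` V) \<le> n"
      using card_image_le[OF finV, of "(*) (e - b)"] card_image_le[OF finV, of "(*) b"] V by linarith+
    have sub: "?f ` ?P \<subseteq> (*) (e - b) ` V \<times> (*) b ` V" by auto
    have sums: "x + y \<in> V" if "(x, y) \<in> ?f ` ?P" for x y using that by auto
    have K': "0 < 1 / K" using K by simp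
    obtain X' Y' where XY: "X' \<subseteq> (*) (e - b) ` V" "Y' \<subseteq> (*) b ` V"
      "1 / K * n / 6 \<le> card X'" "1 / K * n / 4 \<le> card Y'"
      "card (X' + Y') \<le> 3072 / (1 / K) ^ 5 * n"
      by (rule balog_szemeredi_gowers[OF finite_imageI[OF finV] finite_imageI[OF finV] finV
            sub sums small V(2) n K' dense])
    define X Y where "X = {v \<in> V. (e - b) * v \<in> X'}" and "Y = {w \<in> V. b * w \<in> Y'}"
    have img: "(*) (e - b) ` X = X'" "(*) b ` Y = Y'" using XY by (auto simp: X_def Y_def)
    have finXY: "finite X" "finite Y" using finV by (auto simp: X_def Y_def)
    have six: "n / K ^ 17 \<le> 1 / K * n / 6"
    proof -
      have "6 * K \<le> K ^ 3 * K" using numeral_le_power[OF K, of 6 3] K by (intro mult_right_mono) auto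
      also have "\<dots> = K ^ 4" by (simp add: numeral_eq_Suc)
      also have "\<dots> \<le> K ^ 17" using K by (intro power_increasing) auto
      finally have "n / K ^ 17 \<le> n / (6 * K)" using K n by (intro divide_left_mono) auto
      then show ?thesis by simp
    qed
    have "n / K ^ 17 \<le> card X"
      using six XY(3) card_image_le[OF finXY(1), of "(*) (e - b)"] unfolding img by linarith
    moreover have "1 / K * n / 6 \<le> 1 / K * n / 4"
      using K n by (intro divide_left_mono) auto
    then have "n / K ^ 17 \<le> card Y"
      using six XY(4) card_image_le[OF finXY(2), of "(*) b"] unfolding img by linarith
    moreover have "card ((*) (e - b) ` X + (*) b ` Y) \<le> K ^ 17 * n"
    proof -
      have "3072 / (1 / K) ^ 5 = 3072 * K ^ 5" by (simp add: power_divide)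
      also have "\<dots> \<le> K ^ 12 * K ^ 5" using numeral_le_power[OF K, of 3072 12] K by (intro mult_right_mono) auto
      also have "\<dots> = K ^ 17" by (simp flip: power_add)
      finally have "3072 / (1 / K) ^ 5 * n \<le> K ^ 17 * n" using n by (intro mult_right_mono) auto
      then show ?thesis using XY(5) unfolding img by linarith
    qed
    ultimately show ?thesis by (intro exI[of _ X] exI[of _ Y]) (auto simp: X_def Y_def)
  qed
  then obtain X Y where XY: "\<And>b. b \<in> B \<Longrightarrow> X b \<subseteq> V" "\<And>b. b \<in> B \<Longrightarrow> n / K ^ 17 \<le> card (X b)"
    "\<And>b. b \<in> B \<Longrightarrow> Y b \<subseteq> V" "\<And>b. b \<in> B \<Longrightarrow> n / K ^ 17 \<le> card (Y b)"
    "\<And>b. b \<in> B \<Longrightarrow> card ((*) (e - b) ` X b + (*) b ` Y b) \<le> K ^ 17 * n"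
    by metis
  have "n / K ^ 17 \<le> n / K" using K17 K n by (intro divide_left_mono) auto
  then have cB: "n / K ^ 17 \<le> card B" using B(4) by linarith
  have "n \<le> (K ^ 17) ^ 2350 \<or> card F \<le> (K ^ 17) ^ 2350 * n"
    by (rule structured_family_bound[OF K17(2) n V B(1-3) cB XY])
  then show ?thesis by (simp flip: power_mult)
qed

text \<open>
  The set \<open>M\<close> consists of the lines \<open>v = s u + t\<close>, encoded as \<open>(s, t)\<close>.  Convexity gives at least a
  power of \<open>1/K\<close> times \<open>n\<^sup>5\<close> triples of columns in which one line hits \<open>V\<close>, counted with that
  line, so some pair \<open>u0, u1\<close> of columns is completed by almost \<open>n\<^sup>3\<close> pairs of a line and a third column.  Write the third column as
  \<open>u = u0 + b (u1 - u0)\<close>: the height of the line at \<open>u\<close> is the convex combination with weight \<open>b\<close> of its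
  heights at \<open>u0\<close> and \<open>u1\<close>, and the line is determined by these heights.  The loss is \<open>K\<^sup>9\<close>, and
  \<open>9 \<sqdot> 39950 = 359550\<close>.
\<close>

lemma grid_incidence_bound:
  fixes K n :: real
  assumes K: "K \<ge> 2" and n: "n > 0"
    and U: "U \<subseteq> F" "card U \<le> n" and V: "V \<subseteq> F" "card V \<le> n"
    and M: "M \<subseteq> F \<times> F" "card M \<le> n\<^sup>2"
    and rich: "n ^ 3 / K \<le> (\<Sum>m\<in>M. real (card {u \<in> U. fst m * u + snd m \<in> V}))"
  shows "n \<le> K ^ 359550 \<or> card F \<le> K ^ 359550 * n"
proof (cases "n \<le> 8 * K")
  case True
  also have "8 * K \<le> K ^ 3 * K" using numeral_le_power[OF K, of 8 3] K by (intro mult_right_mono) auto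
  also have "\<dots> = K ^ 4" by (simp add: numeral_eq_Suc)
  also have "\<dots> \<le> K ^ 359550" using K by (intro power_increasing) auto
  finally show ?thesis ..
next
  case nbig: False
  have finU: "finite U" and finV: "finite V" and finM: "finite M"
    using finite_subset[OF _ finite_F] U V finite_subset[OF M(1)] finite_F by auto
  define hit where "hit m u \<longleftrightarrow> fst m * u + snd m \<in> V" for m u
  define H where "H m = {u \<in> U. hit m u}" for m
  define r where "r m = real (card (H m))" for m
  have finH: "finite (H m)" for m using finU by (auto simp: H_def)
  define M1 where "M1 = {m \<in> M. n / (2 * K) \<le> r m}"
  have "n ^ 3 / K - n\<^sup>2 * (n / (2 * K)) \<le> sum r M1"
    unfolding M1_def
    by (rule sum_popular_ge[OF finM M(2)]) (use rich n K in \<open>auto simp: r_def H_def hit_def\<close>)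
  then have M1: "n ^ 3 / (2 * K) \<le> sum r M1"
    using K by (simp add: field_simps power2_eq_square power3_eq_cube)
  have finM1: "finite M1" "M1 \<subseteq> M" using finM by (auto simp: M1_def)
  \<comment> \<open>Convexity enters through \<open>|T m| = r (r - 1) (r - 2)\<close>.\<close>
  define T where "T m = {(x, y, z). x \<in> H m \<and> y \<in> H m \<and> z \<in> H m \<and> x \<noteq> y \<and> z \<noteq> x \<and> z \<noteq> y}" for m
  have finT: "finite (T m)" for m
    by (rule finite_subset[of _ "H m \<times> H m \<times> H m"]) (auto simp: T_def finH)
  have T_large: "r m * (n\<^sup>2 / (16 * K\<^sup>2)) \<le> card (T m)" if m: "m \<in> M1" for m
  proof -
    have rm: "n / (2 * K) \<le> r m" using m by (simp add: M1_def)
    have "4 \<le> n / (2 * K)" using nbig K by (simp add: field_simps)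
    then have r4: "4 \<le> r m" using rm by linarith
    have "(n / (4 * K)) * (n / (4 * K)) \<le> (r m - 1) * (r m - 2)"
      using rm r4 n K by (intro mult_mono) auto
    then have "r m * (n\<^sup>2 / (16 * K\<^sup>2)) \<le> r m * ((r m - 1) * (r m - 2))"
      using r4 by (intro mult_left_mono) (auto simp: power2_eq_square)
    also have "\<dots> = card (T m)"
      unfolding T_def card_distinct_triples[OF finH] using r4 by (simp add: r_def of_nat_diff)
    finally show ?thesis .
  qed
  define pairs where "pairs = {(x, y). x \<in> U \<and> y \<in> U \<and> x \<noteq> y}"
  have pairs_sub: "pairs \<subseteq> U \<times> U" by (auto simp: pairs_def)
  have finP: "finite pairs" using finU pairs_sub finite_subset by blast
  have cP: "card pairs \<le> n\<^sup>2"
  proof -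
    have "card pairs \<le> card (U \<times> U)" using finU pairs_sub by (intro card_mono) auto
    also have "real (card (U \<times> U)) \<le> n\<^sup>2"
      using U n mult_mono[of "real (card U)" n "real (card U)" n]
      by (simp add: card_cartesian_product power2_eq_square)
    finally show ?thesis by simp
  qed
  define Q where "Q q = {(m, u). m \<in> M \<and> u \<in> U \<and> fst q \<in> H m \<and> snd q \<in> H m \<and> u \<in> H m
      \<and> u \<noteq> fst q \<and> u \<noteq> snd q}" for q
  have finQ: "finite (Q q)" for q
    by (rule finite_subset[of _ "M \<times> U"]) (auto simp: Q_def finM finU)
  have "n\<^sup>2 * (n ^ 3 / (32 * K ^ 3)) = n ^ 3 / (2 * K) * (n\<^sup>2 / (16 * K\<^sup>2))"
    by (simp add: power2_eq_square power3_eq_cube)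
  also have "\<dots> \<le> sum r M1 * (n\<^sup>2 / (16 * K\<^sup>2))" using M1 by (intro mult_right_mono) auto
  also have "\<dots> = (\<Sum>m\<in>M1. r m * (n\<^sup>2 / (16 * K\<^sup>2)))" by (rule sum_distrib_right)
  also have "\<dots> \<le> (\<Sum>m\<in>M1. real (card (T m)))" by (intro sum_mono T_large)
  also have "\<dots> \<le> (\<Sum>m\<in>M. real (card (T m)))" using finM finM1 by (intro sum_mono2) auto
  also have "\<dots> = card (SIGMA m:M. T m)" using finM finT by (simp add: card_SigmaI)
  also have "\<dots> \<le> card (SIGMA q:pairs. Q q)"
  proof -
    let ?f = "\<lambda>(m, (x, (y, z))). ((x, y), (m, z))"
    have "inj_on ?f (SIGMA m:M. T m)" by (auto simp: inj_on_def)
    moreover have "?f ` (SIGMA m:M. T m) \<subseteq> (SIGMA q:pairs. Q q)"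
      by (auto simp: T_def pairs_def Q_def H_def)
    ultimately show ?thesis using finP finQ by (intro of_nat_mono card_inj_on_le[of ?f]) auto
  qed
  also have "\<dots> = (\<Sum>q\<in>pairs. real (card (Q q)))" using finP finQ by (simp add: card_SigmaI)
  finally have sumQ: "n\<^sup>2 * (n ^ 3 / (32 * K ^ 3)) \<le> (\<Sum>q\<in>pairs. real (card (Q q)))" .
  have pos: "0 < n\<^sup>2" "0 < n ^ 3 / (32 * K ^ 3)" using n K by auto
  obtain q where q: "q \<in> pairs" "n ^ 3 / (32 * K ^ 3) \<le> card (Q q)"
    using exists_ge_average[OF finP cP pos sumQ] by blast
  define u0 u1 where "u0 = fst q" and "u1 = snd q"
  have u01: "u0 \<in> U" "u1 \<in> U" "u0 \<noteq> u1" using q by (auto simp: pairs_def u0_def u1_def)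
  have uF: "u \<in> F" if "u \<in> U" for u using that U by auto
  have K8: "n ^ 3 / K ^ 8 \<le> card (Q q)"
  proof -
    have "32 * K ^ 3 \<le> K ^ 5 * K ^ 3" using numeral_le_power[OF K, of 32 5] K by (intro mult_right_mono) auto
    also have "\<dots> = K ^ 8" by (simp flip: power_add)
    finally have "n ^ 3 / K ^ 8 \<le> n ^ 3 / (32 * K ^ 3)" using K n by (intro divide_left_mono) auto
    then show ?thesis using q(2) by linarith
  qed
  define w where "w = rec (u1 - u0)"
  have d: "u1 - u0 \<in> F" "u1 - u0 \<noteq> 0" using u01 uF diff_F by auto
  have w: "w \<in> F" "w * (u1 - u0) = e" using d rec_F rec_mult by (auto simp: w_def)
  define b where "b u = (u - u0) * w" for u
  have bF: "b u \<in> F" if "u \<in> U" for u using that uF u01 w diff_F mult_F by (auto simp: b_def)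
  have bd: "b u * (u1 - u0) = u - u0" if "u \<in> U" for u
  proof -
    have "b u * (u1 - u0) = (u - u0) * (w * (u1 - u0))" by (simp add: b_def mult.assoc)
    also have "\<dots> = e * (u - u0)" using w by (simp add: mult.commute)
    also have "\<dots> = u - u0" using that uF u01 diff_F by (intro e_mult) auto
    finally show ?thesis .
  qed
  define B0 where "B0 = b ` (U - {u0, u1})"
  define P where "P t = {(x, y). x \<in> V \<and> y \<in> V \<and> (e - t) * x + t * y \<in> V}" for t
  have finP': "finite (P t)" for t
    by (rule finite_subset[of _ "V \<times> V"]) (auto simp: P_def finV)
  have cP': "card (P t) \<le> n\<^sup>2" for t
  proof -
    have "card (P t) \<le> card (V \<times> V)" using finV by (intro card_mono) (auto simp: P_def)
    also have "real (card (V \<times> V)) \<le> n\<^sup>2"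
      using V n mult_mono[of "real (card V)" n "real (card V)" n]
      by (simp add: card_cartesian_product power2_eq_square)
    finally show ?thesis by simp
  qed
  have B0: "B0 \<subseteq> F" using bF by (auto simp: B0_def)
  have finB0: "finite B0" using finU by (simp add: B0_def)
  have "0 \<notin> B0"
  proof
    assume "0 \<in> B0"
    then obtain u where "u \<in> U" "u \<noteq> u0" "0 = b u" unfolding B0_def by blast
    then show False using bd[of u] by (simp flip: \<open>0 = b u\<close>)
  qed
  have "e \<notin> B0"
  proof
    assume "e \<in> B0"
    then obtain u where "u \<in> U" "u \<noteq> u1" "e = b u" unfolding B0_def by blast
    then show False using bd[of u] e_mult[OF d(1)] by (simp flip: \<open>e = b u\<close>)
  qed
  have cB0: "card B0 \<le> n"
  proof -
    have "card B0 \<le> card U" unfolding B0_def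
      using finU by (meson Diff_subset card_image_le card_mono finite_Diff order_trans)
    then show ?thesis using U by linarith
  qed
  have inj: "inj_on (\<lambda>(m, u). (b u, fst m * u0 + snd m, fst m * u1 + snd m)) (Q q)"
  proof (rule inj_onI)
    fix x y assume "x \<in> Q q" "y \<in> Q q"
      and eq: "(\<lambda>(m, u). (b u, fst m * u0 + snd m, fst m * u1 + snd m)) x
        = (\<lambda>(m, u). (b u, fst m * u0 + snd m, fst m * u1 + snd m)) y"
    moreover obtain s t u s' t' u' where x: "x = ((s, t), u)" and y: "y = ((s', t'), u')"
      by (metis surj_pair)
    ultimately have *: "((s, t), u) \<in> Q q" "((s', t'), u') \<in> Q q" "b u = b u'"
      "s * u0 + t = s' * u0 + t'" "s * u1 + t = s' * u1 + t'" by auto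
    have uU: "u \<in> U" "u' \<in> U" using *(1,2) by (auto simp: Q_def)
    have "u - u0 = u' - u0" using bd[OF uU(1)] bd[OF uU(2)] unfolding *(3) by (rule trans[OF sym])
    then have "u = u'" by simp
    have "(u1 - u0) * s = (s * u1 + t) - (s * u0 + t)" by (simp add: algebra_simps)
    also have "\<dots> = (s' * u1 + t') - (s' * u0 + t')" using *(4,5) by simp
    also have "\<dots> = (u1 - u0) * s'" by (simp add: algebra_simps)
    finally have "(u1 - u0) * s = (u1 - u0) * s'" .
    moreover have "s \<in> F" "s' \<in> F" using *(1,2) M by (auto simp: Q_def)
    ultimately have "s = s'" using mult_cancel_F[OF d(1) _ _ d(2)] by blast
    then show "x = y" unfolding x y using *(4) \<open>u = u'\<close> by simp
  qed
  have "card (Q q) \<le> card (SIGMA t:B0. P t)"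
  proof (rule card_inj_on_le[OF inj])
    show "(\<lambda>(m, u). (b u, fst m * u0 + snd m, fst m * u1 + snd m)) ` Q q \<subseteq> (SIGMA t:B0. P t)"
    proof (rule image_subsetI)
      fix x assume "x \<in> Q q"
      then obtain s t u where x: "x = ((s, t), u)" and *: "((s, t), u) \<in> Q q" by (metis surj_pair)
      then have u: "u \<in> U" "u \<noteq> u0" "u \<noteq> u1" by (auto simp: Q_def u0_def u1_def)
      then have bu: "b u \<in> B0" by (auto simp: B0_def)
      have st: "s \<in> F" "t \<in> F" using * M by (auto simp: Q_def)
      have hits: "s * u0 + t \<in> V" "s * u1 + t \<in> V" "s * u + t \<in> V"
        using * by (auto simp: Q_def H_def hit_def u0_def u1_def)
      have "(e - b u) * (s * u0 + t) + b u * (s * u1 + t)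
          = e * (s * u0 + t) + s * (b u * (u1 - u0))" by (simp add: algebra_simps)
      also have "\<dots> = (s * u0 + t) + s * (u - u0)"
        using bd[OF u(1)] e_mult hits V by auto
      also have "\<dots> = s * u + t" by (simp add: algebra_simps)
      finally show "(\<lambda>(m, u). (b u, fst m * u0 + snd m, fst m * u1 + snd m)) x \<in> (SIGMA t:B0. P t)"
        using hits bu by (simp add: P_def x)
    qed
  qed (use finB0 finP' in auto)
  also have "real (card (SIGMA t:B0. P t)) = (\<Sum>t\<in>B0. real (card (P t)))"
    using finB0 finP' by (simp add: card_SigmaI)
  finally have "n ^ 3 / K ^ 8 \<le> (\<Sum>t\<in>B0. real (card (P t)))" using K8 by linarith
  then have "n ^ 3 / K ^ 8 - n * (n\<^sup>2 / K ^ 9)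
      \<le> (\<Sum>t\<in>{t \<in> B0. n\<^sup>2 / K ^ 9 \<le> real (card (P t))}. real (card (P t)))"
    using K n by (intro sum_popular_ge[OF finB0 cB0]) auto
  moreover define B where "B = {t \<in> B0. n\<^sup>2 / K ^ 9 \<le> real (card (P t))}"
  ultimately have "n ^ 3 / K ^ 8 - n * (n\<^sup>2 / K ^ 9) \<le> (\<Sum>t\<in>B. real (card (P t)))" by simp
  also have "\<dots> \<le> (\<Sum>t\<in>B. n\<^sup>2)" by (intro sum_mono cP')
  also have "\<dots> = n\<^sup>2 * card B" by simp
  finally have up: "n ^ 3 / K ^ 8 - n * (n\<^sup>2 / K ^ 9) \<le> n\<^sup>2 * card B" .
  have "n\<^sup>2 * (n / K ^ 9) = n ^ 3 / K ^ 9" by (simp add: power2_eq_square power3_eq_cube)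
  also have "\<dots> = 2 * (n ^ 3 / K ^ 9) - n ^ 3 / K ^ 9" by simp
  also have "\<dots> \<le> K * (n ^ 3 / K ^ 9) - n ^ 3 / K ^ 9"
    using K n by (intro diff_mono mult_right_mono) auto
  also have "K * (n ^ 3 / K ^ 9) = n ^ 3 / K ^ 8" using K by (simp add: numeral_eq_Suc)
  also have "n ^ 3 / K ^ 8 - n ^ 3 / K ^ 9 = n ^ 3 / K ^ 8 - n * (n\<^sup>2 / K ^ 9)"
    by (simp add: power2_eq_square power3_eq_cube)
  finally have "n\<^sup>2 * (n / K ^ 9) \<le> n\<^sup>2 * card B" using up by linarith
  then have cB: "n / K ^ 9 \<le> card B" using pos(1) by (simp only: mult_le_cancel_left_pos)
  have K9: "2 \<le> K ^ 9" using numeral_le_power[OF K, of 2 1] power_increasing[of 1 9 K] K by simp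
  have "n \<le> (K ^ 9) ^ 39950 \<or> card F \<le> (K ^ 9) ^ 39950 * n"
  proof (rule popular_dilates_bound[OF K9 n V _ _ _ cB])
    show "n\<^sup>2 / K ^ 9 \<le> card {(v, w). v \<in> V \<and> w \<in> V \<and> (e - t) * v + t * w \<in> V}" if "t \<in> B" for t
      using that by (simp add: B_def P_def)
  qed (use B0 \<open>0 \<notin> B0\<close> \<open>e \<notin> B0\<close> in \<open>auto simp: B_def\<close>)
  then show ?thesis by (simp flip: power_mult)
qed

end

section \<open>The residue fields inside one ring\<close>

text \<open>
  The product over all \<open>n\<close> of the rings of residues mod \<open>n\<close>.  It contains the field with \<open>p\<close> elements,
  for every prime \<open>p\<close> at once, as the ideal of families supported at \<open>p\<close>.  The factor at \<open>n = 0\<close> is the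
  ring of integers, since \<open>x mod 0 = x\<close>.
\<close>

typedef residue_family = "{f :: nat \<Rightarrow> int. \<forall>n. f n mod int n = f n}"
  morphisms residue_at Residue_family
  by (intro exI[of _ "\<lambda>_. 0"]) simp

setup_lifting type_definition_residue_family

instantiation residue_family :: comm_ring_1
begin

lift_definition zero_residue_family :: residue_family is "\<lambda>_. 0" by simp
lift_definition one_residue_family :: residue_family is "\<lambda>n. 1 mod int n" by simp
lift_definition plus_residue_family :: "residue_family \<Rightarrow> residue_family \<Rightarrow> residue_family"
  is "\<lambda>f g n. (f n + g n) mod int n" by simp
lift_definition uminus_residue_family :: "residue_family \<Rightarrow> residue_family"
  is "\<lambda>f n. (- f n) mod int n" by simp
lift_definition minus_residue_family :: "residue_family \<Rightarrow> residue_family \<Rightarrow> residue_family"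
  is "\<lambda>f g n. (f n - g n) mod int n" by simp
lift_definition times_residue_family :: "residue_family \<Rightarrow> residue_family \<Rightarrow> residue_family"
  is "\<lambda>f g n. (f n * g n) mod int n" by simp

instance
proof
  fix a b c :: residue_family
  show "a + b + c = a + (b + c)" by transfer (simp add: mod_simps add.assoc)
  show "a + b = b + a" by transfer (simp add: add.commute)
  show "0 + a = a" by transfer simp
  show "- a + a = 0" by transfer (simp add: mod_simps)
  show "a - b = a + - b" by transfer (simp add: mod_simps)
  show "a * b * c = a * (b * c)" by transfer (simp add: mod_simps mult.assoc)
  show "a * b = b * a" by transfer (simp add: mult.commute)
  show "1 * a = a" by transfer (simp add: mod_simps)
  show "(a + b) * c = a * c + b * c" by transfer (simp add: mod_simps distrib_right)
  show "(0 :: residue_family) \<noteq> 1" by transfer (auto simp: fun_eq_iff intro!: exI[of _ 2])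
qed

end

lift_definition residue_class :: "nat \<Rightarrow> int \<Rightarrow> residue_family"
  is "\<lambda>p x n. if n = p then x mod int p else 0" by simp

lemma residue_class_add: "residue_class p (x + y) = residue_class p x + residue_class p y"
  by transfer (auto simp: mod_simps)

lemma residue_class_mult: "residue_class p (x * y) = residue_class p x * residue_class p y"
  by transfer (auto simp: mod_simps)

lemma residue_class_uminus: "residue_class p (- x) = - residue_class p x"
  by transfer (auto simp: mod_simps)

lemma residue_class_diff: "residue_class p (x - y) = residue_class p x - residue_class p y"
  by transfer (auto simp: mod_simps)

lemma residue_class_eq_iff: "residue_class p x = residue_class p y \<longleftrightarrow> [x = y] (mod int p)"
  by transfer (auto simp: fun_eq_iff cong_def)

lemma residue_class_0: "residue_class p 0 = 0"
  by transfer auto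

lemma residue_class_eq_0_iff: "residue_class p x = 0 \<longleftrightarrow> int p dvd x"
  unfolding residue_class_0[of p, symmetric] residue_class_eq_iff by (simp add: cong_0_iff)

lemma range_residue_class: "p > 0 \<Longrightarrow> range (residue_class p) = residue_class p ` {0..<int p}"
proof (intro subset_antisym subsetI)
  fix y assume p: "p > 0" and "y \<in> range (residue_class p)"
  then obtain x where "y = residue_class p x" by auto
  also have "\<dots> = residue_class p (x mod int p)" by (simp add: residue_class_eq_iff cong_def)
  finally show "y \<in> residue_class p ` {0..<int p}" using p by auto
qed auto

lemma card_range_residue_class: "p > 0 \<Longrightarrow> card (range (residue_class p)) = p"
  unfolding range_residue_class
  by (subst card_image) (auto simp: inj_on_def residue_class_eq_iff cong_def)

definition residue_inverse :: "nat \<Rightarrow> residue_family \<Rightarrow> residue_family" where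
  "residue_inverse p x = (SOME y. y \<in> range (residue_class p) \<and> y * x = residue_class p 1)"

lemma prime_subfield_residue_class:
  assumes "prime p"
  shows "prime_subfield (range (residue_class p)) (residue_class p 1) (residue_inverse p)"
proof
  have p: "p > 0" using assms prime_gt_0_nat by auto
  show "finite (range (residue_class p))" using range_residue_class[OF p] by simp
  show "0 \<in> range (residue_class p)" using residue_class_0[of p] by (metis rangeI)
  show "residue_class p 1 \<noteq> 0" using prime_gt_1_nat[OF assms] by (simp add: residue_class_eq_0_iff)
  show "x + y \<in> range (residue_class p)" if "x \<in> range (residue_class p)" "y \<in> range (residue_class p)" for x y
    using that by (auto simp flip: residue_class_add)
  show "x * y \<in> range (residue_class p)" if "x \<in> range (residue_class p)" "y \<in> range (residue_class p)" for x y
    using that by (auto simp flip: residue_class_mult)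
  show "- x \<in> range (residue_class p)" if "x \<in> range (residue_class p)" for x
    using that by (auto simp flip: residue_class_uminus)
  show "residue_class p 1 * x = x" if "x \<in> range (residue_class p)" for x
    using that by (auto simp flip: residue_class_mult)
  have "\<exists>y. y \<in> range (residue_class p) \<and> y * x = residue_class p 1"
    if x: "x \<in> range (residue_class p)" "x \<noteq> 0" for x
  proof -
    obtain z where z: "x = residue_class p z" using x by auto
    have "\<not> int p dvd z" using x by (simp add: z residue_class_eq_0_iff)
    then have "coprime (int p) z" using prime_imp_coprime[of "int p" z] assms by simp
    then obtain w where "[z * w = 1] (mod int p)"
      using cong_solve_coprime_int[of z "int p"] by (auto simp: coprime_commute)
    then show ?thesis
      by (intro exI[of _ "residue_class p w"])
        (auto simp: z residue_class_eq_iff mult.commute simp flip: residue_class_mult)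
  qed
  then have *: "residue_inverse p x \<in> range (residue_class p) \<and> residue_inverse p x * x = residue_class p 1"
    if "x \<in> range (residue_class p)" "x \<noteq> 0" for x
    unfolding residue_inverse_def by (rule someI_ex) (use that in auto)
  show "residue_inverse p x \<in> range (residue_class p)" "residue_inverse p x * x = residue_class p 1"
    if "x \<in> range (residue_class p)" "x \<noteq> 0" for x
    using *[OF that] by auto
  fix R assume R: "R \<subseteq> range (residue_class p)" "0 \<in> R" "\<And>x. x \<in> R \<Longrightarrow> x + residue_class p 1 \<in> R"
  have nat_R: "residue_class p (int n) \<in> R" for n
  proof (induction n)
    case (Suc n)
    have "residue_class p (int (Suc n)) = residue_class p (int n) + residue_class p 1"
      by (simp add: add.commute flip: residue_class_add)
    then show ?case using R(3) Suc by simp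
  qed (use R in \<open>simp add: residue_class_0\<close>)
  have "residue_class p x \<in> R" if "0 \<le> x" for x using nat_R[of "nat x"] that by simp
  then have "residue_class p ` {0..<int p} \<subseteq> R" by auto
  then show "R = range (residue_class p)" using R(1) range_residue_class[OF p] by blast
qed auto

section \<open>Two rich pencils\<close>

text \<open>
  Two points share at most one line, so Cauchy-Schwarz gives \<open>I\<^sup>2 \<le> |L| (I + |P|\<^sup>2)\<close> for the number \<open>I\<close>
  of incidences; if each of the points has degree at least \<open>2n\<close>, then \<open>|P| \<le> I/(2n)\<close>, and the term
  \<open>|L| I\<close> must dominate.
\<close>

lemma high_degree_incidences:
  fixes n :: real and I :: "'a \<Rightarrow> 'b \<Rightarrow> bool"
  assumes fin: "finite P" "finite L" and n: "n > 0" and L: "card L \<le> n\<^sup>2"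
    and unique: "\<And>q q' l l'. q \<in> P \<Longrightarrow> q' \<in> P \<Longrightarrow> q \<noteq> q' \<Longrightarrow> l \<in> L \<Longrightarrow> l' \<in> L \<Longrightarrow>
      I q l \<Longrightarrow> I q l' \<Longrightarrow> I q' l \<Longrightarrow> I q' l' \<Longrightarrow> l = l'"
    and high: "\<And>q. q \<in> P \<Longrightarrow> 2 * n \<le> card {l \<in> L. I q l}"
  shows "(\<Sum>q\<in>P. real (card {l \<in> L. I q l})) \<le> 2 * n\<^sup>2"
proof -
  define S where "S = (\<Sum>q\<in>P. real (card {l \<in> L. I q l}))"
  let ?M = "real (card P)"
  define r where "r l = real (card {q \<in> P. I q l})" for l
  have S_r: "S = (\<Sum>l\<in>L. r l)" unfolding S_def r_def using fin by (rule double_counting)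
  have S0: "S \<ge> 0" by (simp add: S_def sum_nonneg)
  have "(\<Sum>l\<in>L. (r l)\<^sup>2) = (\<Sum>l\<in>L. real (card {z \<in> P \<times> P. I (fst z) l \<and> I (snd z) l}))"
  proof (intro sum.cong refl)
    fix l
    have "{z \<in> P \<times> P. I (fst z) l \<and> I (snd z) l} = {q \<in> P. I q l} \<times> {q \<in> P. I q l}" by auto
    then show "(r l)\<^sup>2 = real (card {z \<in> P \<times> P. I (fst z) l \<and> I (snd z) l})"
      by (simp add: r_def card_cartesian_product power2_eq_square)
  qed
  also have "\<dots> = (\<Sum>z\<in>P \<times> P. real (card {l \<in> L. I (fst z) l \<and> I (snd z) l}))"
    using fin by (intro double_counting[symmetric]) auto
  also have "\<dots> = (\<Sum>q\<in>P. \<Sum>q'\<in>P. real (card {l \<in> L. I q l \<and> I q' l}))"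
    by (simp add: sum.cartesian_product case_prod_unfold)
  also have "\<dots> \<le> (\<Sum>q\<in>P. \<Sum>q'\<in>P. (if q = q' then real (card {l \<in> L. I q l}) else 0) + 1)"
  proof (intro sum_mono)
    fix q q' assume q: "q \<in> P" "q' \<in> P"
    show "real (card {l \<in> L. I q l \<and> I q' l}) \<le> (if q = q' then real (card {l \<in> L. I q l}) else 0) + 1"
    proof (cases "q = q'")
      case False
      then have "card {l \<in> L. I q l \<and> I q' l} \<le> Suc 0"
        using q fin unique[of q q'] by (subst card_le_Suc0_iff_eq) auto
      then show ?thesis using False by simp
    qed simp
  qed
  also have "\<dots> = S + ?M\<^sup>2"
    using fin by (simp add: sum.distrib S_def power2_eq_square)
  finally have r2: "(\<Sum>l\<in>L. (r l)\<^sup>2) \<le> S + ?M\<^sup>2" .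
  have "S\<^sup>2 \<le> card L * (\<Sum>l\<in>L. (r l)\<^sup>2)" unfolding S_r using fin(2) by (rule sum_square_le)
  also have "\<dots> \<le> n\<^sup>2 * (S + ?M\<^sup>2)" using L r2 by (intro mult_mono sum_nonneg) auto
  finally have A: "S\<^sup>2 \<le> n\<^sup>2 * S + (n * ?M)\<^sup>2" by (simp add: distrib_left power_mult_distrib)
  have "?M * (2 * n) \<le> S"
    unfolding S_def using sum_mono[of P "\<lambda>_. 2 * n" "\<lambda>q. real (card {l \<in> L. I q l})"] high by simp
  then have "n * ?M \<le> S / 2" by (simp add: mult_ac)
  then have "(n * ?M)\<^sup>2 \<le> (S / 2)\<^sup>2" using n by (intro power_mono) auto
  then have "S\<^sup>2 \<le> n\<^sup>2 * S + S\<^sup>2 / 4" using A by (simp add: power_divide)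
  moreover have "0 \<le> n\<^sup>2 * S" using S0 by simp
  ultimately have "S\<^sup>2 \<le> 2 * (n\<^sup>2 * S)" by linarith
  then have "S * S \<le> S * (2 * n\<^sup>2)" by (simp add: power2_eq_square mult_ac)
  then have "S \<le> 2 * n\<^sup>2"
    using S0 by (cases "S = 0") (auto simp: mult_le_cancel_left_pos)
  then show ?thesis by (simp add: S_def)
qed

text \<open>
  Discard the points of degree above \<open>2n\<close>, then the poor lines, then the poor points.  At least
  \<open>n\<^sup>2/(16 K)\<close> points \<open>q\<close> remain, and each of them sees about \<open>n\<^sup>4\<close> pairs \<open>(q1, q2)\<close> along two different lines through
  \<open>q\<close>, up to powers of \<open>K\<close>.  There are at most \<open>n\<^sup>4\<close> pairs, so some pair is seen by many \<open>q\<close>.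
\<close>

lemma two_pencils:
  fixes n K :: real and I :: "'a \<Rightarrow> 'b \<Rightarrow> bool"
  assumes fin: "finite P" "finite L" and K: "K \<ge> 2" and n: "n \<ge> 16 * K"
    and P: "card P \<le> n\<^sup>2" and L: "card L \<le> n\<^sup>2"
    and unique: "\<And>q q' l l'. q \<in> P \<Longrightarrow> q' \<in> P \<Longrightarrow> q \<noteq> q' \<Longrightarrow> l \<in> L \<Longrightarrow> l' \<in> L \<Longrightarrow>
      I q l \<Longrightarrow> I q l' \<Longrightarrow> I q' l \<Longrightarrow> I q' l' \<Longrightarrow> l = l'"
    and rich: "n ^ 3 / K \<le> (\<Sum>q\<in>P. real (card {l \<in> L. I q l}))"
  obtains q1 q2 Q where "q1 \<in> P" "q2 \<in> P" "q1 \<noteq> q2" "Q \<subseteq> P" "n\<^sup>2 / K ^ 22 \<le> card Q"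
    "card {l \<in> L. I q1 l} \<le> 2 * n" "card {l \<in> L. I q2 l} \<le> 2 * n"
    "\<And>q. q \<in> Q \<Longrightarrow> n / (8 * K) \<le> card {l \<in> L. I q l} \<and> q \<noteq> q1 \<and> q \<noteq> q2 \<and>
      (\<exists>l1\<in>L. \<exists>l2\<in>L. l1 \<noteq> l2 \<and> I q l1 \<and> I q1 l1 \<and> I q l2 \<and> I q2 l2)"
proof -
  have n0: "n > 0" using n K by linarith
  define deg where "deg q = real (card {l \<in> L. I q l})" for q
  define P0 where "P0 = {q \<in> P. deg q \<le> 2 * n}"
  have P0: "P0 \<subseteq> P" "finite P0" using fin by (auto simp: P0_def)
  have "(\<Sum>q\<in>P - P0. deg q) \<le> 2 * n\<^sup>2"
    unfolding deg_def
  proof (rule high_degree_incidences[OF _ fin(2) n0 L])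
    show "2 * n \<le> card {l \<in> L. I q l}" if "q \<in> P - P0" for q using that by (auto simp: P0_def deg_def)
    show "l = l'" if "q \<in> P - P0" "q' \<in> P - P0" "q \<noteq> q'" "l \<in> L" "l' \<in> L" "I q l" "I q l'" "I q' l" "I q' l'"
      for q q' l l' using unique[of q q' l l'] that by blast
  qed (use fin in auto)
  moreover have "(\<Sum>q\<in>P. deg q) = (\<Sum>q\<in>P - P0. deg q) + (\<Sum>q\<in>P0. deg q)"
    using P0 fin by (intro sum.subset_diff) auto
  moreover have "2 * n\<^sup>2 \<le> n ^ 3 / (2 * K)"
  proof -
    have "n\<^sup>2 * (4 * K) \<le> n\<^sup>2 * n" using n K by (intro mult_left_mono) auto
    then show ?thesis using K by (simp add: field_simps power2_eq_square power3_eq_cube)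
  qed
  moreover have "n ^ 3 / K = n ^ 3 / (2 * K) + n ^ 3 / (2 * K)" using K by (simp add: field_simps)
  ultimately have rich0: "n ^ 3 / (2 * K) \<le> (\<Sum>q\<in>P0. deg q)"
    using rich unfolding deg_def by linarith
  define r where "r l = real (card {q \<in> P0. I q l})" for l
  define L0 where "L0 = {l \<in> L. n / (4 * K) \<le> r l}"
  have L0: "L0 \<subseteq> L" "finite L0" using fin by (auto simp: L0_def)
  have "(\<Sum>q\<in>P0. deg q) = (\<Sum>l\<in>L. r l)"
    unfolding deg_def r_def using P0 fin by (intro double_counting) auto
  then have "n ^ 3 / (2 * K) - n\<^sup>2 * (n / (4 * K)) \<le> (\<Sum>l\<in>L0. r l)"
    unfolding L0_def using rich0 n0 K by (intro sum_popular_ge fin L) auto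
  moreover have "(\<Sum>l\<in>L0. r l) = (\<Sum>q\<in>P0. real (card {l \<in> L0. I q l}))"
    unfolding r_def using P0 L0 by (intro double_counting[symmetric]) auto
  moreover define d where "d q = real (card {l \<in> L0. I q l})" for q
  ultimately have rich1: "n ^ 3 / (4 * K) \<le> (\<Sum>q\<in>P0. d q)"
    using K by (simp add: field_simps power2_eq_square power3_eq_cube)
  define P1 where "P1 = {q \<in> P0. n / (8 * K) \<le> d q}"
  have P1: "P1 \<subseteq> P0" "finite P1" using P0 by (auto simp: P1_def)
  have cP0: "card P0 \<le> n\<^sup>2" using card_mono[OF fin(1) P0(1)] P by linarith
  have "n ^ 3 / (4 * K) - n\<^sup>2 * (n / (8 * K)) \<le> (\<Sum>q\<in>P1. d q)"
    unfolding P1_def using rich1 n0 K by (intro sum_popular_ge P0 cP0) auto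
  also have "\<dots> \<le> (\<Sum>q\<in>P1. 2 * n)"
  proof (intro sum_mono)
    fix q assume "q \<in> P1"
    then have "deg q \<le> 2 * n" using P1 by (auto simp: P0_def)
    moreover have "card {l \<in> L0. I q l} \<le> card {l \<in> L. I q l}" using L0 fin by (intro card_mono) auto
    ultimately show "d q \<le> 2 * n" by (simp add: d_def deg_def)
  qed
  finally have "n * (n\<^sup>2 / (16 * K)) \<le> n * card P1"
    using K by (simp add: field_simps power2_eq_square power3_eq_cube)
  then have cP1: "n\<^sup>2 / (16 * K) \<le> card P1" using n0 by (simp only: mult_le_cancel_left_pos)
  define W where "W q z \<longleftrightarrow> q \<noteq> fst z \<and> q \<noteq> snd z \<and>
      (\<exists>l1\<in>L. \<exists>l2\<in>L. l1 \<noteq> l2 \<and> I q l1 \<and> I (fst z) l1 \<and> I q l2 \<and> I (snd z) l2)" for q z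
  have W_large: "n ^ 4 / (2 ^ 13 * K ^ 4) \<le> card {z \<in> P0 \<times> P0. W q z}" if q: "q \<in> P1" for q
  proof -
    define Lq where "Lq = {l \<in> L0. I q l}"
    define Pl where "Pl l = {x \<in> P0. I x l} - {q}" for l
    have finLq: "finite Lq" and finPl: "finite (Pl l)" for l
      using L0 P0 by (auto simp: Lq_def Pl_def)
    have qP0: "q \<in> P0" using q P1 by auto
    have dq: "n / (8 * K) \<le> card Lq" using q by (simp add: P1_def d_def Lq_def)
    have "2 \<le> n / (8 * K)" using n K by (simp add: field_simps)
    then have dq1: "n / (16 * K) \<le> real (card Lq) - 1" using dq by (simp add: field_simps)
    have Pl: "n / (8 * K) \<le> card (Pl l)" if "l \<in> Lq" for l
    proof -
      have "card (Pl l) = card {x \<in> P0. I x l} - 1"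
        using that qP0 by (simp add: Pl_def Lq_def)
      moreover have "n / (4 * K) \<le> card {x \<in> P0. I x l}" using that by (simp add: Lq_def L0_def r_def)
      moreover have "n / (4 * K) = n / (8 * K) + n / (8 * K)" using K by (simp add: field_simps)
      ultimately show ?thesis using \<open>2 \<le> n / (8 * K)\<close> by linarith
    qed
    let ?S = "SIGMA z:(SIGMA l:Lq. Lq - {l}). Pl (fst z) \<times> Pl (snd z)"
    have "n ^ 4 / (2 ^ 13 * K ^ 4) = n / (8 * K) * (n / (16 * K)) * (n / (8 * K) * (n / (8 * K)))"
      by (simp add: power4_eq_xxxx mult_ac)
    also have "\<dots> \<le> real (card Lq) * (real (card Lq) - 1) * (n / (8 * K) * (n / (8 * K)))"
      using dq dq1 n0 K by (intro mult_right_mono mult_mono) auto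
    also have "real (card Lq) * (real (card Lq) - 1) = card (SIGMA l:Lq. Lq - {l})"
    proof -
      have "card (SIGMA l:Lq. Lq - {l}) = (\<Sum>l\<in>Lq. card (Lq - {l}))"
        using finLq by (intro card_SigmaI) auto
      also have "\<dots> = (\<Sum>l\<in>Lq. card Lq - 1)"
        by (intro sum.cong refl) (rule card_Diff_singleton)
      finally have *: "card (SIGMA l:Lq. Lq - {l}) = card Lq * (card Lq - 1)" by simp
      have "1 \<le> card Lq" using dq \<open>2 \<le> n / (8 * K)\<close> by linarith
      then show ?thesis unfolding * of_nat_mult by (simp only: of_nat_diff of_nat_1)
    qed
    also have "\<dots> * (n / (8 * K) * (n / (8 * K))) = (\<Sum>z\<in>(SIGMA l:Lq. Lq - {l}). n / (8 * K) * (n / (8 * K)))"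
      by simp
    also have "\<dots> \<le> (\<Sum>z\<in>(SIGMA l:Lq. Lq - {l}). real (card (Pl (fst z) \<times> Pl (snd z))))"
      unfolding card_cartesian_product of_nat_mult using Pl n0 K by (intro sum_mono mult_mono) auto
    also have "\<dots> = card ?S" using finLq finPl by (subst card_SigmaI) auto
    also have "\<dots> \<le> card {z \<in> P0 \<times> P0. W q z}"
    proof -
      have "inj_on snd ?S"
      proof (rule inj_onI)
        fix s t assume st: "s \<in> ?S" "t \<in> ?S" "snd s = snd t"
        obtain l1 l2 x y where s: "s = ((l1, l2), (x, y))" by (metis surj_pair)
        obtain l1' l2' where t: "t = ((l1', l2'), (x, y))" using st(3) s by (metis prod.collapse snd_conv)
        have eq: "l = l'" if "l \<in> Lq" "l' \<in> Lq" "z \<in> Pl l" "z \<in> Pl l'" for l l' z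
          using unique[of q z l l'] that qP0 P0 L0 by (auto simp: Lq_def Pl_def)
        show "s = t" using eq[of l1 l1' x] eq[of l2 l2' y] st unfolding s t by simp
      qed
      moreover have "snd ` ?S \<subseteq> {z \<in> P0 \<times> P0. W q z}"
      proof (rule image_subsetI)
        fix s assume s_in: "s \<in> ?S"
        obtain l1 l2 x y where s: "s = ((l1, l2), (x, y))" by (metis surj_pair)
        have *: "l1 \<in> Lq" "l2 \<in> Lq" "l1 \<noteq> l2" "x \<in> Pl l1" "y \<in> Pl l2" using s_in by (auto simp: s)
        then have "l1 \<in> L" "l2 \<in> L" "I q l1" "I q l2" "I x l1" "I y l2" "q \<noteq> x" "q \<noteq> y" "x \<in> P0" "y \<in> P0"
          using L0 by (auto simp: Lq_def Pl_def)
        then show "snd s \<in> {z \<in> P0 \<times> P0. W q z}"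
          using *(3) unfolding W_def s by auto
      qed
      ultimately show ?thesis using P0 by (intro of_nat_mono card_inj_on_le[of snd]) auto
    qed
    finally show ?thesis .
  qed
  have "K ^ 5 = K * K ^ 4" by (simp add: numeral_eq_Suc)
  then have "n ^ 4 * (n\<^sup>2 / (2 ^ 17 * K ^ 5)) = n\<^sup>2 / (16 * K) * (n ^ 4 / (2 ^ 13 * K ^ 4))"
    by (simp add: mult_ac)
  also have "\<dots> \<le> card P1 * (n ^ 4 / (2 ^ 13 * K ^ 4))" using cP1 K by (intro mult_right_mono) auto
  also have "\<dots> = (\<Sum>q\<in>P1. n ^ 4 / (2 ^ 13 * K ^ 4))" by simp
  also have "\<dots> \<le> (\<Sum>q\<in>P1. real (card {z \<in> P0 \<times> P0. W q z}))" by (intro sum_mono W_large)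
  also have "\<dots> = (\<Sum>z\<in>P0 \<times> P0. real (card {q \<in> P1. W q z}))"
    using P0 P1 by (intro double_counting) auto
  finally have sum_ge: "n ^ 4 * (n\<^sup>2 / (2 ^ 17 * K ^ 5)) \<le> (\<Sum>z\<in>P0 \<times> P0. real (card {q \<in> P1. W q z}))" .
  have cPP: "card (P0 \<times> P0) \<le> n ^ 4"
    using mult_mono[OF cP0 cP0] n0 by (simp add: card_cartesian_product power4_eq_xxxx power2_eq_square mult_ac)
  have pos: "0 < n ^ 4" "0 < n\<^sup>2 / (2 ^ 17 * K ^ 5)" using n0 K by auto
  obtain z where z: "z \<in> P0 \<times> P0" "n\<^sup>2 / (2 ^ 17 * K ^ 5) \<le> card {q \<in> P1. W q z}"
    using exists_ge_average[OF finite_cartesian_product[OF P0(2) P0(2)] cPP pos sum_ge] by blast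
  define Q where "Q = {q \<in> P1. W q z}"
  have "n\<^sup>2 / K ^ 22 \<le> n\<^sup>2 / (2 ^ 17 * K ^ 5)"
  proof -
    have "2 ^ 17 * K ^ 5 \<le> K ^ 17 * K ^ 5" using K by (intro mult_right_mono power_mono) auto
    also have "\<dots> = K ^ 22" by (simp flip: power_add)
    finally show ?thesis using K n0 by (intro divide_left_mono) auto
  qed
  then have cQ: "n\<^sup>2 / K ^ 22 \<le> card Q" using z(2) by (simp add: Q_def)
  moreover have "0 < n\<^sup>2 / K ^ 22" using n0 K by simp
  ultimately have "Q \<noteq> {}" by auto
  then obtain q where q: "q \<in> P1" "W q z" by (auto simp: Q_def)
  have neq: "fst z \<noteq> snd z"
  proof
    assume eq: "fst z = snd z"
    then obtain l1 l2 where "l1 \<in> L" "l2 \<in> L" "l1 \<noteq> l2" "I q l1" "I (fst z) l1" "I q l2" "I (fst z) l2" "q \<noteq> fst z"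
      using q(2) by (auto simp: W_def)
    moreover have "q \<in> P" "fst z \<in> P" using q P1 P0 z by auto
    ultimately show False using unique[of q "fst z" l1 l2] by blast
  qed
  have zP: "fst z \<in> P0" "snd z \<in> P0" using z by auto
  show ?thesis
  proof (rule that[of "fst z" "snd z" Q])
    show "fst z \<in> P" "snd z \<in> P" "Q \<subseteq> P" using zP P0 P1 by (auto simp: Q_def)
    show "card {l \<in> L. I (fst z) l} \<le> 2 * n" "card {l \<in> L. I (snd z) l} \<le> 2 * n"
      using zP by (auto simp: P0_def deg_def)
    show "n / (8 * K) \<le> card {l \<in> L. I q l} \<and> q \<noteq> fst z \<and> q \<noteq> snd z \<and>
      (\<exists>l1\<in>L. \<exists>l2\<in>L. l1 \<noteq> l2 \<and> I q l1 \<and> I (fst z) l1 \<and> I q l2 \<and> I (snd z) l2)" if "q \<in> Q" for q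
    proof -
      have "d q \<le> deg q" unfolding d_def deg_def
        using L0 fin by (intro of_nat_mono card_mono) auto
      then show ?thesis using that by (auto simp: Q_def W_def P1_def deg_def)
    qed
  qed (use neq cQ in auto)
qed

section \<open>Lines that are independent modulo p\<close>

text \<open>
  Lines \<open>A x + B y + C = 0\<close> over the residues mod \<open>p\<^sup>k\<close>, given by integer coefficients, that are
  nondegenerate and pairwise distinct as lines mod \<open>p\<close>.
\<close>

locale separated_lines =
  fixes p k :: nat and L :: "'b set" and A B C :: "'b \<Rightarrow> int"
  assumes prime_p: "prime p" and k: "1 \<le> k" and finite_L: "finite L"
    and normal: "\<And>l. l \<in> L \<Longrightarrow> \<not> (int p dvd A l \<and> int p dvd B l)"
    and independent: "\<And>l l'. l \<in> L \<Longrightarrow> l' \<in> L \<Longrightarrow> l \<noteq> l' \<Longrightarrow>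
      \<not> (int p dvd A l * B l' - A l' * B l \<and> int p dvd A l * C l' - A l' * C l
        \<and> int p dvd B l * C l' - B l' * C l)"
begin

definition on_line :: "int \<times> int \<Rightarrow> 'b \<Rightarrow> bool" where
  "on_line q l \<longleftrightarrow> int p ^ k dvd A l * fst q + B l * snd q + C l"

text \<open>
  Two lines with proportional normals through a common point mod \<open>p\<close> would coincide mod \<open>p\<close>.
\<close>

lemma transverse_mod_p:
  assumes "l \<in> L" "l' \<in> L" "l \<noteq> l'"
    and "int p dvd A l * x + B l * y + C l" "int p dvd A l' * x + B l' * y + C l'"
  shows "\<not> int p dvd A l * B l' - A l' * B l"
proof
  assume det: "int p dvd A l * B l' - A l' * B l"
  have "A l * C l' - A l' * C l = A l * (A l' * x + B l' * y + C l') - A l' * (A l * x + B l * y + C l)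
      - (A l * B l' - A l' * B l) * y" by (simp add: algebra_simps)
  then have "int p dvd A l * C l' - A l' * C l" using assms(4,5) det by simp
  moreover have "B l * C l' - B l' * C l = B l * (A l' * x + B l' * y + C l') - B l' * (A l * x + B l * y + C l)
      + (A l * B l' - A l' * B l) * x" by (simp add: algebra_simps)
  then have "int p dvd B l * C l' - B l' * C l" using assms(4,5) det by simp
  ultimately show False using independent assms(1-3) det by blast
qed

lemma on_line_mod_p: "on_line q l \<Longrightarrow> int p dvd A l * fst q + B l * snd q + C l"
  using k unfolding on_line_def by (meson dvd_power dvd_trans less_le_trans zero_less_one)

lemma transverse:
  assumes "l \<in> L" "l' \<in> L" "l \<noteq> l'" "on_line q l" "on_line q l'"
  shows "\<not> int p dvd A l * B l' - A l' * B l"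
  using transverse_mod_p[OF assms(1-3)] on_line_mod_p assms by blast

text \<open>
  Cramer's rule, with a determinant that is invertible mod \<open>p\<^sup>j\<close>.
\<close>

lemma transverse_system:
  assumes det: "\<not> int p dvd A l * B l' - A l' * B l"
    and "int p ^ j dvd A l * x + B l * y" "int p ^ j dvd A l' * x + B l' * y"
  shows "int p ^ j dvd x" "int p ^ j dvd y"
proof -
  have "prime (int p)" using prime_p by simp
  then have cop: "coprime (int p ^ j) (A l * B l' - A l' * B l)"
    using det by (simp add: prime_imp_coprime)
  have "(A l * B l' - A l' * B l) * x = B l' * (A l * x + B l * y) - B l * (A l' * x + B l' * y)"
    by (simp add: algebra_simps)
  then have "int p ^ j dvd (A l * B l' - A l' * B l) * x" using assms by simp
  then show "int p ^ j dvd x" using cop by (simp add: coprime_dvd_mult_right_iff)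
  have "(A l * B l' - A l' * B l) * y = A l * (A l' * x + B l' * y) - A l' * (A l * x + B l * y)"
    by (simp add: algebra_simps)
  then have "int p ^ j dvd (A l * B l' - A l' * B l) * y" using assms by simp
  then show "int p ^ j dvd y" using cop by (simp add: coprime_dvd_mult_right_iff)
qed

lemma common_points_congruent:
  assumes "l \<in> L" "l' \<in> L" "l \<noteq> l'" "on_line q l" "on_line q l'" "on_line q' l" "on_line q' l'"
  shows "int p ^ k dvd fst q - fst q'" "int p ^ k dvd snd q - snd q'"
proof -
  have diff: "int p ^ k dvd A m * (fst q - fst q') + B m * (snd q - snd q')" if "on_line q m" "on_line q' m" for m
  proof -
    have "A m * (fst q - fst q') + B m * (snd q - snd q')
        = (A m * fst q + B m * snd q + C m) - (A m * fst q' + B m * snd q' + C m)"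
      by (simp add: algebra_simps)
    moreover have "int p ^ k dvd (A m * fst q + B m * snd q + C m) - (A m * fst q' + B m * snd q' + C m)"
      using that unfolding on_line_def by (rule dvd_diff)
    ultimately show ?thesis by simp
  qed
  note system = transverse_system[OF transverse[OF assms(1-5)] diff[OF assms(4,6)] diff[OF assms(5,7)]]
  show "int p ^ k dvd fst q - fst q'" "int p ^ k dvd snd q - snd q'" by (fact system)+
qed

sublocale Fp: prime_subfield "range (residue_class p)" "residue_class p 1" "residue_inverse p"
  by (rule prime_subfield_residue_class[OF prime_p])

end

text \<open>
  Pull the exact power \<open>p\<^sup>j\<close> out of \<open>(d1, d2)\<close> and complete the primitive rest \<open>(e1, e2)\<close>
  to a basis mod \<open>p\<close>.
\<close>

lemma exists_frame:
  fixes d1 d2 :: int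
  assumes p: "prime p" and d: "\<not> (int p ^ k dvd d1 \<and> int p ^ k dvd d2)"
  obtains j e1 e2 h1 h2 where "j < k" "d1 = int p ^ j * e1" "d2 = int p ^ j * e2"
    "\<not> (int p dvd e1 \<and> int p dvd e2)" "[h1 * e1 + h2 * e2 = 1] (mod int p)"
proof -
  define i where "i = (LEAST i. \<not> (int p ^ i dvd d1 \<and> int p ^ i dvd d2))"
  have i: "\<not> (int p ^ i dvd d1 \<and> int p ^ i dvd d2)" "i \<le> k"
    unfolding i_def using d by (rule LeastI, rule Least_le)
  have "i \<noteq> 0" using i(1) by (intro notI) simp
  then obtain j where j: "i = Suc j" by (cases i) auto
  have "int p ^ j dvd d1 \<and> int p ^ j dvd d2"
    using not_less_Least[of j "\<lambda>i. \<not> (int p ^ i dvd d1 \<and> int p ^ i dvd d2)"] j i_def by auto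
  then obtain e1 e2 where e: "d1 = int p ^ j * e1" "d2 = int p ^ j * e2" by (auto elim!: dvdE)
  have ne: "\<not> (int p dvd e1 \<and> int p dvd e2)"
  proof
    assume "int p dvd e1 \<and> int p dvd e2"
    then have "int p ^ i dvd d1 \<and> int p ^ i dvd d2" by (auto simp: j e mult.commute intro!: mult_dvd_mono)
    then show False using i by simp
  qed
  have inv: "\<exists>h. [h * x = 1] (mod int p)" if "\<not> int p dvd x" for x
  proof -
    have "coprime (int p) x" using prime_imp_coprime[of "int p" x] p that by simp
    then obtain h where "[x * h = 1] (mod int p)"
      using cong_solve_coprime_int[of x "int p"] by (auto simp: coprime_commute)
    then show ?thesis by (auto simp: mult.commute)
  qed
  have "\<exists>h1 h2. [h1 * e1 + h2 * e2 = 1] (mod int p)"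
  proof (cases "int p dvd e1")
    case False
    then obtain h where "[h * e1 + 0 * e2 = 1] (mod int p)" using inv[of e1] by auto
    then show ?thesis by blast
  next
    case True
    then obtain h where "[0 * e1 + h * e2 = 1] (mod int p)" using inv[of e2] ne by auto
    then show ?thesis by blast
  qed
  then show ?thesis using that[of j e1 e2] i(2) j e ne by auto
qed

text \<open>
  The situation around two points \<open>q1\<close> and \<open>q2 = q1 + p\<^sup>j e\<close>.  Points near \<open>q1\<close> are written as
  \<open>q1 + p\<^sup>j w\<close>, where \<open>w\<close> has the coordinates \<open>X = h1 w1 + h2 w2\<close> and \<open>Y = e1 w2 - e2 w1\<close> mod \<open>p\<close>; in
  them \<open>q1\<close> and \<open>q2\<close> become \<open>(0, 0)\<close> and \<open>(1, 0)\<close>.  A line that meets this neighbourhood becomes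
  \<open>\<alpha> X + \<beta> Y + \<gamma> = 0\<close>.  The projective map to \<open>u = X/Y\<close> and \<open>v = (X - 1)/Y\<close> sends the pencils of lines
  through the two points to columns and rows.
\<close>

locale pencil_frame = separated_lines +
  fixes q1 q2 :: "int \<times> int" and j :: nat and e1 e2 h1 h2 :: int
  assumes j: "j < k"
    and q2_q1: "fst q2 - fst q1 = int p ^ j * e1" "snd q2 - snd q1 = int p ^ j * e2"
    and e_nonzero: "\<not> (int p dvd e1 \<and> int p dvd e2)"
    and frame: "[h1 * e1 + h2 * e2 = 1] (mod int p)"
begin

abbreviation rc :: "int \<Rightarrow> residue_family" where "rc \<equiv> residue_class p"

definition \<alpha> :: "'a \<Rightarrow> int" where "\<alpha> l = A l * e1 + B l * e2"
definition \<beta> :: "'a \<Rightarrow> int" where "\<beta> l = B l * h1 - A l * h2"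
definition \<gamma> :: "'a \<Rightarrow> int" where "\<gamma> l = (A l * fst q1 + B l * snd q1 + C l) div int p ^ j"
definition near :: "'a \<Rightarrow> bool" where "near l \<longleftrightarrow> int p ^ j dvd A l * fst q1 + B l * snd q1 + C l"
text \<open>
  The value \<open>-\<beta>/\<alpha>\<close>: the column \<open>X = u Y\<close> for a line through \<open>q1\<close>, and the row \<open>X - 1 = v Y\<close> for a
  line through \<open>q2\<close>.
\<close>

definition slope :: "'a \<Rightarrow> residue_family" where
  "slope l = - (residue_inverse p (rc (\<alpha> l)) * rc (\<beta> l))"

lemma rc_eqI: "int p dvd x - y \<Longrightarrow> rc x = rc y"
  by (simp add: residue_class_eq_iff cong_iff_dvd_diff)

lemma frame_dvd: "int p dvd h1 * e1 + h2 * e2 - 1"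
  using frame by (simp add: cong_iff_dvd_diff)

lemma rc_frame: "rc (x * (h1 * e1 + h2 * e2)) = rc x"
proof (rule rc_eqI)
  have "x * (h1 * e1 + h2 * e2) - x = x * (h1 * e1 + h2 * e2 - 1)" by (simp add: algebra_simps)
  then show "int p dvd x * (h1 * e1 + h2 * e2) - x" using frame_dvd by simp
qed

lemma frame_coordinates:
  "rc (A l * w1 + B l * w2) = rc (\<alpha> l) * rc (h1 * w1 + h2 * w2) + rc (\<beta> l) * rc (e1 * w2 - e2 * w1)"
proof -
  have "(A l * w1 + B l * w2) * (h1 * e1 + h2 * e2)
      = \<alpha> l * (h1 * w1 + h2 * w2) + \<beta> l * (e1 * w2 - e2 * w1)"
    by (simp add: \<alpha>_def \<beta>_def algebra_simps)
  then show ?thesis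
    by (metis rc_frame residue_class_add residue_class_mult)
qed

lemma frame_determinant:
  "rc (\<alpha> l) * rc (\<beta> l') - rc (\<alpha> l') * rc (\<beta> l) = rc (A l * B l' - A l' * B l)"
proof -
  have "(A l * B l' - A l' * B l) * (h1 * e1 + h2 * e2) = \<alpha> l * \<beta> l' - \<alpha> l' * \<beta> l"
    by (simp add: \<alpha>_def \<beta>_def algebra_simps)
  then show ?thesis
    by (metis rc_frame residue_class_diff residue_class_mult)
qed

lemma near_\<gamma>: "near l \<Longrightarrow> A l * fst q1 + B l * snd q1 + C l = int p ^ j * \<gamma> l"
  by (simp add: near_def \<gamma>_def)

text \<open>
  Rescaling by \<open>p\<^sup>j\<close> does not identify lines.  From \<open>\<alpha>\<close> and \<open>\<beta>\<close> one recovers the normal \<open>(A, B)\<close> mod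
  \<open>p\<close>; and since \<open>A q1 + B q1 + C = p\<^sup>j \<gamma>\<close>, proportional \<open>\<gamma>\<close> together with proportional normals
  force the coefficients \<open>C\<close> to be proportional as well.
\<close>

lemma proportional_imp_eq:
  assumes l: "l \<in> L" "l' \<in> L" "near l" "near l'"
    and prp: "rc (\<alpha> l) * rc (\<beta> l') = rc (\<alpha> l') * rc (\<beta> l)"
      "rc (\<alpha> l) * rc (\<gamma> l') = rc (\<alpha> l') * rc (\<gamma> l)"
      "rc (\<beta> l) * rc (\<gamma> l') = rc (\<beta> l') * rc (\<gamma> l)"
  shows "l = l'"
proof (rule ccontr)
  assume ne: "l \<noteq> l'"
  have "rc (A l * B l' - A l' * B l) = 0" unfolding frame_determinant[symmetric] using prp by simp
  then have det: "int p dvd A l * B l' - A l' * B l" by (simp add: residue_class_eq_0_iff)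
  have coord: "rc (A m) = rc (\<alpha> m) * rc h1 - rc (\<beta> m) * rc e2"
      "rc (B m) = rc (\<alpha> m) * rc h2 + rc (\<beta> m) * rc e1" for m
    using frame_coordinates[of m 1 0] frame_coordinates[of m 0 1]
    by (simp_all add: residue_class_uminus)
  have "rc (A l) * rc (\<gamma> l') = rc h1 * (rc (\<alpha> l) * rc (\<gamma> l')) - rc e2 * (rc (\<beta> l) * rc (\<gamma> l'))"
    by (simp add: coord algebra_simps)
  also have "\<dots> = rc (A l') * rc (\<gamma> l)" unfolding prp by (simp add: coord algebra_simps)
  finally have "rc (A l * \<gamma> l') = rc (A l' * \<gamma> l)" by (simp add: residue_class_mult)
  then have "int p dvd A l * \<gamma> l' - A l' * \<gamma> l" by (simp add: residue_class_eq_iff cong_iff_dvd_diff)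
  then have "int p dvd int p ^ j * (A l * \<gamma> l' - A l' * \<gamma> l)" by (rule dvd_mult)
  also have "int p ^ j * (A l * \<gamma> l' - A l' * \<gamma> l) = A l * (A l' * fst q1 + B l' * snd q1 + C l')
      - A l' * (A l * fst q1 + B l * snd q1 + C l)"
    using near_\<gamma>[OF l(3)] near_\<gamma>[OF l(4)] by (simp add: algebra_simps)
  also have "\<dots> = (A l * B l' - A l' * B l) * snd q1 + (A l * C l' - A l' * C l)"
    by (simp add: algebra_simps)
  finally have AC: "int p dvd A l * C l' - A l' * C l" using det by (simp add: dvd_add_right_iff)
  have "rc (B l) * rc (\<gamma> l') = rc h2 * (rc (\<alpha> l) * rc (\<gamma> l')) + rc e1 * (rc (\<beta> l) * rc (\<gamma> l'))"
    by (simp add: coord algebra_simps)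
  also have "\<dots> = rc (B l') * rc (\<gamma> l)" unfolding prp by (simp add: coord algebra_simps)
  finally have "rc (B l * \<gamma> l') = rc (B l' * \<gamma> l)" by (simp add: residue_class_mult)
  then have "int p dvd B l * \<gamma> l' - B l' * \<gamma> l" by (simp add: residue_class_eq_iff cong_iff_dvd_diff)
  then have "int p dvd int p ^ j * (B l * \<gamma> l' - B l' * \<gamma> l)" by (rule dvd_mult)
  also have "int p ^ j * (B l * \<gamma> l' - B l' * \<gamma> l) = B l * (A l' * fst q1 + B l' * snd q1 + C l')
      - B l' * (A l * fst q1 + B l * snd q1 + C l)"
    using near_\<gamma>[OF l(3)] near_\<gamma>[OF l(4)] by (simp add: algebra_simps)
  also have "\<dots> = (B l * C l' - B l' * C l) - (A l * B l' - A l' * B l) * fst q1"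
    by (simp add: algebra_simps)
  finally have "int p dvd B l * C l' - B l' * C l" using det by (simp add: dvd_diff_left_iff)
  then show False using independent[OF l(1,2) ne] det AC by blast
qed

text \<open>
  The condition \<open>p dvd \<alpha> l\<close> says that \<open>l\<close> has the direction of \<open>e\<close> mod \<open>p\<close>, and lines through a common
  point have different directions.
\<close>

lemma at_most_one_line_along_e:
  assumes "l \<in> L" "l' \<in> L" "on_line q l" "on_line q l'" "int p dvd \<alpha> l" "int p dvd \<alpha> l'"
  shows "l = l'"
proof (rule ccontr)
  assume "l \<noteq> l'"
  then have "\<not> int p dvd A l * B l' - A l' * B l" using transverse assms by blast
  then have "int p ^ 1 dvd e1" "int p ^ 1 dvd e2"
    using transverse_system[of l l' 1 e1 e2] assms(5,6) by (auto simp: \<alpha>_def)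
  then show False using e_nonzero by simp
qed

lemma slope_F:
  assumes "\<not> int p dvd \<alpha> l"
  shows "slope l \<in> range rc"
proof -
  have "residue_inverse p (rc (\<alpha> l)) \<in> range rc"
    using assms by (intro Fp.rec_F[OF rangeI]) (simp add: residue_class_eq_0_iff)
  from Fp.uminus_F[OF Fp.mult_F[OF this rangeI]] show ?thesis by (simp only: slope_def)
qed

lemma \<alpha>_slope:
  assumes "\<not> int p dvd \<alpha> l"
  shows "rc (\<alpha> l) * slope l = - rc (\<beta> l)"
proof -
  have "rc (\<alpha> l) * slope l = - ((residue_inverse p (rc (\<alpha> l)) * rc (\<alpha> l)) * rc (\<beta> l))"
    by (simp add: slope_def mult_ac)
  also have "residue_inverse p (rc (\<alpha> l)) * rc (\<alpha> l) = rc 1"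
    using assms by (intro Fp.rec_mult) (auto simp: residue_class_eq_0_iff)
  finally show ?thesis using Fp.e_mult[of "rc (\<beta> l)"] by simp
qed

text \<open>
  Equal slopes mean proportional \<open>(\<alpha>, \<beta>)\<close>, hence proportional normals mod \<open>p\<close>, which is impossible
  for different lines through one point.
\<close>

lemma slope_inj:
  assumes "l \<in> L" "l' \<in> L" "on_line q l" "on_line q l'"
    and \<alpha>: "\<not> int p dvd \<alpha> l" "\<not> int p dvd \<alpha> l'" and eq: "slope l = slope l'"
  shows "l = l'"
proof (rule ccontr)
  assume "l \<noteq> l'"
  then have "\<not> int p dvd A l * B l' - A l' * B l" using transverse assms by blast
  then have "rc (\<alpha> l) * rc (\<beta> l') - rc (\<alpha> l') * rc (\<beta> l) \<noteq> 0"
    unfolding frame_determinant by (simp add: residue_class_eq_0_iff)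
  moreover have "rc (\<beta> l') = - (rc (\<alpha> l') * slope l)" "rc (\<beta> l) = - (rc (\<alpha> l) * slope l)"
    using \<alpha>_slope[OF \<alpha>(1)] \<alpha>_slope[OF \<alpha>(2)] eq by auto
  ultimately show False by (simp add: algebra_simps)
qed

text \<open>
  Both lines \<open>l1, l2\<close> pass \<open>p\<^sup>j\<close>-closely to \<open>q1\<close>, so their intersection \<open>q\<close> is congruent to \<open>q1\<close> mod
  \<open>p\<^sup>j\<close> by transversality, and has coordinates \<open>X, Y\<close>.  Here \<open>l1\<close> reads \<open>X = u Y\<close>, and \<open>l2\<close> reads
  \<open>X - 1 = v Y\<close>; hence \<open>(u - v) Y = 1\<close>, and multiplying the equation of any line through \<open>q\<close> by
  \<open>u - v\<close> eliminates \<open>X\<close> and \<open>Y\<close>.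
\<close>

lemma grid_coordinates:
  assumes L12: "l1 \<in> L" "l2 \<in> L" "l1 \<noteq> l2"
    and on: "on_line q1 l1" "on_line q l1" "on_line q2 l2" "on_line q l2"
    and \<alpha>12: "\<not> int p dvd \<alpha> l1" "\<not> int p dvd \<alpha> l2"
    and l: "on_line q l"
  shows "near l" "rc (\<alpha> l) * slope l1 + rc (\<beta> l) + rc (\<gamma> l) * (slope l1 - slope l2) = 0"
proof -
  let ?dx = "fst q - fst q1" and ?dy = "snd q - snd q1"
  have jk: "int p ^ j dvd int p ^ k" "int p ^ Suc j dvd int p ^ k"
    using j by (auto intro: le_imp_power_dvd simp del: power_Suc)
  have diff: "A m * ?dx + B m * ?dy + (A m * fst q1 + B m * snd q1 + C m)
      = A m * fst q + B m * snd q + C m" for m by (simp add: algebra_simps)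
  have q2: "A m * fst q2 + B m * snd q2 + C m = A m * fst q1 + B m * snd q1 + C m + int p ^ j * \<alpha> m" for m
  proof -
    have "fst q2 = fst q1 + int p ^ j * e1" "snd q2 = snd q1 + int p ^ j * e2" using q2_q1 by auto
    then show ?thesis by (simp add: \<alpha>_def algebra_simps)
  qed
  have on_j: "int p ^ j dvd A m * fst q + B m * snd q + C m" if "on_line q m" for m q
    using that jk dvd_trans unfolding on_line_def by blast
  have near1: "near l1" using on_j[OF on(1)] by (simp add: near_def)
  have near2: "near l2"
    using on_j[OF on(3)] unfolding q2 near_def by (simp add: dvd_add_left_iff)
  have small: "int p ^ j dvd A m * ?dx + B m * ?dy" if "near m" "on_line q m" for m
  proof -
    have "int p ^ j dvd A m * ?dx + B m * ?dy + (A m * fst q1 + B m * snd q1 + C m)"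
      unfolding diff by (rule on_j[OF that(2)])
    then show ?thesis using that(1) unfolding near_def by (simp only: dvd_add_left_iff)
  qed
  note dxy = transverse_system[OF transverse[OF L12 on(2,4)] small[OF near1 on(2)] small[OF near2 on(4)]]
  obtain w1 w2 where w: "?dx = int p ^ j * w1" "?dy = int p ^ j * w2"
    using dxy by (elim dvdE) blast
  have nearI: "near m" if "on_line q m" for m
  proof -
    have "int p ^ j dvd A m * ?dx + B m * ?dy" unfolding w by simp
    moreover have "int p ^ j dvd A m * ?dx + B m * ?dy + (A m * fst q1 + B m * snd q1 + C m)"
      unfolding diff by (rule on_j[OF that])
    ultimately show ?thesis unfolding near_def by (simp only: dvd_add_right_iff)
  qed
  show "near l" by (rule nearI[OF l])
  define X Y where "X = rc (h1 * w1 + h2 * w2)" and "Y = rc (e1 * w2 - e2 * w1)"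
  have p0: "int p \<noteq> 0" using prime_p by (auto simp: prime_gt_0_nat)
  have cancel: "int p dvd x" if "int p ^ k dvd int p ^ j * x" for x
  proof -
    have "int p ^ Suc j dvd int p ^ j * x" using jk(2) that by (rule dvd_trans)
    then have "int p ^ j * int p dvd int p ^ j * x" by (simp add: mult.commute)
    then show ?thesis using p0 by simp
  qed
  have eqn: "rc (\<alpha> m) * X + rc (\<beta> m) * Y + rc (\<gamma> m) = 0" if "on_line q m" for m
  proof -
    have "int p ^ k dvd int p ^ j * (A m * w1 + B m * w2 + \<gamma> m)"
      using that unfolding on_line_def diff[of m, symmetric] w near_\<gamma>[OF nearI[OF that]]
      by (simp add: algebra_simps)
    from cancel[OF this] have "rc (A m * w1 + B m * w2 + \<gamma> m) = 0"
      by (simp only: residue_class_eq_0_iff)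
    then have "rc (A m * w1 + B m * w2) + rc (\<gamma> m) = 0" by (simp only: residue_class_add)
    then show ?thesis by (simp only: frame_coordinates X_def Y_def)
  qed
  have "int p ^ k dvd int p ^ j * \<gamma> l1"
    using on(1) unfolding on_line_def near_\<gamma>[OF near1] .
  from cancel[OF this] have "rc (\<gamma> l1) = 0" by (simp only: residue_class_eq_0_iff)
  moreover have "rc (\<gamma> l2) = - rc (\<alpha> l2)"
  proof -
    have "int p ^ k dvd int p ^ j * (\<gamma> l2 + \<alpha> l2)"
      using on(3) unfolding on_line_def q2 near_\<gamma>[OF near2] by (simp add: distrib_left)
    from cancel[OF this] have "rc (\<gamma> l2 + \<alpha> l2) = 0" by (simp only: residue_class_eq_0_iff)
    then show ?thesis by (simp add: residue_class_add eq_neg_iff_add_eq_0)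
  qed
  moreover define u v where "u = slope l1" and "v = slope l2"
  moreover have \<beta>12: "rc (\<beta> l1) = - (rc (\<alpha> l1) * u)" "rc (\<beta> l2) = - (rc (\<alpha> l2) * v)"
    using \<alpha>_slope[OF \<alpha>12(1)] \<alpha>_slope[OF \<alpha>12(2)] by (auto simp: u_def v_def)
  ultimately have eq1: "rc (\<alpha> l1) * X + - (rc (\<alpha> l1) * u) * Y + 0 = 0"
    and eq2: "rc (\<alpha> l2) * X + - (rc (\<alpha> l2) * v) * Y + - rc (\<alpha> l2) = 0"
    using eqn[OF on(2)] eqn[OF on(4)] by simp_all
  have F: "u \<in> range rc" "v \<in> range rc" "X \<in> range rc" "Y \<in> range rc"
    using slope_F[OF \<alpha>12(1)] slope_F[OF \<alpha>12(2)] by (simp_all add: u_def v_def X_def Y_def)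
  have a1: "rc (\<alpha> l1) * X = rc (\<alpha> l1) * (u * Y)"
    using eq1 by (simp add: mult.assoc)
  have a2: "rc (\<alpha> l2) * X = rc (\<alpha> l2) * (v * Y + rc 1)"
    using eq2 Fp.e_mult[of "rc (\<alpha> l2)"] by (simp add: algebra_simps)
  have nz: "rc (\<alpha> l1) \<noteq> 0" "rc (\<alpha> l2) \<noteq> 0" using \<alpha>12 by (simp_all add: residue_class_eq_0_iff)
  have X1: "X = u * Y"
    by (rule Fp.mult_cancel_F[OF rangeI F(3) Fp.mult_F[OF F(1,4)] nz(1) a1])
  have X2: "X = v * Y + rc 1"
    by (rule Fp.mult_cancel_F[OF rangeI F(3) Fp.add_F[OF Fp.mult_F[OF F(2,4)] rangeI] nz(2) a2])
  have Y: "(u - v) * Y = rc 1" using X1 X2 by (simp add: algebra_simps)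
  have e: "rc 1 * z = z" if "z \<in> range rc" for z using that by (rule Fp.e_mult)
  have "0 = (u - v) * (rc (\<alpha> l) * X + rc (\<beta> l) * Y + rc (\<gamma> l))" using eqn[OF l] by simp
  also have "\<dots> = rc (\<alpha> l) * (((u - v) * Y) * u) + rc (\<beta> l) * ((u - v) * Y) + rc (\<gamma> l) * (u - v)"
    unfolding X1 by (simp add: algebra_simps)
  also have "\<dots> = rc (\<alpha> l) * u + rc (\<beta> l) + rc (\<gamma> l) * (u - v)"
    unfolding Y using e[OF F(1)] e[of "rc (\<beta> l)"] by (simp add: mult.commute)
  finally show "rc (\<alpha> l) * slope l1 + rc (\<beta> l) + rc (\<gamma> l) * (slope l1 - slope l2) = 0"
    by (simp add: u_def v_def)
qed

end

section \<open>The incidence bound for independent lines\<close>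

context pencil_frame
begin

text \<open>
  The chart degenerates on the line of the first pencil in direction \<open>e\<close>.  There is at most one such
  line, and each of its points is determined by the line of the second pencil through it.
\<close>

lemma points_on_lines_along_e:
  fixes n :: real
  assumes finQ: "finite Q"
    and apart: "\<And>q q'. q \<in> Q \<Longrightarrow> q' \<in> Q \<Longrightarrow> q \<noteq> q' \<Longrightarrow>
      \<not> (int p ^ k dvd fst q - fst q' \<and> int p ^ k dvd snd q - snd q')"
    and deg: "card {l \<in> L. on_line x2 l} \<le> n"
  shows "card {q \<in> Q. \<exists>l1\<in>L. \<exists>l2\<in>L. l1 \<noteq> l2 \<and> int p dvd \<alpha> l1 \<and>
      on_line x1 l1 \<and> on_line q l1 \<and> on_line x2 l2 \<and> on_line q l2} \<le> n"
proof -
  let ?Bad = "{q \<in> Q. \<exists>l1\<in>L. \<exists>l2\<in>L. l1 \<noteq> l2 \<and> int p dvd \<alpha> l1 \<and>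
      on_line x1 l1 \<and> on_line q l1 \<and> on_line x2 l2 \<and> on_line q l2}"
  have "\<forall>q\<in>?Bad. \<exists>l. fst l \<in> L \<and> snd l \<in> L \<and> fst l \<noteq> snd l \<and> int p dvd \<alpha> (fst l) \<and>
      on_line x1 (fst l) \<and> on_line q (fst l) \<and> on_line x2 (snd l) \<and> on_line q (snd l)"
    by auto
  from bchoice[OF this] obtain f where f: "\<And>q. q \<in> ?Bad \<Longrightarrow> fst (f q) \<in> L \<and> snd (f q) \<in> L \<and>
      fst (f q) \<noteq> snd (f q) \<and> int p dvd \<alpha> (fst (f q)) \<and>
      on_line x1 (fst (f q)) \<and> on_line q (fst (f q)) \<and> on_line x2 (snd (f q)) \<and> on_line q (snd (f q))"
    by blast
  have "inj_on (\<lambda>q. snd (f q)) ?Bad"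
  proof (rule inj_onI)
    fix q q' assume q: "q \<in> ?Bad" "q' \<in> ?Bad" and eq: "snd (f q) = snd (f q')"
    note fq = f[OF q(1)] and fq' = f[OF q(2)]
    have eq1: "fst (f q) = fst (f q')"
      using at_most_one_line_along_e[of "fst (f q)" "fst (f q')" x1] fq fq' by simp
    show "q = q'"
    proof (rule ccontr)
      assume "q \<noteq> q'"
      then have "\<not> (int p ^ k dvd fst q - fst q' \<and> int p ^ k dvd snd q - snd q')"
        using apart q by simp
      then show False
        using common_points_congruent[of "fst (f q)" "snd (f q)" q q'] fq fq' eq eq1 by simp
    qed
  qed
  moreover have "(\<lambda>q. snd (f q)) ` ?Bad \<subseteq> {l \<in> L. on_line x2 l}" using f by blast
  ultimately have "card ?Bad \<le> card {l \<in> L. on_line x2 l}"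
    using finite_L by (intro card_inj_on_le) auto
  then show ?thesis using deg by linarith
qed

text \<open>
  The equation \<open>\<alpha> u + \<beta> + \<gamma> (u - v) = 0\<close> solved for \<open>v\<close>, as slope and intercept; meaningful when
  \<open>\<gamma>\<close> does not vanish mod \<open>p\<close>.
\<close>

definition grid_line :: "'a \<Rightarrow> residue_family \<times> residue_family" where
  "grid_line l = (residue_inverse p (rc (\<gamma> l)) * (rc (\<alpha> l) + rc (\<gamma> l)), residue_inverse p (rc (\<gamma> l)) * rc (\<beta> l))"

lemma inverse_\<gamma>:
  assumes "rc (\<gamma> l) \<noteq> 0" "z \<in> range rc"
  shows "residue_inverse p (rc (\<gamma> l)) * (rc (\<gamma> l) * z) = z"
  using Fp.rec_mult[OF rangeI assms(1)] Fp.e_mult[OF assms(2)] by (simp flip: mult.assoc)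

lemma grid_line_F: "rc (\<gamma> l) \<noteq> 0 \<Longrightarrow> grid_line l \<in> range rc \<times> range rc"
  unfolding grid_line_def
  using Fp.mult_F[OF Fp.rec_F[OF rangeI] Fp.add_F[OF rangeI rangeI]] Fp.mult_F[OF Fp.rec_F[OF rangeI] rangeI]
  by blast

lemma grid_line_inj: "inj_on grid_line {l \<in> L. near l \<and> rc (\<gamma> l) \<noteq> 0}"
proof (rule inj_onI, clarify)
  fix l l' assume l: "l \<in> L" "near l" "rc (\<gamma> l) \<noteq> 0" and l': "l' \<in> L" "near l'" "rc (\<gamma> l') \<noteq> 0"
    and eq: "grid_line l = grid_line l'"
  define a b c a' b' c' where "a = rc (\<alpha> l)" "b = rc (\<beta> l)" "c = rc (\<gamma> l)"
    "a' = rc (\<alpha> l')" "b' = rc (\<beta> l')" "c' = rc (\<gamma> l')"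
  note defs = this
  define w w' where "w = residue_inverse p c" and "w' = residue_inverse p c'"
  have w: "w * (c * z) = z" "w' * (c' * z) = z" if "z \<in> range rc" for z
    using inverse_\<gamma>[OF l(3) that] inverse_\<gamma>[OF l'(3) that] by (simp_all add: w_def w'_def defs)
  have F: "a * c' \<in> range rc" "a' * c \<in> range rc" "b * c' \<in> range rc" "b' * c \<in> range rc"
      "a * b' \<in> range rc" "a' * b \<in> range rc" "rc 1 \<in> range rc"
    unfolding defs by (simp_all flip: residue_class_mult)
  have wc: "w * c = w' * c'"
    using Fp.rec_mult[OF rangeI l(3)] Fp.rec_mult[OF rangeI l'(3)] by (simp add: w_def w'_def defs)
  have b: "w * b = w' * b'" and "w * (a + c) = w' * (a' + c')"
    using eq by (simp_all add: grid_line_def w_def w'_def defs)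
  then have a: "w * a = w' * a'" using wc by (simp add: distrib_left)
  have "a * c' = w * (c * (a * c'))" using w F by simp
  also have "\<dots> = (w * a) * (c * c')" by (simp add: mult_ac)
  also have "\<dots> = w' * (c' * (a' * c))" unfolding a by (simp add: mult_ac)
  also have "\<dots> = a' * c" using w F by simp
  finally have ac: "a * c' = a' * c" .
  have "b * c' = w * (c * (b * c'))" using w F by simp
  also have "\<dots> = (w * b) * (c * c')" by (simp add: mult_ac)
  also have "\<dots> = w' * (c' * (b' * c))" unfolding b by (simp add: mult_ac)
  also have "\<dots> = b' * c" using w F by simp
  finally have bc: "b * c' = b' * c" .
  have "a * b' = w * (c * (a * b'))" using w F by simp
  also have "\<dots> = w * (c * (w' * (c' * (a * b'))))" using w(2)[OF F(5)] by simp
  also have "\<dots> = (w * a) * (w' * b') * (c * c')" by (simp add: mult_ac)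
  also have "\<dots> = (w' * a') * (w * b) * (c * c')" unfolding a b ..
  also have "\<dots> = w * (c * (w' * (c' * (a' * b))))" by (simp add: mult_ac)
  also have "\<dots> = a' * b" using w F by simp
  finally have ab: "a * b' = a' * b" .
  show "l = l'"
    by (rule proportional_imp_eq[OF l(1) l'(1) l(2) l'(2)]) (use ab ac bc in \<open>simp_all add: defs\<close>)
qed

text \<open>
  Transfer to the grid.  After removing the at most \<open>4n\<close> points on lines along \<open>e\<close>, each point \<open>q\<close> has
  coordinates \<open>(u q, v q)\<close> that determine it, and each line \<open>l\<close> through it with \<open>\<gamma> l\<close> nonzero mod \<open>p\<close>
  becomes a line of the grid; at most one line through \<open>q\<close> is vertical.  The bound for grids is
  applied with \<open>2n\<close> in place of \<open>n\<close>, since the pencils have at most \<open>2n\<close> lines.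
\<close>

lemma pencils_bound:
  fixes K n :: real
  assumes K: "K \<ge> 2" and n: "n \<ge> 8 * K ^ 22" and L: "card L \<le> n\<^sup>2"
    and finQ: "finite Q" and card_Q: "n\<^sup>2 / K ^ 22 \<le> card Q"
    and apart: "\<And>q q'. q \<in> Q \<Longrightarrow> q' \<in> Q \<Longrightarrow> q \<noteq> q' \<Longrightarrow>
      \<not> (int p ^ k dvd fst q - fst q' \<and> int p ^ k dvd snd q - snd q')"
    and deg: "card {l \<in> L. on_line q1 l} \<le> 2 * n" "card {l \<in> L. on_line q2 l} \<le> 2 * n"
    and rich: "\<And>q. q \<in> Q \<Longrightarrow> n / (8 * K) \<le> card {l \<in> L. on_line q l}"
    and pencils: "\<And>q. q \<in> Q \<Longrightarrow> \<exists>l1\<in>L. \<exists>l2\<in>L. l1 \<noteq> l2 \<and>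
      on_line q l1 \<and> on_line q1 l1 \<and> on_line q l2 \<and> on_line q2 l2"
  shows "2 * n \<le> (K ^ 31) ^ 359550 \<or> p \<le> (K ^ 31) ^ 359550 * (2 * n)"
proof -
  have K22: "K * 2 \<le> K ^ 22"
  proof -
    have "K * 2 \<le> K * K" using K by (intro mult_left_mono) auto
    also have "\<dots> = K ^ 2" by (simp add: power2_eq_square)
    also have "\<dots> \<le> K ^ 22" using K by (intro power_increasing) auto
    finally show ?thesis .
  qed
  have n0: "n > 0" and n16: "n \<ge> 16 * K" using n K K22 by linarith+
  define Bad where "Bad x1 x2 = {q \<in> Q. \<exists>l1\<in>L. \<exists>l2\<in>L. l1 \<noteq> l2 \<and> int p dvd \<alpha> l1 \<and>
      on_line x1 l1 \<and> on_line q l1 \<and> on_line x2 l2 \<and> on_line q l2}" for x1 x2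
  define Q1 where "Q1 = {q \<in> Q. \<exists>l1\<in>L. \<exists>l2\<in>L. l1 \<noteq> l2 \<and> \<not> int p dvd \<alpha> l1 \<and> \<not> int p dvd \<alpha> l2 \<and>
      on_line q1 l1 \<and> on_line q l1 \<and> on_line q2 l2 \<and> on_line q l2}"
  have fin: "finite Q1" "finite (Bad q1 q2)" "finite (Bad q2 q1)" using finQ by (auto simp: Q1_def Bad_def)
  have bad: "card (Bad q1 q2) \<le> 2 * n" "card (Bad q2 q1) \<le> 2 * n"
    unfolding Bad_def by (intro points_on_lines_along_e[OF finQ apart] deg; assumption)+
  have "q \<in> Q1 \<union> Bad q1 q2 \<union> Bad q2 q1" if q: "q \<in> Q" for q
  proof -
    obtain l1 l2 where l12: "l1 \<in> L" "l2 \<in> L" "l1 \<noteq> l2" "l2 \<noteq> l1"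
      "on_line q l1" "on_line q1 l1" "on_line q l2" "on_line q2 l2"
      using pencils[OF q] by auto
    consider "int p dvd \<alpha> l1" | "int p dvd \<alpha> l2" | "\<not> int p dvd \<alpha> l1" "\<not> int p dvd \<alpha> l2" by blast
    then show ?thesis
    proof cases
      case 1
      then have "q \<in> Bad q1 q2"
        unfolding Bad_def using q l12 by (intro CollectI conjI bexI[of _ l1] bexI[of _ l2])
      then show ?thesis by simp
    next
      case 2
      then have "q \<in> Bad q2 q1"
        unfolding Bad_def using q l12 by (intro CollectI conjI bexI[of _ l2] bexI[of _ l1])
      then show ?thesis by simp
    next
      case 3
      then have "q \<in> Q1"
        unfolding Q1_def using q l12 by (intro CollectI conjI bexI[of _ l1] bexI[of _ l2])
      then show ?thesis by simp
    qed
  qed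
  then have "Q \<subseteq> Q1 \<union> Bad q1 q2 \<union> Bad q2 q1" by blast
  then have "card Q \<le> card (Q1 \<union> Bad q1 q2 \<union> Bad q2 q1)" using fin by (intro card_mono) auto
  also have "\<dots> \<le> card Q1 + card (Bad q1 q2) + card (Bad q2 q1)"
    using card_Un_le[of "Q1 \<union> Bad q1 q2" "Bad q2 q1"] card_Un_le[of Q1 "Bad q1 q2"] by linarith
  finally have "n\<^sup>2 / K ^ 22 \<le> card Q1 + 4 * n" using card_Q bad by linarith
  moreover have "4 * n \<le> n\<^sup>2 / K ^ 22 / 2"
  proof -
    have "n * (8 * K ^ 22) \<le> n * n" using n n0 by (intro mult_left_mono) auto
    then show ?thesis using K by (simp add: power2_eq_square field_simps)
  qed
  moreover have "n\<^sup>2 / K ^ 23 \<le> n\<^sup>2 / K ^ 22 / 2"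
  proof -
    have "K ^ 22 * 2 \<le> K ^ 22 * K" using K by (intro mult_left_mono) auto
    also have "\<dots> = K ^ 23" by (simp add: numeral_eq_Suc)
    finally have "n\<^sup>2 / K ^ 23 \<le> n\<^sup>2 / (K ^ 22 * 2)" using K by (intro divide_left_mono) auto
    then show ?thesis by simp
  qed
  ultimately have cQ1: "n\<^sup>2 / K ^ 23 \<le> card Q1" by linarith

  have "\<forall>q\<in>Q1. \<exists>l. fst l \<in> L \<and> snd l \<in> L \<and> fst l \<noteq> snd l \<and> \<not> int p dvd \<alpha> (fst l) \<and> \<not> int p dvd \<alpha> (snd l) \<and>
      on_line q1 (fst l) \<and> on_line q (fst l) \<and> on_line q2 (snd l) \<and> on_line q (snd l)"
    unfolding Q1_def by auto
  from bchoice[OF this] obtain h where h: "\<And>q. q \<in> Q1 \<Longrightarrow>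
      fst (h q) \<in> L \<and> snd (h q) \<in> L \<and> fst (h q) \<noteq> snd (h q) \<and> \<not> int p dvd \<alpha> (fst (h q)) \<and> \<not> int p dvd \<alpha> (snd (h q)) \<and>
      on_line q1 (fst (h q)) \<and> on_line q (fst (h q)) \<and> on_line q2 (snd (h q)) \<and> on_line q (snd (h q))"
    by blast
  define u v where "u q = slope (fst (h q))" and "v q = slope (snd (h q))" for q
  have coords: "near l" "rc (\<alpha> l) * u q + rc (\<beta> l) + rc (\<gamma> l) * (u q - v q) = 0"
    if "q \<in> Q1" "on_line q l" for q l
    using grid_coordinates[of "fst (h q)" "snd (h q)" q l] h[OF that(1)] that(2) by (simp_all add: u_def v_def)
  have uF: "u q \<in> range rc" "v q \<in> range rc" if "q \<in> Q1" for q
    using slope_F h[OF that] by (simp_all add: u_def v_def)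
  define G where "G x = {l \<in> L. on_line x l \<and> \<not> int p dvd \<alpha> l}" for x
  have card_G: "card (slope ` G x) \<le> card {l \<in> L. on_line x l}" for x
  proof -
    have "card (slope ` G x) \<le> card (G x)" using finite_L by (intro card_image_le) (simp add: G_def)
    also have "\<dots> \<le> card {l \<in> L. on_line x l}" using finite_L by (intro card_mono) (auto simp: G_def)
    finally show ?thesis .
  qed
  define U V where "U = slope ` G q1" and "V = slope ` G q2"
  have UV: "U \<subseteq> range rc" "V \<subseteq> range rc" "card U \<le> 2 * n" "card V \<le> 2 * n"
    using slope_F card_G[of q1] card_G[of q2] deg by (auto simp: U_def V_def G_def)
  have uv_in: "u q \<in> U" "v q \<in> V" if "q \<in> Q1" for q
    using h[OF that] by (auto simp: u_def v_def U_def V_def G_def)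
  have uv_inj: "q = q'" if q: "q \<in> Q1" "q' \<in> Q1" "u q = u q'" "v q = v q'" for q q'
  proof -
    note hq = h[OF q(1)] and hq' = h[OF q(2)]
    have 1: "fst (h q) = fst (h q')"
      using slope_inj[of "fst (h q)" "fst (h q')" q1] hq hq' q(3) by (simp add: u_def)
    have 2: "snd (h q) = snd (h q')"
      using slope_inj[of "snd (h q)" "snd (h q')" q2] hq hq' q(4) by (simp add: v_def)
    have "int p ^ k dvd fst q - fst q' \<and> int p ^ k dvd snd q - snd q'"
      using common_points_congruent[of "fst (h q)" "snd (h q)" q q'] hq hq' 1 2 by simp
    then show ?thesis using apart[of q q'] q by (auto simp: Q1_def)
  qed
  define Ln where "Ln = {l \<in> L. near l \<and> rc (\<gamma> l) \<noteq> 0}"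
  define M where "M = grid_line ` Ln"
  have finLn: "finite Ln" using finite_L by (simp add: Ln_def)
  have cM: "card M \<le> n\<^sup>2"
  proof -
    have "card M \<le> card Ln" unfolding M_def using finLn by (rule card_image_le)
    also have "\<dots> \<le> card L" using finite_L by (intro card_mono) (auto simp: Ln_def)
    finally show ?thesis using L by linarith
  qed
  have MF: "M \<subseteq> range rc \<times> range rc" using grid_line_F unfolding M_def Ln_def by blast
  define N where "N q = {l \<in> L. on_line q l \<and> rc (\<gamma> l) \<noteq> 0}" for q
  have finN: "finite (N q)" for q using finite_L by (simp add: N_def)
  have NLn: "N q \<subseteq> Ln" if "q \<in> Q1" for q using coords(1)[OF that] by (auto simp: N_def Ln_def)
  have on_grid: "fst (grid_line l) * u q + snd (grid_line l) = v q" if q: "q \<in> Q1" and l: "l \<in> N q" for q l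
  proof -
    have \<gamma>: "rc (\<gamma> l) \<noteq> 0" and on: "on_line q l" using l by (auto simp: N_def)
    let ?w = "residue_inverse p (rc (\<gamma> l))"
    have "fst (grid_line l) * u q + snd (grid_line l)
        = ?w * ((rc (\<alpha> l) * u q + rc (\<beta> l) + rc (\<gamma> l) * (u q - v q)) + rc (\<gamma> l) * v q)"
      by (simp add: grid_line_def algebra_simps)
    also have "\<dots> = v q" using coords(2)[OF q on] inverse_\<gamma>[OF \<gamma> uF(2)[OF q]] by simp
    finally show ?thesis .
  qed
  have cN: "n / (16 * K) \<le> card (N q)" if q: "q \<in> Q1" for q
  proof -
    let ?V = "{l \<in> L. on_line q l \<and> rc (\<gamma> l) = 0}"
    have "l = l'" if l: "l \<in> ?V" "l' \<in> ?V" for l l'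
    proof -
      have \<beta>: "rc (\<beta> m) = - (rc (\<alpha> m) * u q)" if "m \<in> ?V" for m
        using coords(2)[OF q, of m] that by (simp add: eq_neg_iff_add_eq_0 add.commute)
      have "rc (\<alpha> l) * rc (\<beta> l') = rc (\<alpha> l') * rc (\<beta> l)"
        unfolding \<beta>[OF l(1)] \<beta>[OF l(2)] by (simp add: mult_ac)
      then show ?thesis
        using coords(1)[OF q] l by (intro proportional_imp_eq) auto
    qed
    then have "card ?V \<le> 1"
      using finite_L by (intro card_le_Suc0_iff_eq[THEN iffD2, folded One_nat_def]) auto
    moreover have "{l \<in> L. on_line q l} = N q \<union> ?V" by (auto simp: N_def)
    then have "card {l \<in> L. on_line q l} \<le> card (N q) + card ?V" by (simp add: card_Un_le)
    moreover have "n / (8 * K) \<le> card {l \<in> L. on_line q l}" using rich q by (auto simp: Q1_def)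
    moreover have "n / (8 * K) = n / (16 * K) + n / (16 * K)" using K by (simp add: field_simps)
    moreover have "1 \<le> n / (16 * K)" using n16 K by (simp add: field_simps)
    ultimately show ?thesis by linarith
  qed
  \<comment> \<open>The remaining points number at least \<open>n\<^sup>2/K\<^sup>2\<^sup>3\<close>, with at least \<open>n/(16 K)\<close> grid lines through each.\<close>
  have "(2 * n) ^ 3 / K ^ 31 \<le> n\<^sup>2 / K ^ 23 * (n / (16 * K))"
  proof -
    have "128 * K ^ 24 \<le> K ^ 7 * K ^ 24" using numeral_le_power[OF K, of 128 7] K by (intro mult_right_mono) auto
    also have "\<dots> = K ^ 31" by (simp flip: power_add)
    finally have "8 * n ^ 3 / K ^ 31 \<le> 8 * n ^ 3 / (128 * K ^ 24)"
      using K n0 by (intro divide_left_mono) auto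
    moreover have "K ^ 24 = K ^ 23 * K" by (simp add: numeral_eq_Suc)
    ultimately show ?thesis by (simp add: power_mult_distrib power2_eq_square power3_eq_cube mult_ac)
  qed
  also have "\<dots> \<le> card Q1 * (n / (16 * K))" using cQ1 n0 K by (intro mult_right_mono) auto
  also have "\<dots> = (\<Sum>q\<in>Q1. n / (16 * K))" by simp
  also have "\<dots> \<le> (\<Sum>q\<in>Q1. real (card (N q)))" by (intro sum_mono cN)
  also have "\<dots> = card (SIGMA q:Q1. N q)" using fin finN by (simp add: card_SigmaI)
  also have "\<dots> \<le> card (SIGMA m:M. {u \<in> U. fst m * u + snd m \<in> V})"
  proof -
    let ?f = "\<lambda>(q, l). (grid_line l, u q)"
    have finU: "finite U" using finite_L by (simp add: U_def G_def)
    have "inj_on ?f (SIGMA q:Q1. N q)"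
    proof (rule inj_onI)
      fix x y assume x: "x \<in> (SIGMA q:Q1. N q)" and y: "y \<in> (SIGMA q:Q1. N q)" and eq: "?f x = ?f y"
      obtain q l q' l' where xy: "x = (q, l)" "y = (q', l')" by (metis surj_pair)
      have q: "q \<in> Q1" "l \<in> N q" and q': "q' \<in> Q1" "l' \<in> N q'" using x y by (auto simp: xy)
      have gl: "grid_line l = grid_line l'" and u: "u q = u q'" using eq by (auto simp: xy)
      have "l = l'"
        using inj_onD[OF grid_line_inj gl] NLn[OF q(1)] NLn[OF q'(1)] q q' unfolding Ln_def by blast
      moreover have "v q = v q'" using on_grid[OF q] on_grid[OF q'] gl u by simp
      then have "q = q'" using uv_inj q q' u by blast
      ultimately show "x = y" by (simp add: xy)
    qed
    moreover have "?f ` (SIGMA q:Q1. N q) \<subseteq> (SIGMA m:M. {u \<in> U. fst m * u + snd m \<in> V})"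
    proof (rule image_subsetI)
      fix x assume x: "x \<in> (SIGMA q:Q1. N q)"
      obtain q l where xe: "x = (q, l)" by (metis surj_pair)
      have q: "q \<in> Q1" "l \<in> N q" using x by (auto simp: xe)
      show "?f x \<in> (SIGMA m:M. {u \<in> U. fst m * u + snd m \<in> V})"
        using on_grid[OF q] uv_in[OF q(1)] NLn[OF q(1)] q(2) by (auto simp: xe M_def)
    qed
    moreover have "finite (SIGMA m:M. {u \<in> U. fst m * u + snd m \<in> V})"
      using finU finLn by (auto simp: M_def)
    ultimately show ?thesis by (intro of_nat_mono card_inj_on_le)
  qed
  also have "\<dots> = (\<Sum>m\<in>M. real (card {u \<in> U. fst m * u + snd m \<in> V}))"
    using finLn finite_L by (subst card_SigmaI) (auto simp: M_def U_def G_def)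
  finally have many: "(2 * n) ^ 3 / K ^ 31 \<le> (\<Sum>m\<in>M. real (card {u \<in> U. fst m * u + snd m \<in> V}))" .
  have "2 \<le> K ^ 31" using numeral_le_power[OF K, of 2 1] power_increasing[of 1 31 K] K by simp
  moreover have "card M \<le> (2 * n)\<^sup>2" using cM n0 by (simp add: power_mult_distrib)
  moreover have "card (range rc) = p" using prime_p by (intro card_range_residue_class prime_gt_0_nat)
  ultimately show ?thesis
    using Fp.grid_incidence_bound[of "K ^ 31" "2 * n" U V M] n0 UV MF many by simp
qed

end

context separated_lines
begin

text \<open>
  If \<open>n\<close> is smaller than a power of \<open>K\<close>, nothing is to be shown; otherwise two rich pencils exist.  The
  exponent is \<open>31 \<sqdot> 359550 + 1\<close>.
\<close>

theorem incidence_bound: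
  fixes K n :: real
  assumes K: "K \<ge> 2" and n: "n > 0" and finP: "finite P"
    and apart: "\<And>q q'. q \<in> P \<Longrightarrow> q' \<in> P \<Longrightarrow> q \<noteq> q' \<Longrightarrow>
      \<not> (int p ^ k dvd fst q - fst q' \<and> int p ^ k dvd snd q - snd q')"
    and P: "card P \<le> n\<^sup>2" and L: "card L \<le> n\<^sup>2"
    and rich: "n ^ 3 / K \<le> (\<Sum>q\<in>P. real (card {l \<in> L. on_line q l}))"
  shows "n \<le> K ^ 11146051 \<or> p \<le> K ^ 11146051 * n"
proof (cases "n < 8 * K ^ 22")
  case True
  also have "8 * K ^ 22 \<le> K ^ 3 * K ^ 22" using numeral_le_power[OF K, of 8 3] K by (intro mult_right_mono) auto
  also have "\<dots> = K ^ 25" by (simp flip: power_add)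
  also have "\<dots> \<le> K ^ 11146051" using K by (intro power_increasing) auto
  finally show ?thesis by simp
next
  case False
  then have n22: "n \<ge> 8 * K ^ 22" by simp
  have "K * 2 \<le> K * K" using K by (intro mult_left_mono) auto
  also have "\<dots> = K ^ 2" by (simp add: power2_eq_square)
  also have "\<dots> \<le> K ^ 22" using K by (intro power_increasing) auto
  finally have n16: "n \<ge> 16 * K" using n22 by linarith
  have unique: "l = l'" if "q \<in> P" "q' \<in> P" "q \<noteq> q'" "l \<in> L" "l' \<in> L"
    "on_line q l" "on_line q l'" "on_line q' l" "on_line q' l'" for q q' l l'
    using common_points_congruent[of l l' q q'] apart[of q q'] that by blast
  obtain q1 q2 Q where q12: "q1 \<in> P" "q2 \<in> P" "q1 \<noteq> q2" and Q: "Q \<subseteq> P" "n\<^sup>2 / K ^ 22 \<le> card Q"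
    and deg: "card {l \<in> L. on_line q1 l} \<le> 2 * n" "card {l \<in> L. on_line q2 l} \<le> 2 * n"
    and pencils: "\<And>q. q \<in> Q \<Longrightarrow> n / (8 * K) \<le> card {l \<in> L. on_line q l} \<and> q \<noteq> q1 \<and> q \<noteq> q2 \<and>
      (\<exists>l1\<in>L. \<exists>l2\<in>L. l1 \<noteq> l2 \<and> on_line q l1 \<and> on_line q1 l1 \<and> on_line q l2 \<and> on_line q2 l2)"
  proof (rule two_pencils[where I = on_line, OF finP finite_L K n16 P L _ rich], goal_cases)
    case 1
    then show ?case using unique by blast
  next
    case 2
    then show ?case using that by blast
  qed
  have "\<not> (int p ^ k dvd fst q2 - fst q1 \<and> int p ^ k dvd snd q2 - snd q1)"
    using apart[OF q12(2,1)] q12(3) by blast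
  then obtain j e1 e2 h1 h2 where frame: "j < k" "fst q2 - fst q1 = int p ^ j * e1"
    "snd q2 - snd q1 = int p ^ j * e2" "\<not> (int p dvd e1 \<and> int p dvd e2)" "[h1 * e1 + h2 * e2 = 1] (mod int p)"
    by (rule exists_frame[OF prime_p])
  interpret pencil_frame p k L A B C q1 q2 j e1 e2 h1 h2
    by unfold_locales (fact frame)+
  have finQ: "finite Q" using Q finP finite_subset by blast
  have "2 * n \<le> (K ^ 31) ^ 359550 \<or> p \<le> (K ^ 31) ^ 359550 * (2 * n)"
  proof (rule pencils_bound[OF K n22 L finQ Q(2) _ deg])
    show "\<not> (int p ^ k dvd fst q - fst q' \<and> int p ^ k dvd snd q - snd q')"
      if "q \<in> Q" "q' \<in> Q" "q \<noteq> q'" for q q' using apart[of q q'] that Q(1) by blast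
  qed (use pencils in blast)+
  then have "2 * n \<le> K ^ 11146050 \<or> p \<le> K ^ 11146050 * (2 * n)" by (simp flip: power_mult)
  moreover have "K ^ 11146050 * 2 \<le> K ^ 11146051"
  proof -
    have "K ^ 11146050 * 2 \<le> K ^ 11146050 * K" using K by (intro mult_left_mono) auto
    also have "\<dots> = K ^ (11146050 + 1)" by (simp only: power_add power_one_right)
    finally show ?thesis by simp
  qed
  ultimately show ?thesis
  proof (elim disjE)
    assume "2 * n \<le> K ^ 11146050"
    moreover have "0 \<le> K ^ 11146050" using K by simp
    ultimately have "n \<le> K ^ 11146051" using \<open>K ^ 11146050 * 2 \<le> K ^ 11146051\<close> n by linarith
    then show ?thesis ..
  next
    assume "p \<le> K ^ 11146050 * (2 * n)"
    also have "\<dots> = (K ^ 11146050 * 2) * n" by simp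
    also have "\<dots> \<le> K ^ 11146051 * n"
      using \<open>K ^ 11146050 * 2 \<le> K ^ 11146051\<close> n by (intro mult_right_mono) auto
    finally show ?thesis ..
  qed
qed

end

section \<open>Separated lines in the plane over the residue ring\<close>

context
  fixes p k :: nat
  assumes prime_p: "prime p" and k: "1 \<le> k"
begin

lemma residues_Rk: "residues (int p ^ k)"
proof
  have "1 < p ^ k" using prime_gt_1_nat[OF prime_p] k by (intro one_less_power) auto
  then show "1 < int p ^ k" by (metis of_nat_1 of_nat_less_iff of_nat_power)
qed

lemma Rk_simps:
  "carrier (Rk p k) = {0..int p ^ k - 1}"
  "x \<oplus>\<^bsub>Rk p k\<^esub> y = (x + y) mod int p ^ k"
  "x \<otimes>\<^bsub>Rk p k\<^esub> y = (x * y) mod int p ^ k"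
  unfolding Rk_def
  by (rule residues.res_carrier_eq[OF residues_Rk], rule residues.res_add_eq[OF residues_Rk],
      rule residues.res_mult_eq[OF residues_Rk])

lemma p_dvd_pk: "int p dvd int p ^ k"
  using k by (simp add: dvd_power)

lemma coprime_pk_iff: "coprime x (int p ^ k) \<longleftrightarrow> \<not> int p dvd x"
proof -
  have "prime (int p)" using prime_p by simp
  then have "\<not> int p dvd x \<longleftrightarrow> coprime (int p) x" by (meson coprime_absorb_left not_prime_unit prime_imp_coprime)
  then show ?thesis using k by (simp add: coprime_commute)
qed

lemma Units_Rk: "x \<in> Units (Rk p k) \<longleftrightarrow> 0 < x \<and> x < int p ^ k \<and> \<not> int p dvd x"
  unfolding Rk_def residues.res_units_eq[OF residues_Rk] using coprime_pk_iff[of x] by simp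

lemma mod_pk_unit: "\<not> int p dvd x \<Longrightarrow> x mod int p ^ k \<in> Units (Rk p k)"
proof -
  assume x: "\<not> int p dvd x"
  have pos: "int p ^ k > 0" using prime_gt_0_nat[OF prime_p] by simp
  have nd: "\<not> int p dvd x mod int p ^ k" using x p_dvd_pk by (simp add: dvd_mod_iff)
  then have "x mod int p ^ k \<noteq> 0" by auto
  moreover have "0 \<le> x mod int p ^ k" "x mod int p ^ k < int p ^ k" using pos by simp_all
  ultimately show ?thesis unfolding Units_Rk using nd by linarith
qed

lemma unimodular_mod_p: "b \<in> unimodular p k \<Longrightarrow> \<not> (int p dvd fst b \<and> int p dvd snd b)"
  by (auto simp: unimodular_def Units_Rk)

lemma pk_pos: "int p ^ k > 0"
  using prime_gt_0_nat[OF prime_p] by simp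

lemma exists_inverse_mod:
  assumes "\<not> int p dvd x"
  obtains y where "int p ^ k dvd x * y - 1"
proof -
  have "coprime x (int p ^ k)" using assms coprime_pk_iff by blast
  then obtain y where "[x * y = 1] (mod int p ^ k)" using cong_solve_coprime_int by blast
  then show ?thesis using that by (simp add: cong_iff_dvd_diff)
qed

lemma plane_eqI:
  assumes "q \<in> plane p k" "q' \<in> plane p k"
    and "int p ^ k dvd fst q - fst q'" "int p ^ k dvd snd q - snd q'"
  shows "q = q'"
proof -
  have eq: "x = y" if "x \<in> {0..int p ^ k - 1}" "y \<in> {0..int p ^ k - 1}" "int p ^ k dvd x - y" for x y
  proof -
    have "x mod int p ^ k = y mod int p ^ k" using that(3) by (simp add: mod_eq_dvd_iff)
    then show ?thesis using that by simp
  qed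
  show ?thesis using assms eq[of "fst q" "fst q'"] eq[of "snd q" "snd q'"]
    by (auto simp: plane_def Rk_simps prod_eq_iff)
qed

lemma finite_plane: "finite (plane p k)"
  by (simp add: plane_def Rk_simps)

lemma line_eq: "line p k a b = (\<lambda>t. ((fst a + t * fst b) mod int p ^ k, (snd a + t * snd b) mod int p ^ k)) ` UNIV"
proof -
  have "line p k a b = (\<lambda>t. ((fst a + t * fst b) mod int p ^ k, (snd a + t * snd b) mod int p ^ k)) ` {0..int p ^ k - 1}"
    by (simp add: line_def padd_def pscale_def Rk_simps mod_simps)
  also have "\<dots> = (\<lambda>t. ((fst a + t * fst b) mod int p ^ k, (snd a + t * snd b) mod int p ^ k)) ` UNIV"
  proof (intro subset_antisym subsetI)
    fix q assume "q \<in> (\<lambda>t. ((fst a + t * fst b) mod int p ^ k, (snd a + t * snd b) mod int p ^ k)) ` UNIV"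
    then obtain t where t: "q = ((fst a + t * fst b) mod int p ^ k, (snd a + t * snd b) mod int p ^ k)" by auto
    let ?t = "t mod int p ^ k"
    have "(x + ?t * y) mod int p ^ k = (x + t * y) mod int p ^ k" for x y
      by (metis mod_add_right_eq mod_mult_left_eq)
    then have "q = ((fst a + ?t * fst b) mod int p ^ k, (snd a + ?t * snd b) mod int p ^ k)"
      by (simp add: t)
    moreover have "?t \<in> {0..int p ^ k - 1}" using pk_pos by simp
    ultimately show "q \<in> (\<lambda>t. ((fst a + t * fst b) mod int p ^ k, (snd a + t * snd b) mod int p ^ k)) ` {0..int p ^ k - 1}"
      by blast
  qed auto
  finally show ?thesis .
qed

text \<open>
  Solve for the parameter in the coordinate in which the direction is invertible; the equation of the
  line takes care of the other coordinate.  The modulus \<open>m\<close> will be \<open>p\<^sup>k\<close> or \<open>p\<close>.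
\<close>

lemma exists_line_parameter:
  assumes b: "b \<in> unimodular p k" and m: "m dvd int p ^ k"
    and on: "m dvd snd b * x + - fst b * y + (fst b * snd a - snd b * fst a)"
  obtains t where "m dvd x - (fst a + t * fst b)" "m dvd y - (snd a + t * snd b)"
proof (cases "int p dvd fst b")
  case False
  then obtain c where "int p ^ k dvd fst b * c - 1" by (rule exists_inverse_mod)
  then have c: "m dvd fst b * c - 1" using m by (rule dvd_trans[rotated])
  let ?D = "snd b * x + - fst b * y + (fst b * snd a - snd b * fst a)"
  have "x - (fst a + ((x - fst a) * c) * fst b) = - (x - fst a) * (fst b * c - 1)"
    by (simp add: algebra_simps)
  moreover have "y - (snd a + ((x - fst a) * c) * snd b) = - (y - snd a) * (fst b * c - 1) + - c * ?D"
    by (simp add: algebra_simps)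
  ultimately show ?thesis
    using that[of "(x - fst a) * c"] c on by (metis dvd_add dvd_mult)
next
  case True
  then have "\<not> int p dvd snd b" using unimodular_mod_p[OF b] by blast
  then obtain c where "int p ^ k dvd snd b * c - 1" by (rule exists_inverse_mod)
  then have c: "m dvd snd b * c - 1" using m by (rule dvd_trans[rotated])
  let ?D = "snd b * x + - fst b * y + (fst b * snd a - snd b * fst a)"
  have "y - (snd a + ((y - snd a) * c) * snd b) = - (y - snd a) * (snd b * c - 1)"
    by (simp add: algebra_simps)
  moreover have "x - (fst a + ((y - snd a) * c) * fst b) = - (x - fst a) * (snd b * c - 1) + c * ?D"
    by (simp add: algebra_simps)
  ultimately show ?thesis
    using that[of "(y - snd a) * c"] c on by (metis dvd_add dvd_mult)
qed

lemma mem_line_iff: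
  assumes b: "b \<in> unimodular p k"
  shows "q \<in> line p k a b \<longleftrightarrow> q \<in> plane p k \<and>
    int p ^ k dvd snd b * fst q + - fst b * snd q + (fst b * snd a - snd b * fst a)"
proof
  let ?m = "int p ^ k"
  assume "q \<in> line p k a b"
  then obtain t where q: "q = ((fst a + t * fst b) mod ?m, (snd a + t * snd b) mod ?m)"
    unfolding line_eq by blast
  have "[fst q = fst a + t * fst b] (mod ?m)" "[snd q = snd a + t * snd b] (mod ?m)"
    by (simp_all add: q cong_def)
  then have "[snd b * fst q + - fst b * snd q + (fst b * snd a - snd b * fst a)
      = snd b * (fst a + t * fst b) + - fst b * (snd a + t * snd b) + (fst b * snd a - snd b * fst a)] (mod ?m)"
    by (intro cong_add cong_mult cong_refl)
  also have "snd b * (fst a + t * fst b) + - fst b * (snd a + t * snd b) + (fst b * snd a - snd b * fst a) = 0"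
    by (simp add: algebra_simps)
  finally have "?m dvd snd b * fst q + - fst b * snd q + (fst b * snd a - snd b * fst a)"
    by (simp add: cong_0_iff)
  moreover have "q \<in> plane p k" using pk_pos by (simp add: q plane_def Rk_simps)
  ultimately show "q \<in> plane p k \<and> ?m dvd snd b * fst q + - fst b * snd q + (fst b * snd a - snd b * fst a)"
    by simp
next
  let ?m = "int p ^ k"
  assume q: "q \<in> plane p k \<and> ?m dvd snd b * fst q + - fst b * snd q + (fst b * snd a - snd b * fst a)"
  then obtain t where t: "?m dvd fst q - (fst a + t * fst b)" "?m dvd snd q - (snd a + t * snd b)"
    using exists_line_parameter[OF b dvd_refl, of "fst q" "snd q" a] by blast
  define q' where "q' = ((fst a + t * fst b) mod ?m, (snd a + t * snd b) mod ?m)"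
  have "q' \<in> plane p k" using pk_pos by (simp add: q'_def plane_def Rk_simps)
  moreover have "?m dvd fst q - fst q'" "?m dvd snd q - snd q'"
    using t by (simp_all add: q'_def mod_eq_dvd_iff[symmetric])
  ultimately have "q = q'" using q plane_eqI by blast
  then show "q \<in> line p k a b" unfolding line_eq q'_def by blast
qed

lemma finite_line: "finite (line p k a b)"
  by (simp add: line_def Rk_simps)

text \<open>
  If the determinant of \<open>b\<close> and \<open>b'\<close> vanishes mod \<open>p\<close>, then the coordinate in which \<open>b\<close> is invertible is
  also invertible in \<open>b'\<close>, and cross-multiplying by these coordinates makes the two vectors agree
  mod \<open>p\<close>.
\<close>

lemma parallel_angle_le:
  assumes b: "b \<in> unimodular p k" "b' \<in> unimodular p k" and par: "int p dvd snd b * fst b' - snd b' * fst b"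
  shows "angle_le p 1 (direction_class p k b) (direction_class p k b')"
proof -
  have ex: "angle_le p 1 (direction_class p k b) (direction_class p k b')"
    if r: "\<not> int p dvd r" "\<not> int p dvd r'" and eq: "int p dvd r * fst b - r' * fst b'" "int p dvd r * snd b - r' * snd b'"
    for r r'
  proof -
    let ?r = "r mod int p ^ k" and ?r' = "r' mod int p ^ k"
    have mem: "pscale p k ?r b \<in> direction_class p k b" "pscale p k ?r' b' \<in> direction_class p k b'"
      using mod_pk_unit r by (auto simp: direction_class_def)
    have red: "int p dvd (?r * x) mod int p ^ k - (?r' * y) mod int p ^ k" if "int p dvd r * x - r' * y" for x y
    proof -
      have "(?r * x) mod int p ^ k - (?r' * y) mod int p ^ k = (r * x) mod int p ^ k - (r' * y) mod int p ^ k"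
        by (simp add: mod_mult_left_eq)
      also have "[\<dots> = r * x - r' * y] (mod int p)"
        using p_dvd_pk by (intro cong_diff) (auto simp: cong_def mod_mod_cancel)
      finally show ?thesis using that cong_dvd_iff by blast
    qed
    have "pow_dvd_diff p 1 (pscale p k ?r b) (pscale p k ?r' b')"
      using red[OF eq(1)] red[OF eq(2)] by (simp add: pow_dvd_diff_def pscale_def Rk_simps)
    then show ?thesis unfolding angle_le_def using mem by blast
  qed
  have pr: "prime (int p)" using prime_p by simp
  show ?thesis
  proof (cases "int p dvd fst b")
    case True
    then have sb: "\<not> int p dvd snd b" using unimodular_mod_p[OF b(1)] by blast
    have "int p dvd (snd b * fst b' - snd b' * fst b) + snd b' * fst b"
      using dvd_add[OF par dvd_mult[OF True]] .
    then have "int p dvd snd b * fst b'" by simp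
    then have "int p dvd fst b'" using sb pr prime_dvd_mult_iff by blast
    then have sb': "\<not> int p dvd snd b'" using unimodular_mod_p[OF b(2)] by blast
    have "snd b' * fst b - snd b * fst b' = - (snd b * fst b' - snd b' * fst b)" by simp
    then have "int p dvd snd b' * fst b - snd b * fst b'" using par by (simp only: dvd_minus_iff)
    then show ?thesis by (intro ex[OF sb' sb]) (simp_all add: mult.commute)
  next
    case False
    have fb': "\<not> int p dvd fst b'"
    proof
      assume *: "int p dvd fst b'"
      have "int p dvd snd b * fst b' - (snd b * fst b' - snd b' * fst b)"
        using dvd_diff[OF dvd_mult[OF *] par] .
      then have "int p dvd snd b' * fst b" by simp
      then have "int p dvd snd b'" using False pr prime_dvd_mult_iff by blast
      then show False using * unimodular_mod_p[OF b(2)] by blast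
    qed
    have "fst b' * snd b - fst b * snd b' = snd b * fst b' - snd b' * fst b" by simp
    then show ?thesis using par by (intro ex[OF fb' False]) (simp_all add: mult.commute)
  qed
qed

lemma parallel_line_angle:
  assumes a: "a \<in> plane p k" "a' \<in> plane p k" and b: "b \<in> unimodular p k" "b' \<in> unimodular p k"
    and par: "int p dvd snd b * fst b' - snd b' * fst b"
  shows "line_angle p k (line p k a b) (line p k a' b') < 1"
proof -
  let ?D = "direction_class p k b" and ?D' = "direction_class p k b'"
  have le1: "angle_le p 1 ?D ?D'" by (rule parallel_angle_le[OF b par])
  then have "?D \<noteq> {}" "?D' \<noteq> {}" by (auto simp: angle_le_def)
  then have ex1: "\<exists>!j. has_angle_exponent p k j ?D ?D'" by (rule ex1_angle_exponent)
  define j where "j = (THE j. has_angle_exponent p k j ?D ?D')"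
  have j: "has_angle_exponent p k j ?D ?D'" unfolding j_def by (rule theI'[OF ex1])
  have "j \<noteq> 0"
  proof
    assume "j = 0"
    then show False using j le1 k by (simp add: has_angle_exponent_def)
  qed
  moreover have "1 < real p" using prime_gt_1_nat[OF prime_p] by simp
  ultimately have "1 < real p ^ j" by (intro one_less_power) auto
  then have "1 / real p ^ j < 1" by (subst divide_less_eq_1_pos) linarith+
  then show ?thesis
    using line_direction_line[OF prime_p k a(1) b(1)] line_direction_line[OF prime_p k a(2) b(2)]
    by (simp add: line_angle_def angle_def flip: j_def)
qed

text \<open>
  Lines that are parallel mod \<open>p\<close> can only be separated in distance, and then their reductions mod
  some \<open>p\<^sup>r\<close> with \<open>r \<ge> 1\<close> are at distance \<open>1\<close>; congruent points would be at distance at most \<open>1/p\<close>.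
\<close>

lemma separated_parallel_lines_disjoint_mod_p:
  assumes a: "a \<in> plane p k" "a' \<in> plane p k" and b: "b \<in> unimodular p k" "b' \<in> unimodular p k"
    and sep: "separated_in_direction p k (line p k a b) (line p k a' b') \<or>
      separated_in_distance p k (line p k a b) (line p k a' b')"
    and par: "int p dvd snd b * fst b' - snd b' * fst b"
    and xy: "x \<in> line p k a b" "y \<in> line p k a' b'"
  shows "\<not> (int p dvd fst x - fst y \<and> int p dvd snd x - snd y)"
proof
  assume cong: "int p dvd fst x - fst y \<and> int p dvd snd x - snd y"
  let ?l = "line p k a b" and ?l' = "line p k a' b'"
  have p1: "1 < real p" using prime_gt_1_nat[OF prime_p] by simp
  have "\<not> separated_in_direction p k ?l ?l'"
    using parallel_line_angle[OF a b par] by (simp add: separated_in_direction_def)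
  then obtain j where j: "lines_at_distance p k j ?l ?l'" "1 / real p ^ j \<ge> 1"
    using sep by (auto simp: separated_in_distance_def)
  have "j = 0"
  proof (rule ccontr)
    assume "j \<noteq> 0"
    then have "1 < real p ^ j" using p1 by (intro one_less_power) auto
    then have "1 / real p ^ j < 1" by (subst divide_less_eq_1_pos) linarith+
    then show False using j(2) by linarith
  qed
  then obtain r where r: "1 \<le> r" "set_dist p r (reduction p r ` ?l) (reduction p r ` ?l') = 1"
    using j(1) by (auto simp: lines_at_distance_def)
  let ?S = "{pdist p r u v |u v. u \<in> reduction p r ` ?l \<and> v \<in> reduction p r ` ?l'}"
  let ?x = "reduction p r x" and ?y = "reduction p r y"
  have "finite ?S" by (rule finite_image_set2) (simp_all add: finite_line)
  moreover have "pdist p r ?x ?y \<in> ?S" using xy by blast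
  ultimately have ge1: "1 \<le> pdist p r ?x ?y" using r(2) Min_le[of ?S] by (simp add: set_dist_def)
  have "int p dvd int p ^ r" using r(1) by (simp add: dvd_power)
  then have red: "int p dvd u mod int p ^ r - v mod int p ^ r" if "int p dvd u - v" for u v
    using that by (metis mod_eq_dvd_iff mod_mod_cancel)
  have "pow_dvd_diff p 1 ?x ?y"
    using cong red by (simp add: pow_dvd_diff_def reduction_def)
  then have "1 \<in> {j. j \<le> r \<and> pow_dvd_diff p j ?x ?y}" using r(1) by simp
  then have "1 \<le> Max {j. j \<le> r \<and> pow_dvd_diff p j ?x ?y}" by (intro Max_ge) auto
  then have "1 < real p ^ Max {j. j \<le> r \<and> pow_dvd_diff p j ?x ?y}"
    using p1 by (intro one_less_power) auto
  then have "pdist p r ?x ?y < 1" unfolding pdist_def by (subst divide_less_eq_1_pos) linarith+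
  then show False using ge1 by linarith
qed

text \<open>
  If the coefficient vectors were proportional, the base point \<open>a\<close> would satisfy the equation of the second
  line mod \<open>p\<close>, so some point of the second line would be congruent to it.
\<close>

lemma separated_lines_independent_mod_p:
  assumes a: "a \<in> plane p k" "a' \<in> plane p k" and b: "b \<in> unimodular p k" "b' \<in> unimodular p k"
    and sep: "separated_in_direction p k (line p k a b) (line p k a' b') \<or>
      separated_in_distance p k (line p k a b) (line p k a' b')"
  defines "c \<equiv> fst b * snd a - snd b * fst a" and "c' \<equiv> fst b' * snd a' - snd b' * fst a'"
  shows "\<not> (int p dvd snd b * (- fst b') - snd b' * (- fst b) \<and> int p dvd snd b * c' - snd b' * c \<and>
    int p dvd (- fst b) * c' - (- fst b') * c)"
proof
  assume minors: "int p dvd snd b * (- fst b') - snd b' * (- fst b) \<and> int p dvd snd b * c' - snd b' * c \<and>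
    int p dvd (- fst b) * c' - (- fst b') * c"
  have "snd b * fst b' - snd b' * fst b = - (snd b * (- fst b') - snd b' * (- fst b))" by simp
  then have par: "int p dvd snd b * fst b' - snd b' * fst b" using minors by (simp only: dvd_minus_iff)
  let ?D = "snd b' * fst a + - fst b' * snd a + c'"
  have "snd b * ?D = (snd b * c' - snd b' * c) + - snd a * (snd b * fst b' - snd b' * fst b)"
    by (simp add: c_def algebra_simps)
  then have "int p dvd snd b * ?D" using minors par by (metis dvd_add dvd_mult)
  moreover have "fst b * ?D = - ((- fst b) * c' - (- fst b') * c) + - fst a * (snd b * fst b' - snd b' * fst b)"
    by (simp add: c_def algebra_simps)
  then have "int p dvd fst b * ?D" using minors par by (metis dvd_add dvd_mult dvd_minus_iff)
  moreover have "prime (int p)" using prime_p by simp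
  ultimately have D: "int p dvd ?D" using unimodular_mod_p[OF b(1)] prime_dvd_mult_iff by blast
  obtain t where t: "int p dvd fst a - (fst a' + t * fst b')" "int p dvd snd a - (snd a' + t * snd b')"
    using exists_line_parameter[OF b(2) p_dvd_pk D[unfolded c'_def]] by blast
  define y where "y = ((fst a' + t * fst b') mod int p ^ k, (snd a' + t * snd b') mod int p ^ k)"
  have y: "y \<in> line p k a' b'" unfolding line_eq y_def by blast
  have x: "a \<in> line p k a b" unfolding mem_line_iff[OF b(1)] using a by (simp add: algebra_simps)
  have red: "int p dvd u - v mod int p ^ k" if "int p dvd u - v" for u v
    using that p_dvd_pk by (metis mod_eq_dvd_iff mod_mod_cancel)
  have "int p dvd fst a - fst y \<and> int p dvd snd a - snd y" using t red by (simp add: y_def)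
  then show False using separated_parallel_lines_disjoint_mod_p[OF a b sep par x y] by blast
qed

end

lemma card_incidences:
  assumes "finite P" "finite L"
  shows "real (card (incidences P L)) = (\<Sum>q\<in>P. real (card {l \<in> L. q \<in> l}))"
proof -
  have "incidences P L = {(q, l). q \<in> P \<and> l \<in> L \<and> q \<in> l}" by (simp add: incidences_def)
  then show ?thesis using card_filter_pairs[OF assms, of "\<lambda>q l. q \<in> l"] by simp
qed

lemma separated_lines_incidence_bound:
  fixes K n :: real
  assumes prime_p: "prime p" and k: "1 \<le> k" and P: "P \<subseteq> plane p k" and L: "L \<subseteq> lines p k"
    and sep: "\<And>l l'. l \<in> L \<Longrightarrow> l' \<in> L \<Longrightarrow> l \<noteq> l' \<Longrightarrow>
      separated_in_direction p k l l' \<or> separated_in_distance p k l l'"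
    and finL: "finite L"
    and K: "K \<ge> 2" and n: "n > 0" and card: "card P \<le> n\<^sup>2" "card L \<le> n\<^sup>2"
    and rich: "n ^ 3 / K \<le> card (incidences P L)"
  shows "n \<le> K ^ 11146051 \<or> p \<le> K ^ 11146051 * n"
proof -
  have finP: "finite P" using P finite_plane[OF prime_p k] finite_subset by blast
  have "\<forall>l\<in>L. \<exists>z. fst z \<in> plane p k \<and> snd z \<in> unimodular p k \<and> l = line p k (fst z) (snd z)"
    using L unfolding lines_def by fastforce
  from bchoice[OF this] obtain z where z: "\<And>l. l \<in> L \<Longrightarrow>
      fst (z l) \<in> plane p k \<and> snd (z l) \<in> unimodular p k \<and> l = line p k (fst (z l)) (snd (z l))"
    by blast
  define a b where "a l = fst (z l)" and "b l = snd (z l)" for l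
  have a: "a l \<in> plane p k" and b: "b l \<in> unimodular p k" and l: "l = line p k (a l) (b l)" if "l \<in> L" for l
    using z[OF that] by (auto simp: a_def b_def)
  interpret separated_lines p k L "\<lambda>l. snd (b l)" "\<lambda>l. - fst (b l)"
    "\<lambda>l. fst (b l) * snd (a l) - snd (b l) * fst (a l)"
  proof
    fix l assume "l \<in> L"
    then show "\<not> (int p dvd snd (b l) \<and> int p dvd - fst (b l))"
      using unimodular_mod_p[OF prime_p k b] by auto
  next
    fix l l' assume ll: "l \<in> L" "l' \<in> L" "l \<noteq> l'"
    have "separated_in_direction p k (line p k (a l) (b l)) (line p k (a l') (b l')) \<or>
      separated_in_distance p k (line p k (a l) (b l)) (line p k (a l') (b l'))"
      using sep[OF ll] l[OF ll(1)] l[OF ll(2)] by metis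
    from separated_lines_independent_mod_p[OF prime_p k a[OF ll(1)] a[OF ll(2)] b[OF ll(1)] b[OF ll(2)] this]
    show "\<not> (int p dvd snd (b l) * - fst (b l') - snd (b l') * - fst (b l) \<and>
          int p dvd snd (b l) * (fst (b l') * snd (a l') - snd (b l') * fst (a l')) -
            snd (b l') * (fst (b l) * snd (a l) - snd (b l) * fst (a l)) \<and>
          int p dvd - fst (b l) * (fst (b l') * snd (a l') - snd (b l') * fst (a l')) -
            - fst (b l') * (fst (b l) * snd (a l) - snd (b l) * fst (a l)))" .
  qed (use prime_p k finL in auto)
  have on: "q \<in> l \<longleftrightarrow> on_line q l" if "q \<in> P" "l \<in> L" for q l
  proof -
    have "q \<in> l \<longleftrightarrow> q \<in> line p k (a l) (b l)" using l[OF that(2)] by simp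
    then show ?thesis
      using mem_line_iff[OF prime_p k b[OF that(2)], of q "a l"] P that(1) unfolding on_line_def by auto
  qed
  have "card (incidences P L) = (\<Sum>q\<in>P. real (card {l \<in> L. on_line q l}))"
    unfolding card_incidences[OF finP finL]
    by (intro sum.cong refl arg_cong[where f = card] arg_cong[where f = real]) (use on in auto)
  moreover have "\<not> (int p ^ k dvd fst q - fst q' \<and> int p ^ k dvd snd q - snd q')"
    if "q \<in> P" "q' \<in> P" "q \<noteq> q'" for q q'
    using plane_eqI[OF prime_p k, of q q'] that P by blast
  ultimately show ?thesis using rich by (intro incidence_bound[OF K n finP _ card]) auto
qed

theorem theorem1p1:
  fixes \<alpha> :: real
  assumes "0 < \<alpha>" and "\<alpha> < 2"
  shows "\<exists>\<epsilon>>0. \<exists>C>0. \<forall>(p::nat) (k::nat) P L.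
    prime p \<longrightarrow> 1 \<le> k \<longrightarrow>
    P \<subseteq> plane p k \<longrightarrow> L \<subseteq> lines p k \<longrightarrow>
    (\<forall>l\<in>L. \<forall>l'\<in>L. l \<noteq> l' \<longrightarrow>
       separated_in_direction p k l l' \<or> separated_in_distance p k l l') \<longrightarrow>
    real (card P) \<le> real p powr \<alpha> \<longrightarrow> real (card L) \<le> real p powr \<alpha> \<longrightarrow>
    real (card (incidences P L)) \<le> C * (real p powr \<alpha>) powr (3 / 2 - \<epsilon>)"
proof -
  define c :: real where "c = 11146051"
  \<comment> \<open>With \<open>K = N\<^sup>\<epsilon>\<close> and \<open>\<epsilon> c = \<delta>/2\<close>, the alternatives \<open>n \<le> K\<^sup>c\<close> and \<open>p \<le> K\<^sup>c n\<close> read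
    \<open>1/2 \<le> \<delta>/2\<close> and \<open>1/\<alpha> \<le> \<delta>/2 + 1/2\<close> in exponents of \<open>N\<close>.\<close>
  define \<delta> where "\<delta> = min (1 / 2) (1 / \<alpha> - 1 / 2)"
  define \<epsilon> where "\<epsilon> = \<delta> / (2 * c)"
  define C :: real where "C = 2 powr (2 / \<epsilon>)"
  have "1 / 2 < 1 / \<alpha>" using assms by (simp add: field_simps)
  then have \<delta>: "0 < \<delta>" "\<delta> \<le> 1 / 2" "\<delta> \<le> 1 / \<alpha> - 1 / 2"
    unfolding \<delta>_def by (simp_all only: min_less_iff_conj min.cobounded1 min.cobounded2) simp
  have c: "c > 0" by (simp add: c_def)
  have \<epsilon>: "0 < \<epsilon>" "\<epsilon> * c = \<delta> / 2" "\<epsilon> \<le> 1" using \<delta> by (auto simp: \<epsilon>_def c_def)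
  have C1: "1 \<le> C" using \<epsilon> by (simp add: C_def ge_one_powr_ge_zero)
  have main: "real (card (incidences P L)) \<le> C * (real p powr \<alpha>) powr (3 / 2 - \<epsilon>)"
    if p: "prime p" and k: "1 \<le> k" and P: "P \<subseteq> plane p k" and L: "L \<subseteq> lines p k"
      and sep: "\<forall>l\<in>L. \<forall>l'\<in>L. l \<noteq> l' \<longrightarrow>
       separated_in_direction p k l l' \<or> separated_in_distance p k l l'"
      and cP: "real (card P) \<le> real p powr \<alpha>" and cL: "real (card L) \<le> real p powr \<alpha>"
    for p k :: nat and P L
  proof -
    define N where "N = real p powr \<alpha>"
    have p1: "1 < real p" using prime_gt_1_nat[OF p] by simp
    have N1: "1 < N" using p1 assms by (simp add: N_def)
    have finP: "finite P" using P finite_plane[OF p k] finite_subset by blast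
    have "lines p k \<subseteq> Pow (plane p k)" using mem_line_iff[OF p k] by (auto simp: lines_def)
    then have finL: "finite L" using L finite_plane[OF p k] by (meson finite_Pow_iff finite_subset)
    show ?thesis
    \<comment> \<open>In the first case \<open>N\<close> is bounded in terms of \<open>\<epsilon>\<close>, and \<open>C\<close> is so large that the trivial bound \<open>N\<^sup>2\<close> suffices.\<close>
    proof (cases "N powr \<epsilon> < 2")
      case True
      have "N = (N powr \<epsilon>) powr (1 / \<epsilon>)" using \<epsilon> N1 by (simp add: powr_powr)
      also have "\<dots> \<le> 2 powr (1 / \<epsilon>)" using True \<epsilon> N1 by (intro powr_mono2) auto
      finally have N2: "N \<le> 2 powr (1 / \<epsilon>)" .
      have "incidences P L \<subseteq> P \<times> L" by (auto simp: incidences_def)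
      then have "card (incidences P L) \<le> card (P \<times> L)" using finP finL by (intro card_mono) auto
      also have "real (card (P \<times> L)) \<le> N * N"
        using cP cL by (simp add: card_cartesian_product N_def mult_mono)
      also have "\<dots> \<le> 2 powr (1 / \<epsilon>) * 2 powr (1 / \<epsilon>)" using N2 N1 by (intro mult_mono) auto
      also have "\<dots> = C * 1" by (simp add: C_def flip: powr_add)
      also have "\<dots> \<le> C * N powr (3 / 2 - \<epsilon>)"
        using C1 N1 \<epsilon> by (intro mult_left_mono ge_one_powr_ge_zero) auto
      finally show ?thesis by (simp add: N_def)
    next
      case False
      define K n where "K = N powr \<epsilon>" and "n = N powr (1 / 2)"
      have K: "K \<ge> 2" using False by (simp add: K_def)
      have n: "n > 0" using N1 by (simp add: n_def)
      have n2: "n\<^sup>2 = N" using N1 by (simp add: n_def powr_power)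
      have n3: "n ^ 3 / K = N powr (3 / 2 - \<epsilon>)"
        using N1 by (simp add: n_def K_def powr_power powr_diff)
      show ?thesis
      proof (rule ccontr)
        assume "\<not> ?thesis"
        then have many: "C * N powr (3 / 2 - \<epsilon>) < card (incidences P L)" by (simp add: N_def)
        have "n ^ 3 / K \<le> C * N powr (3 / 2 - \<epsilon>)" unfolding n3 using C1 mult_right_mono[OF C1, of "N powr (3 / 2 - \<epsilon>)"] by simp
        then have rich: "n ^ 3 / K \<le> card (incidences P L)" using many by linarith
        have "n \<le> K ^ 11146051 \<or> p \<le> K ^ 11146051 * n"
        proof (rule separated_lines_incidence_bound[OF p k P L _ finL K n _ _ rich])
          show "separated_in_direction p k l l' \<or> separated_in_distance p k l l'"
            if "l \<in> L" "l' \<in> L" "l \<noteq> l'" for l l' using sep that by blast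
        qed (use cP cL n2 in \<open>auto simp: N_def\<close>)
        moreover have "K ^ 11146051 = N powr (\<delta> / 2)"
        proof -
          have "K powr real (11146051 :: nat) = K ^ 11146051" using K by (intro powr_realpow) simp
          then have "K ^ 11146051 = K powr c" by (simp add: c_def)
          then show ?thesis by (simp add: K_def powr_powr \<epsilon>(2))
        qed
        moreover have "real p = N powr (1 / \<alpha>)" using p1 assms by (simp add: N_def powr_powr)
        ultimately have "N powr (1 / 2) \<le> N powr (\<delta> / 2) \<or> N powr (1 / \<alpha>) \<le> N powr (\<delta> / 2) * N powr (1 / 2)"
          by (simp add: n_def)
        then have "1 / 2 \<le> \<delta> / 2 \<or> 1 / \<alpha> \<le> \<delta> / 2 + 1 / 2"
          using N1 by (simp flip: powr_add)
        then show False using \<delta> by linarith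
      qed
    qed
  qed
  show ?thesis
    by (rule exI[of _ \<epsilon>], rule conjI[OF \<epsilon>(1)], rule exI[of _ C]) (use C1 main in auto)
qed

end
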